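(* Let $d\ge 2$ and let $(J_x)_{x\in\Sigma}$ be i.i.d. weights with a good distribution that additionally satisfy $\mathbb E|J_x|^{4+\delta}<\infty$ for some $\delta>0$. For $n\ge3$ let $M_n$ be the (a.s. unique) ground state of the monomer-dimer model on $\mathbb T_n^d$ with these weights. Then, as $n\to\infty$, \[\frac{H(M_n)-\mathbb E H(M_n)}{\sqrt{\operatorname{Var} H(M_n)}}\to N(0,1)\] in distribution.
   Context: $\mathbb T_n^d=(\mathbb Z/n\mathbb Z)^d$ with nearest-neighbour edges; $\Sigma$ denotes vertices and edges (of $\mathbb Z^d$, or of the torus via the identification of torus vertices with $\{0,\dots,n-1\}^d$ and of the torus edge joining $v,v+e_i\pmod n$ with the edge $(v,v+e_i)$). A matching is a set $M$ of vertices and edges such that every vertex either belongs to $M$ (monomer) or is an endpoint of exactly one edge of $M$ (dimer), but not both. $H(M)=\sum_{x\in M}J_x$; the ground state is a matching minimising $H$. A good distribution: values in $[\beta,\infty)$ for some $\beta\in\{-\infty\}\cup\mathbb R$, continuous density $p$ with $p>0$ on $(\beta,\infty)$, and for some $\alpha>1$, $C(z,\alpha)=\int_\beta^\infty (p(x-z)/p(x))^\alpha p(x)\,dx$ is finite and continuous in $z>0$. *)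

theory Defs
  imports "HOL-Probability.Probability"
begin

text \<open>Points of Z^d are integer lists of length d.  A site of Sigma is either a vertex
  Vtx v, or the nearest-neighbour edge Edg v i joining v and v + e_i (i < d).\<close>

datatype site = Vtx "int list" | Edg "int list" nat

definition sites_Zd :: "nat \<Rightarrow> site set" where
  "sites_Zd d = {Vtx v | v. length v = d} \<union> {Edg v i | v i. length v = d \<and> i < d}"

definition torus_vertices :: "nat \<Rightarrow> nat \<Rightarrow> int list set" where
  "torus_vertices n d = {v. length v = d \<and> (\<forall>k<d. 0 \<le> v ! k \<and> v ! k < int n)}"

definition torus_shift :: "nat \<Rightarrow> int list \<Rightarrow> nat \<Rightarrow> int list" where
  "torus_shift n v i = v[i := (v ! i + 1) mod int n]"

text \<open>Sites of the torus: its vertices and its edges (v, v+e_i mod n), the latter identified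
  with the edge Edg v i of Z^d.\<close>
definition torus_sites :: "nat \<Rightarrow> nat \<Rightarrow> site set" where
  "torus_sites n d = {Vtx v | v. v \<in> torus_vertices n d}
      \<union> {Edg v i | v i. v \<in> torus_vertices n d \<and> i < d}"

fun covers :: "nat \<Rightarrow> site \<Rightarrow> int list set" where
  "covers n (Vtx v) = {v}"
| "covers n (Edg v i) = {v, torus_shift n v i}"

definition matching :: "nat \<Rightarrow> nat \<Rightarrow> site set \<Rightarrow> bool" where
  "matching n d M \<longleftrightarrow> M \<subseteq> torus_sites n d \<and>
     (\<forall>v \<in> torus_vertices n d. card {x \<in> M. v \<in> covers n x} = 1)"

definition energy :: "(site \<Rightarrow> real) \<Rightarrow> site set \<Rightarrow> real" where
  "energy J M = (\<Sum>x\<in>M. J x)"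

definition ground_state :: "nat \<Rightarrow> nat \<Rightarrow> (site \<Rightarrow> real) \<Rightarrow> site set \<Rightarrow> bool" where
  "ground_state n d J M \<longleftrightarrow> matching n d M \<and>
     (\<forall>M'. matching n d M' \<longrightarrow> energy J M \<le> energy J M')"

definition ground_state_energy :: "nat \<Rightarrow> nat \<Rightarrow> (site \<Rightarrow> real) \<Rightarrow> real" where
  "ground_state_energy n d J = energy J (SOME M. ground_state n d J M)"

definition good_distribution :: "real measure \<Rightarrow> bool" where
  "good_distribution \<mu> \<longleftrightarrow>
    (\<exists>p :: real \<Rightarrow> real. \<exists>\<beta> :: ereal. \<beta> \<noteq> \<infinity> \<and>
       \<mu> = density lborel (\<lambda>x. ennreal (p x)) \<and>
       (\<forall>x. ereal x < \<beta> \<longrightarrow> p x = 0) \<and>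
       (\<forall>x. \<beta> < ereal x \<longrightarrow> p x > 0) \<and>
       continuous_on {x. \<beta> < ereal x} p \<and>
       (\<exists>\<alpha> > 1.
          (\<forall>z > 0. set_integrable lborel {x. \<beta> < ereal x}
                      (\<lambda>x. (p (x - z) / p x) powr \<alpha> * p x)) \<and>
          continuous_on {0<..}
            (\<lambda>z. LINT x : {x. \<beta> < ereal x} | lborel. (p (x - z) / p x) powr \<alpha> * p x)))"

end

theory Submission
  imports Defs
begin

text \<open>
  The ground state energy \<open>H(V)\<close> of a vertex set \<open>V\<close> is the minimal energy of an exact cover of \<open>V\<close>.
  Removing one vertex from \<open>V\<close> changes the set of monomers of a suitable optimum in at most one
  vertex (follow the alternating path), so removing a set \<open>W\<close> of walls changes it in at most \<open>|W|\<close> vertices.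
  On the other hand, \<open>H(V) - H(V - {v})\<close> is the minimum of \<open>J_x + h_x\<close> over the sites \<open>x\<close> covering \<open>v\<close>,
  where the cavity fields \<open>h_x\<close> do not depend on the weights at \<open>v\<close>.  If the cavity fields before and
  after the removal of \<open>W\<close> differ substantially, then with a conditional probability bounded below the
  weights at \<open>v\<close> are such that \<open>v\<close> is a monomer in exactly one of the two optima.  Hence the cavity
  fields are nearly unchanged at most vertices as soon as \<open>|W|\<close> is a small fraction of the volume, and by the
  Efron-Stein inequality \<open>Var (H(V) - H(V - W))\<close> is a small fraction of the volume.
  Cutting the torus into large cubes makes \<open>H(V - W)\<close> a sum of i.i.d. variables, and \<open>Var H(V)\<close> is at
  least of the order of the volume, so the classical central limit theorem carries over.
\<close>

section \<open>Exact covers and their minimal energy\<close>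

text \<open>The obstacle is that an alternating path can be arbitrarily long, so removing one vertex
  may change the optimum far away, and no decay of correlations is invoked. What survives is a
  deterministic count: however long the path, the monomer status changes at no more than one vertex.
  In expectation, the probabilities that the status of \<open>v\<close> differs sum to at most
  \<open>card W\<close>. The weights at \<open>v\<close> are independent of the cavity fields at
  \<open>v\<close>, so a discrepancy of the fields by more than \<eta> costs at most a constant
  factor over a change of status. That constant depends on \<eta> but not on the volume. The cube
  side \<open>k\<close> is chosen after all these constants and stays fixed while \<open>n\<close>
  grows; an error of \<epsilon> times the volume is then compared with a variance of the order of
  the volume. For the lower bound on the variance, the energy is tested against a sum of independent
  functions of the monomer weights. Sites are abstract and cover one or two vertices, so the same
  lemmas serve the torus for every \<open>n\<close>, its subsets, and the cubes.\<close>

definition exact_covers :: "('s \<Rightarrow> 'v set) \<Rightarrow> 's set \<Rightarrow> 'v set \<Rightarrow> 's set set" where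
  "exact_covers cov S V =
     {M. M \<subseteq> S \<and> (\<forall>x\<in>M. cov x \<subseteq> V) \<and> (\<forall>v\<in>V. \<exists>!x. x \<in> M \<and> v \<in> cov x)}"

definition cover_energy :: "('s \<Rightarrow> 'v set) \<Rightarrow> 's set \<Rightarrow> 'v set \<Rightarrow> ('s \<Rightarrow> real) \<Rightarrow> real" where
  "cover_energy cov S V J = Min (sum J ` exact_covers cov S V)"

locale cover_system =
  fixes cov :: "'s \<Rightarrow> 'v set" and S :: "'s set" and U :: "'v set" and mon :: "'v \<Rightarrow> 's"
  assumes finite_S: "finite S" and finite_U: "finite U"
    and cov_subset: "x \<in> S \<Longrightarrow> cov x \<subseteq> U"
    and cov_cases: "x \<in> S \<Longrightarrow> (\<exists>v. cov x = {v}) \<or> (\<exists>v w. v \<noteq> w \<and> cov x = {v, w})"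
    and mon_in: "v \<in> U \<Longrightarrow> mon v \<in> S" and cov_mon: "v \<in> U \<Longrightarrow> cov (mon v) = {v}"
begin

abbreviation "EC \<equiv> exact_covers cov S"
abbreviation "H \<equiv> cover_energy cov S"

definition optimal :: "'v set \<Rightarrow> ('s \<Rightarrow> real) \<Rightarrow> 's set \<Rightarrow> bool" where
  "optimal V J M \<longleftrightarrow> M \<in> EC V \<and> sum J M = H V J"

definition sites_at :: "'v \<Rightarrow> 's set" where
  "sites_at v = {x \<in> S. v \<in> cov x}"

definition monomers :: "'s set \<Rightarrow> 'v set" where
  "monomers M = {v \<in> U. mon v \<in> M}"

section \<open>Recursion for the minimal energy\<close>

lemma cov_nonempty: "x \<in> S \<Longrightarrow> cov x \<noteq> {}"
  using cov_cases by fastforce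

lemma cov_other:
  assumes "x \<in> S" "v \<in> cov x" "cov x \<noteq> {v}" shows "\<exists>b. b \<noteq> v \<and> cov x = {v, b}"
  using cov_cases[OF assms(1)]
proof (elim disjE exE conjE)
  fix u w assume "u \<noteq> w" "cov x = {u, w}"
  then show ?thesis using assms(2) by (cases "v = u") (auto simp: insert_commute)
qed (use assms in auto)

lemma finite_EC: "finite (EC V)"
  by (rule finite_subset[of _ "Pow S"]) (auto simp: exact_covers_def finite_S)

lemma finite_EC_elem: "M \<in> EC V \<Longrightarrow> finite M"
  using finite_S by (auto simp: exact_covers_def intro: finite_subset)

lemma mon_image_EC:
  assumes "V \<subseteq> U" shows "mon ` V \<in> EC V"
proof -
  have "\<exists>!x. x \<in> mon ` V \<and> v \<in> cov x" if "v \<in> V" for v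
  proof (rule ex1I[of _ "mon v"])
    show "mon v \<in> mon ` V \<and> v \<in> cov (mon v)" using that assms cov_mon by auto
    fix x assume "x \<in> mon ` V \<and> v \<in> cov x"
    then show "x = mon v" using assms cov_mon by (metis imageE singletonD subsetD)
  qed
  moreover have "cov x \<subseteq> V" if "x \<in> mon ` V" for x
    using that assms cov_mon by auto
  moreover have "mon ` V \<subseteq> S" using assms mon_in by auto
  ultimately show ?thesis by (simp add: exact_covers_def)
qed

lemma H_le: "M \<in> EC V \<Longrightarrow> H V J \<le> sum J M"
  unfolding cover_energy_def by (rule Min_le) (auto simp: finite_EC)

lemma optimal_exists:
  assumes "V \<subseteq> U" shows "\<exists>M. optimal V J M"
proof -
  have "Min (sum J ` EC V) \<in> sum J ` EC V"
    using mon_image_EC[OF assms] finite_EC by (intro Min_in) auto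
  then show ?thesis unfolding optimal_def cover_energy_def by force
qed

lemma EC_insert:
  assumes "x \<in> S" "cov x \<subseteq> V" "M \<in> EC (V - cov x)"
  shows "x \<notin> M" "insert x M \<in> EC V"
proof -
  have M: "M \<subseteq> S" "\<And>y. y \<in> M \<Longrightarrow> cov y \<subseteq> V - cov x"
    "\<And>v. v \<in> V - cov x \<Longrightarrow> \<exists>!y. y \<in> M \<and> v \<in> cov y"
    using assms(3) by (auto simp: exact_covers_def)
  show "x \<notin> M" using M(2)[of x] cov_nonempty[OF assms(1)] by auto
  have "\<exists>!y. y \<in> insert x M \<and> v \<in> cov y" if "v \<in> V" for v
  proof (cases "v \<in> cov x")
    case True
    then show ?thesis using M(2) by (intro ex1I[of _ x]) auto
  next
    case False
    then have "\<exists>!y. y \<in> M \<and> v \<in> cov y" using M(3) that by auto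
    then show ?thesis using False by (metis insert_iff)
  qed
  moreover have "cov y \<subseteq> V" if "y \<in> insert x M" for y using that M(2)[of y] assms(2) by blast
  ultimately show "insert x M \<in> EC V" using M(1) assms(1) by (simp add: exact_covers_def)
qed

lemma EC_remove:
  assumes "M \<in> EC V" "x \<in> M" shows "M - {x} \<in> EC (V - cov x)"
proof -
  have M: "M \<subseteq> S" "\<And>y. y \<in> M \<Longrightarrow> cov y \<subseteq> V"
    "\<And>v. v \<in> V \<Longrightarrow> \<exists>!y. y \<in> M \<and> v \<in> cov y"
    using assms(1) by (auto simp: exact_covers_def)
  have disj: "cov y \<inter> cov x = {}" if "y \<in> M" "y \<noteq> x" for y
    using M(2,3) that assms(2) by blast
  have "\<exists>!y. y \<in> M - {x} \<and> v \<in> cov y" if "v \<in> V - cov x" for v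
    using M(3)[of v] that by (metis DiffD1 DiffD2 DiffI singletonD)
  moreover have "cov y \<subseteq> V - cov x" if "y \<in> M - {x}" for y using that M(2)[of y] disj[of y] by blast
  ultimately show ?thesis using M(1) by (simp add: exact_covers_def subset_insertI2 Diff_subset subset_trans[of _ M])
qed

lemma H_step_le:
  assumes "x \<in> S" "cov x \<subseteq> V" "V \<subseteq> U" shows "H V J \<le> J x + H (V - cov x) J"
proof -
  obtain M where M: "M \<in> EC (V - cov x)" "sum J M = H (V - cov x) J"
    using optimal_exists[of "V - cov x" J] assms(3) unfolding optimal_def by blast
  have "H V J \<le> sum J (insert x M)" using EC_insert[OF assms(1,2) M(1)] by (intro H_le) auto
  also have "\<dots> = J x + sum J M"
    using EC_insert[OF assms(1,2) M(1)] finite_EC_elem[OF M(1)] by simp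
  finally show ?thesis using M by simp
qed

text \<open>Bellman principle: deleting \<open>x\<close> from an optimum leaves a cover of
  \<open>V - cov x\<close>, while \<open>H_step_le\<close> bounds \<open>H V J\<close> from the
  other side. Both inequalities are therefore equalities, and what is left is again optimal.\<close>

lemma optimal_remove:
  assumes "optimal V J M" "x \<in> M" "V \<subseteq> U"
  shows "H V J = J x + H (V - cov x) J" "optimal (V - cov x) J (M - {x})"
proof -
  have M: "M \<in> EC V" "sum J M = H V J" using assms(1) by (auto simp: optimal_def)
  have x: "x \<in> S" "cov x \<subseteq> V" using M(1) assms(2) by (auto simp: exact_covers_def)
  have "sum J M = J x + sum J (M - {x})"
    using finite_EC_elem[OF M(1)] assms(2) by (simp add: sum.remove)
  moreover have "H (V - cov x) J \<le> sum J (M - {x})" using EC_remove[OF M(1) assms(2)] by (rule H_le)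
  ultimately have "H V J = J x + H (V - cov x) J \<and> sum J (M - {x}) = H (V - cov x) J"
    using H_step_le[OF x assms(3), of J] M(2) by linarith
  then show "H V J = J x + H (V - cov x) J" "optimal (V - cov x) J (M - {x})"
    using EC_remove[OF M(1) assms(2)] by (auto simp: optimal_def)
qed

lemma optimal_insert:
  assumes "optimal (V - cov x) J M" "x \<in> S" "cov x \<subseteq> V" "H V J = J x + H (V - cov x) J"
  shows "optimal V J (insert x M)"
  using assms EC_insert[OF assms(2,3), of M] finite_EC_elem[of M "V - cov x"]
  by (auto simp: optimal_def)

lemma optimal_covers:
  assumes "optimal V J M" "v \<in> V" shows "\<exists>x\<in>M. x \<in> S \<and> v \<in> cov x \<and> cov x \<subseteq> V"
  using assms by (fastforce simp: optimal_def exact_covers_def)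

lemma H_attained:
  assumes "V \<subseteq> U" "v \<in> V"
  shows "\<exists>x\<in>S. v \<in> cov x \<and> cov x \<subseteq> V \<and> H V J = J x + H (V - cov x) J"
  using optimal_exists[OF assms(1), of J] optimal_covers[OF _ assms(2)] optimal_remove(1)[OF _ _ assms(1)]
  by metis

section \<open>Monomers under removal of vertices\<close>

lemma monomers_Diff_insert:
  assumes "cov x = {w, u}" "w \<noteq> u"
  shows "monomers (M - {x}) = monomers M" "monomers (insert x M) = monomers M"
proof -
  have "mon v \<noteq> x" if "v \<in> U" for v
  proof
    assume "mon v = x"
    then have "{w, u} = {v}" using assms(1) cov_mon[OF that] by simp
    then show False using assms(2) by (metis doubleton_eq_iff insert_absorb2)
  qed
  then show "monomers (M - {x}) = monomers M" "monomers (insert x M) = monomers M"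
    by (auto simp: monomers_def)
qed

lemma monomers_single:
  assumes "cov x = {w}"
  shows "card (sym_diff (monomers M) (monomers (M - {x}))) \<le> 1"
    "card (sym_diff (monomers (insert x M)) (monomers M)) \<le> 1"
proof -
  have "v = w" if "v \<in> U" "mon v = x" for v using assms cov_mon[OF that(1)] that(2) by simp
  then have "sym_diff (monomers M) (monomers (M - {x})) \<subseteq> {w}"
    "sym_diff (monomers (insert x M)) (monomers M) \<subseteq> {w}"
    by (auto simp: monomers_def)
  then show "card (sym_diff (monomers M) (monomers (M - {x}))) \<le> 1"
    "card (sym_diff (monomers (insert x M)) (monomers M)) \<le> 1"
    using card_mono[of "{w}"] by fastforce+
qed

text \<open>If \<open>w\<close> is matched to \<open>u\<close> in the optimum of \<open>V\<close>, the pair \<open>(V, V - {w})\<close> reduces to the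
  pair \<open>(V - {w} - {u}, V - {w})\<close> with the roles exchanged.  Hence both directions are proved
  simultaneously; the recursion follows the alternating path started at \<open>w\<close>.\<close>
lemma monomers_remove_one:
  assumes "V \<subseteq> U" "w \<in> V"
  shows "\<And>M. optimal V J M \<Longrightarrow>
      \<exists>M'. optimal (V - {w}) J M' \<and> card (sym_diff (monomers M) (monomers M')) \<le> 1"
    and "\<And>M'. optimal (V - {w}) J M' \<Longrightarrow>
      \<exists>M. optimal V J M \<and> card (sym_diff (monomers M) (monomers M')) \<le> 1"
proof -
  have "(\<forall>M. optimal V J M \<longrightarrow>
      (\<exists>M'. optimal (V - {w}) J M' \<and> card (sym_diff (monomers M) (monomers M')) \<le> 1)) \<and>
    (\<forall>M'. optimal (V - {w}) J M' \<longrightarrow>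
      (\<exists>M. optimal V J M \<and> card (sym_diff (monomers M) (monomers M')) \<le> 1))"
    using assms
  proof (induction "card V" arbitrary: V w rule: less_induct)
    case less
    have fin: "finite V" using less.prems finite_U finite_subset by blast
    have cases: "cov x = {w} \<or> (\<exists>u. u \<noteq> w \<and> u \<in> V \<and> cov x = {w, u})"
      if "x \<in> S" "w \<in> cov x" "cov x \<subseteq> V" for x
      using cov_cases[OF that(1)] that(2,3) by (elim disjE exE conjE) (auto simp: insert_commute)
    \<comment> \<open>The smaller pair consists of \<open>V - {w}\<close> and
      \<open>V - {w} - {u}\<close>. \<open>IH1\<close> removes \<open>u\<close>, \<open>IH2\<close>
      puts it back.\<close>
    have IH1: "\<exists>M'. optimal (V - {w} - {u}) J M' \<and> card (sym_diff (monomers M) (monomers M')) \<le> 1"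
      if "u \<noteq> w" "u \<in> V" "optimal (V - {w}) J M" for u M
      using less.hyps[of "V - {w}" u] card_Diff1_less[OF fin less.prems(2)] less.prems that by auto
    have IH2: "\<exists>M. optimal (V - {w}) J M \<and> card (sym_diff (monomers M) (monomers M')) \<le> 1"
      if "u \<noteq> w" "u \<in> V" "optimal (V - {w} - {u}) J M'" for u M'
      using less.hyps[of "V - {w}" u] card_Diff1_less[OF fin less.prems(2)] less.prems that by auto
    show ?case
    proof (intro conjI allI impI)
      fix M assume M: "optimal V J M"
      obtain x where x: "x \<in> M" "x \<in> S" "w \<in> cov x" "cov x \<subseteq> V"
        using optimal_covers[OF M less.prems(2)] by blast
      from cases[OF x(2-4)] show
        "\<exists>M'. optimal (V - {w}) J M' \<and> card (sym_diff (monomers M) (monomers M')) \<le> 1"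
      proof (elim disjE exE conjE)
        assume c: "cov x = {w}"
        then show ?thesis
          using optimal_remove(2)[OF M x(1) less.prems(1)] monomers_single(1)[OF c] by auto
      next
        fix u assume u: "u \<noteq> w" "u \<in> V" and c: "cov x = {w, u}"
        \<comment> \<open>A dimer is not a monomer, so deleting \<open>x\<close> keeps
          \<open>monomers M\<close> and the bound is inherited from the smaller pair. The difference
          of one arises only where the path ends in a site covering a single vertex.\<close>
        have "optimal (V - {w} - {u}) J (M - {x})"
          using optimal_remove(2)[OF M x(1) less.prems(1)] c by (metis Diff_insert insert_commute)
        from IH2[OF u this] show ?thesis
          using monomers_Diff_insert(1)[OF c] u(1) by (metis Un_commute)
      qed
    next
      fix M' assume M': "optimal (V - {w}) J M'"
      \<comment> \<open>\<open>x\<close> belongs to some optimum of \<open>V\<close>, chosen without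
        regard to \<open>M'\<close>. Optima need not be unique, so only a suitable partner of
        \<open>M'\<close> is claimed.\<close>
      obtain x where x: "x \<in> S" "w \<in> cov x" "cov x \<subseteq> V" "H V J = J x + H (V - cov x) J"
        using H_attained[OF less.prems] by blast
      from cases[OF x(1-3)] show
        "\<exists>M. optimal V J M \<and> card (sym_diff (monomers M) (monomers M')) \<le> 1"
      proof (elim disjE exE conjE)
        assume c: "cov x = {w}"
        then show ?thesis
          using optimal_insert[OF _ x(1,3,4), of M'] M' monomers_single(2)[OF c] by auto
      next
        fix u assume u: "u \<noteq> w" "u \<in> V" and c: "cov x = {w, u}"
        obtain M'' where M'': "optimal (V - {w} - {u}) J M''"
          "card (sym_diff (monomers M') (monomers M'')) \<le> 1"
          using IH1[OF u M'] by blast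
        have "V - cov x = V - {w} - {u}" using c by auto
        then have "optimal V J (insert x M'')"
          using optimal_insert[OF _ x(1,3,4)] M'' by simp
        then show ?thesis
          using monomers_Diff_insert(2)[OF c] u(1) M''(2) by (metis Un_commute)
      qed
    qed
  qed
  then show "\<And>M. optimal V J M \<Longrightarrow>
      \<exists>M'. optimal (V - {w}) J M' \<and> card (sym_diff (monomers M) (monomers M')) \<le> 1"
    and "\<And>M'. optimal (V - {w}) J M' \<Longrightarrow>
      \<exists>M. optimal V J M \<and> card (sym_diff (monomers M) (monomers M')) \<le> 1"
    by blast+
qed

lemma finite_monomers: "finite (monomers M)"
  using finite_U by (simp add: monomers_def)

lemma monomers_remove:
  assumes "V \<subseteq> U" "W \<subseteq> V" "optimal V J M"
  shows "\<exists>M'. optimal (V - W) J M' \<and> card (sym_diff (monomers M) (monomers M')) \<le> card W"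
proof -
  have "finite W" using assms(1,2) finite_U finite_subset by (metis subset_trans)
  then show ?thesis using assms(2)
  proof (induction W rule: finite_induct)
    case empty
    then show ?case using assms(3) by auto
  next
    case (insert w W)
    obtain M' where M': "optimal (V - W) J M'"
      "card (sym_diff (monomers M) (monomers M')) \<le> card W"
      using insert by auto
    have *: "V - W - {w} = V - insert w W" "w \<in> V - W" "V - W \<subseteq> U" using insert assms(1) by auto
    obtain M'' where M'': "optimal (V - insert w W) J M''"
      "card (sym_diff (monomers M') (monomers M'')) \<le> 1"
      using monomers_remove_one(1)[OF *(3,2) M'(1)] *(1) by auto
    have "sym_diff (monomers M) (monomers M'')
        \<subseteq> sym_diff (monomers M) (monomers M') \<union> sym_diff (monomers M') (monomers M'')"
      by blast
    then have "card (sym_diff (monomers M) (monomers M''))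
        \<le> card (sym_diff (monomers M) (monomers M') \<union> sym_diff (monomers M') (monomers M''))"
      using finite_monomers by (intro card_mono) auto
    also have "\<dots> \<le> card (sym_diff (monomers M) (monomers M')) +
        card (sym_diff (monomers M') (monomers M''))"
      by (rule card_Un_le)
    also have "\<dots> \<le> card (insert w W)" using M' M'' insert by simp
    finally show ?case using M''(1) by blast
  qed
qed

section \<open>Cavity fields and monomer status\<close>

definition cavity :: "'v \<Rightarrow> 'v set \<Rightarrow> 's \<Rightarrow> ('s \<Rightarrow> real) \<Rightarrow> real" where
  "cavity v V x J = H (V - cov x) J - H (V - {v}) J"

lemma H_local_le:
  assumes "V \<subseteq> U" "x \<in> S" "cov x \<subseteq> V"
  shows "H V J - H (V - {v}) J \<le> J x + cavity v V x J"
  using H_step_le[OF assms(2,3,1)] by (simp add: cavity_def)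

lemma H_local_attained:
  assumes "V \<subseteq> U" "v \<in> V"
  shows "\<exists>x\<in>S. v \<in> cov x \<and> cov x \<subseteq> V \<and> H V J - H (V - {v}) J = J x + cavity v V x J"
  using H_attained[OF assms, of J] by (auto simp: cavity_def)

lemma cavity_mon: "v \<in> U \<Longrightarrow> cavity v V (mon v) J = 0"
  by (simp add: cavity_def cov_mon)

text \<open>A certificate that \<open>v\<close> is not a monomer for \<open>V\<close> but is one for
  \<open>V'\<close>, written in terms of the weights at \<open>v\<close> and the cavity fields. The
  strict inequalities make it valid for every optimum, so ties do no harm. For \<open>v\<close> in
  \<open>U\<close> the choice \<open>y = mon v\<close> in the first clause is void, as its cavity
  field vanishes.\<close>

definition status_differs :: "'v set \<Rightarrow> 'v set \<Rightarrow> 'v \<Rightarrow> ('s \<Rightarrow> real) \<Rightarrow> bool" where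
  "status_differs V V' v J \<longleftrightarrow>
     (\<exists>y\<in>sites_at v. J y + cavity v V y J < J (mon v)) \<and>
     (\<forall>y\<in>sites_at v - {mon v}. J (mon v) < J y + cavity v V' y J)"

lemma status_differs_monomers:
  assumes "status_differs V V' v J" "V \<subseteq> U" "V' \<subseteq> U" "v \<in> V" "v \<in> V'"
    "\<And>x. x \<in> sites_at v \<Longrightarrow> cov x \<subseteq> V" "\<And>x. x \<in> sites_at v \<Longrightarrow> cov x \<subseteq> V'"
    "optimal V J M" "optimal V' J M'"
  shows "v \<notin> monomers M" "v \<in> monomers M'"
proof -
  have vU: "v \<in> U" using assms by auto
  obtain y where y: "y \<in> sites_at v" "J y + cavity v V y J < J (mon v)"
    using assms(1) by (auto simp: status_differs_def)
  show "v \<notin> monomers M"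
  proof
    assume "v \<in> monomers M"
    then have "mon v \<in> M" by (simp add: monomers_def)
    then have "H V J - H (V - {v}) J = J (mon v)"
      using optimal_remove(1)[OF assms(8) _ assms(2)] cov_mon[OF vU] by simp
    then show False
      using y H_local_le[OF assms(2), of y J v] assms(6)[OF y(1)] by (auto simp: sites_at_def)
  qed
  obtain x where x: "x \<in> M'" "x \<in> S" "v \<in> cov x" "cov x \<subseteq> V'"
    using optimal_covers[OF assms(9,5)] by blast
  have eq: "H V' J - H (V' - {v}) J = J x + cavity v V' x J"
    using optimal_remove(1)[OF assms(9) x(1) assms(3)] by (simp add: cavity_def)
  have "x = mon v"
  proof (rule ccontr)
    assume "x \<noteq> mon v"
    then have "J (mon v) < J x + cavity v V' x J"
      using assms(1) x by (auto simp: status_differs_def sites_at_def)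
    moreover have "H V' J - H (V' - {v}) J \<le> J (mon v)"
      using H_local_le[OF assms(3) mon_in[OF vU], of J v] cavity_mon[OF vU] cov_mon[OF vU] assms(5)
      by simp
    ultimately show False using eq by simp
  qed
  then show "v \<in> monomers M'" using x(1) vU by (simp add: monomers_def)
qed

text \<open>Holds for every weight configuration: \<open>monomers_remove\<close> supplies one pair
  of optima whose monomer sets differ in at most \<open>card W\<close> vertices, and the certificate
  applies to any pair. \<open>G\<close> keeps away from \<open>W\<close>, so every site at
  \<open>v\<close> is admissible for both vertex sets.\<close>

lemma card_status_differs:
  assumes "W \<subseteq> U" "G \<subseteq> U - W" "\<And>v x. v \<in> G \<Longrightarrow> x \<in> sites_at v \<Longrightarrow> cov x \<subseteq> U - W"
  shows "card {v \<in> G. status_differs U (U - W) v J \<or> status_differs (U - W) U v J} \<le> card W"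
proof -
  obtain M where M: "optimal U J M" using optimal_exists by blast
  obtain M' where M': "optimal (U - W) J M'"
    "card (sym_diff (monomers M) (monomers M')) \<le> card W"
    using monomers_remove[OF order_refl assms(1) M] by blast
  have "v \<in> sym_diff (monomers M) (monomers M')"
    if v: "v \<in> G" "status_differs U (U - W) v J \<or> status_differs (U - W) U v J" for v
  proof -
    have *: "v \<in> U" "v \<in> U - W" "U - W \<subseteq> U" using v assms by auto
    have c1: "cov x \<subseteq> U - W" if "x \<in> sites_at v" for x using assms(3)[OF v(1) that] .
    then have c2: "cov x \<subseteq> U" if "x \<in> sites_at v" for x using that by blast
    show ?thesis
      using v(2) status_differs_monomers[OF _ order_refl *(3,1,2) c2 c1 M M'(1)]
        status_differs_monomers[OF _ *(3) order_refl *(2,1) c1 c2 M'(1) M] by blast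
  qed
  then have "{v \<in> G. status_differs U (U - W) v J \<or> status_differs (U - W) U v J}
      \<subseteq> sym_diff (monomers M) (monomers M')" by blast
  then have "card {v \<in> G. status_differs U (U - W) v J \<or> status_differs (U - W) U v J}
      \<le> card (sym_diff (monomers M) (monomers M'))"
    using finite_monomers by (intro card_mono) auto
  then show ?thesis using M'(2) by simp
qed

section \<open>Locality and Lipschitz dependence on the weights\<close>

lemma H_cong:
  assumes "\<And>x. x \<in> S \<Longrightarrow> cov x \<subseteq> V \<Longrightarrow> J x = J' x"
  shows "H V J = H V J'"
proof -
  have "sum J M = sum J' M" if "M \<in> EC V" for M
    using that assms by (intro sum.cong) (auto simp: exact_covers_def)
  then have "sum J ` EC V = sum J' ` EC V" by (intro image_cong) auto
  then show ?thesis by (simp add: cover_energy_def)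
qed

lemma H_lipschitz:
  assumes "V \<subseteq> U" shows "\<bar>H V J - H V J'\<bar> \<le> (\<Sum>x\<in>S. \<bar>J x - J' x\<bar>)"
proof -
  have *: "H V J \<le> H V J' + (\<Sum>x\<in>S. \<bar>J x - J' x\<bar>)" for J J'
  proof -
    obtain M where M: "M \<in> EC V" "sum J' M = H V J'"
      using optimal_exists[OF assms, of J'] by (auto simp: optimal_def)
    have "H V J \<le> sum J M" by (rule H_le[OF M(1)])
    also have "\<dots> \<le> sum J' M + (\<Sum>x\<in>M. \<bar>J x - J' x\<bar>)"
      by (subst sum.distrib[symmetric]) (auto intro!: sum_mono)
    also have "(\<Sum>x\<in>M. \<bar>J x - J' x\<bar>) \<le> (\<Sum>x\<in>S. \<bar>J x - J' x\<bar>)"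
      using M(1) finite_S by (intro sum_mono2) (auto simp: exact_covers_def)
    finally show ?thesis using M(2) by simp
  qed
  show ?thesis using *[of J J'] *[of J' J] by (simp add: abs_minus_commute abs_le_iff)
qed

lemma H_update:
  assumes "V \<subseteq> U" "x \<in> S" shows "\<bar>H V J - H V (J(x := c))\<bar> \<le> \<bar>J x - c\<bar>"
proof -
  have "(\<Sum>y\<in>S. \<bar>J y - (J(x := c)) y\<bar>) = (\<Sum>y\<in>S. if y = x then \<bar>J x - c\<bar> else 0)"
    by (intro sum.cong) auto
  then show ?thesis using H_lipschitz[OF assms(1), of J "J(x := c)"] finite_S assms(2) by simp
qed

lemma H_mono:
  assumes "V \<subseteq> U" "\<And>x. x \<in> S \<Longrightarrow> J x \<le> J' x" shows "H V J \<le> H V J'"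
proof -
  obtain M where M: "M \<in> EC V" "sum J' M = H V J'"
    using optimal_exists[OF assms(1), of J'] by (auto simp: optimal_def)
  have "H V J \<le> sum J M" by (rule H_le[OF M(1)])
  also have "\<dots> \<le> sum J' M" using M(1) assms(2) by (intro sum_mono) (auto simp: exact_covers_def)
  finally show ?thesis using M(2) by simp
qed

lemma cavity_cong:
  assumes "v \<in> cov x" "\<And>y. y \<in> S \<Longrightarrow> v \<notin> cov y \<Longrightarrow> J y = J' y"
  shows "cavity v V x J = cavity v V x J'"
  unfolding cavity_def
  by (intro arg_cong2[where f = "(-)"] H_cong assms(2)) (use assms(1) in auto)

lemma H_minus_vertex_cong:
  assumes "\<And>y. y \<in> S \<Longrightarrow> v \<notin> cov y \<Longrightarrow> J y = J' y"
  shows "H (V - {v}) J = H (V - {v}) J'"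
  by (intro H_cong assms) auto

text \<open>\<open>H V J - H (V - {v}) J\<close> is a minimum of \<open>J x + cavity v V x J\<close>
  over the sites at \<open>v\<close>. If the fields for \<open>V\<close> and \<open>V'\<close> are
  within \<eta>, these minima are within \<eta>, both before and after a weight at \<open>v\<close>
  is changed. The energies without \<open>v\<close> do not see that weight and cancel, which leaves
  twice \<eta>.\<close>

lemma local_response:
  assumes "V \<subseteq> U" "V' \<subseteq> U" "v \<in> V" "v \<in> V'"
    "\<And>x. x \<in> sites_at v \<Longrightarrow> cov x \<subseteq> V" "\<And>x. x \<in> sites_at v \<Longrightarrow> cov x \<subseteq> V'"
    and close: "\<And>y. y \<in> sites_at v \<Longrightarrow> \<bar>cavity v V y J - cavity v V' y J\<bar> \<le> \<eta>"
    and x: "x \<in> sites_at v"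
  shows "\<bar>(H V J - H V' J) - (H V (J(x := c)) - H V' (J(x := c)))\<bar> \<le> 2 * \<eta>"
proof -
  let ?J' = "J(x := c)"
  have cav: "cavity v V0 y ?J' = cavity v V0 y J" if "y \<in> sites_at v" for y V0
    using that x by (intro cavity_cong) (auto simp: sites_at_def)
  have HV: "H (V0 - {v}) ?J' = H (V0 - {v}) J" for V0
    using x by (intro H_minus_vertex_cong) (auto simp: sites_at_def)
  \<comment> \<open>A minimising site for \<open>B\<close> is a candidate for \<open>A\<close>. This
    is used in both directions and for both weight configurations.\<close>
  have one: "H A K - H (A - {v}) K \<le> H B K - H (B - {v}) K + \<eta>"
    if AB: "A \<subseteq> U" "B \<subseteq> U" "v \<in> B" "\<And>x. x \<in> sites_at v \<Longrightarrow> cov x \<subseteq> A"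
      and cl: "\<And>y. y \<in> sites_at v \<Longrightarrow> \<bar>cavity v A y K - cavity v B y K\<bar> \<le> \<eta>" for A B K
  proof -
    obtain y where y: "y \<in> S" "v \<in> cov y" "H B K - H (B - {v}) K = K y + cavity v B y K"
      using H_local_attained[OF AB(2,3)] by blast
    then have "y \<in> sites_at v" by (simp add: sites_at_def)
    then have "H A K - H (A - {v}) K \<le> K y + cavity v A y K"
      using AB(4) y(1) by (intro H_local_le[OF AB(1)]) auto
    then show ?thesis using y(3) cl[OF \<open>y \<in> sites_at v\<close>] by linarith
  qed
  have cl2: "\<bar>cavity v V' y J - cavity v V y J\<bar> \<le> \<eta>" if "y \<in> sites_at v" for y
    using close[OF that] by (simp add: abs_minus_commute)
  have "H V J - H (V - {v}) J \<le> H V' J - H (V' - {v}) J + \<eta>"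
    "H V' J - H (V' - {v}) J \<le> H V J - H (V - {v}) J + \<eta>"
    using one[of V V' J] one[of V' V J] assms(1-6) close cl2 by auto
  moreover have "H V ?J' - H (V - {v}) ?J' \<le> H V' ?J' - H (V' - {v}) ?J' + \<eta>"
    "H V' ?J' - H (V' - {v}) ?J' \<le> H V ?J' - H (V - {v}) ?J' + \<eta>"
    using one[of V V' ?J'] one[of V' V ?J'] assms(1-6) close cl2 cav by auto
  ultimately show ?thesis unfolding HV by linarith
qed

section \<open>A priori bounds by nearby weights\<close>

definition local_bound :: "'v \<Rightarrow> ('s \<Rightarrow> real) \<Rightarrow> real" where
  "local_bound a J = (\<Sum>x\<in>sites_at a. \<bar>J x\<bar> + (\<Sum>b\<in>cov x. \<bar>J (mon b)\<bar>))"

lemma finite_sites_at: "finite (sites_at v)"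
  using finite_S by (simp add: sites_at_def)

lemma finite_cov: "x \<in> S \<Longrightarrow> finite (cov x)"
  using cov_subset finite_U finite_subset by blast

lemma local_bound_nonneg: "0 \<le> local_bound a J"
  by (auto simp: local_bound_def intro!: sum_nonneg add_nonneg_nonneg)

lemma H_remove_ge:
  assumes "V \<subseteq> U" "a \<in> V" shows "H V J - J (mon a) \<le> H (V - {a}) J"
  using H_step_le[of "mon a" V J] assms mon_in[of a] cov_mon[of a] by auto

text \<open>In one direction, cover \<open>a\<close> by its monomer. In the other, delete the site
  at \<open>a\<close> from an optimum of \<open>V\<close> and cover the other endpoint, if there is
  one, by its monomer. Only weights near \<open>a\<close> enter, so the bound has an expectation
  independent of the volume.\<close>

lemma H_remove_bound:
  assumes "V \<subseteq> U" "a \<in> V" shows "\<bar>H V J - H (V - {a}) J\<bar> \<le> local_bound a J"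
proof -
  have aU: "a \<in> U" using assms by auto
  have term_le: "\<bar>J x\<bar> + (\<Sum>b\<in>cov x. \<bar>J (mon b)\<bar>) \<le> local_bound a J" if "x \<in> S" "a \<in> cov x" for x
    unfolding local_bound_def using that finite_sites_at
    by (intro member_le_sum[of x _ "\<lambda>x. \<bar>J x\<bar> + (\<Sum>b\<in>cov x. \<bar>J (mon b)\<bar>)"])
       (auto simp: sites_at_def intro!: sum_nonneg add_nonneg_nonneg)
  have up: "H V J - H (V - {a}) J \<le> local_bound a J"
    using H_remove_ge[OF assms, of J] term_le[OF mon_in[OF aU]] cov_mon[OF aU] by simp
  obtain x where x: "x \<in> S" "a \<in> cov x" "cov x \<subseteq> V" "H V J = J x + H (V - cov x) J"
    using H_attained[OF assms] by blast
  have mon_le: "\<bar>J (mon b)\<bar> \<le> (\<Sum>b\<in>cov x. \<bar>J (mon b)\<bar>)" if "b \<in> cov x" for b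
    using that finite_cov[OF x(1)] by (intro member_le_sum[of b _ "\<lambda>b. \<bar>J (mon b)\<bar>"]) auto
  have nn: "0 \<le> (\<Sum>b\<in>cov x. \<bar>J (mon b)\<bar>)" by (intro sum_nonneg) auto
  have "H (V - {a}) J - H V J \<le> \<bar>J x\<bar> + (\<Sum>b\<in>cov x. \<bar>J (mon b)\<bar>)"
  proof (cases "cov x = {a}")
    case True
    then show ?thesis using x(4) nn by auto
  next
    case False
    then obtain b where b: "b \<noteq> a" "cov x = {a, b}"
      using cov_other[OF x(1,2)] by blast
    have "H (V - {a}) J - J (mon b) \<le> H (V - {a} - {b}) J"
      using assms b x(3) by (intro H_remove_ge) auto
    moreover have "V - {a} - {b} = V - cov x" using b by auto
    ultimately show ?thesis using x(4) mon_le[of b] b(2) by auto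
  qed
  then show ?thesis using up term_le[OF x(1,2)] by linarith
qed

text \<open>For an edge joining \<open>v\<close> and \<open>b\<close> the cavity field is the change
  of energy caused by removing \<open>b\<close> from \<open>V - {v}\<close>. For a site covering
  only \<open>v\<close> it is zero.\<close>

lemma cavity_bound:
  assumes "V \<subseteq> U" "x \<in> sites_at v" "cov x \<subseteq> V"
  shows "\<bar>cavity v V x J\<bar> \<le> (\<Sum>a\<in>cov x. local_bound a J)"
proof -
  have x: "x \<in> S" "v \<in> cov x" using assms(2) by (auto simp: sites_at_def)
  show ?thesis
  proof (cases "cov x = {v}")
    case True
    then show ?thesis by (simp add: cavity_def local_bound_nonneg)
  next
    case False
    then obtain b where b: "b \<noteq> v" "cov x = {v, b}"
      using cov_other[OF x] by blast
    have "V - cov x = V - {v} - {b}" using b by auto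
    then have "\<bar>cavity v V x J\<bar> = \<bar>H (V - {v}) J - H (V - {v} - {b}) J\<bar>"
      by (simp add: cavity_def abs_minus_commute)
    also have "\<dots> \<le> local_bound b J" using assms(1,3) b by (intro H_remove_bound) auto
    also have "\<dots> \<le> (\<Sum>a\<in>cov x. local_bound a J)"
      using b local_bound_nonneg finite_cov[OF x(1)]
      by (intro member_le_sum[of b _ "\<lambda>a. local_bound a J"]) auto
    finally show ?thesis .
  qed
qed

text \<open>A one-sided bound through the monomer weight of the other endpoint alone. In the lower
  bound on the variance this replaces any control of the distant environment.\<close>

lemma cavity_ge:
  assumes "V \<subseteq> U" "x \<in> sites_at v" "cov x \<subseteq> V" "\<And>a. a \<in> cov x - {v} \<Longrightarrow> J (mon a) \<le> s"
    "cov x \<noteq> {v}"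
  shows "- s \<le> cavity v V x J"
proof -
  have x: "x \<in> S" "v \<in> cov x" using assms(2) by (auto simp: sites_at_def)
  obtain b where b: "b \<noteq> v" "cov x = {v, b}"
    using cov_other[OF x assms(5)] by blast
  have "V - cov x = V - {v} - {b}" using b by auto
  then show ?thesis
    using H_remove_ge[of "V - {v}" b J] assms(1,3) b assms(4)[of b] by (simp add: cavity_def subset_iff)
qed

text \<open>The hypothesis \<open>split\<close> says that no site straddles two blocks. An optimum
  of the union therefore restricts to covers of the blocks, and optima of the blocks glue to a cover
  of the union.\<close>

lemma H_disjoint_Union:
  assumes "finite I" "(\<Union>i\<in>I. C i) \<subseteq> U" "\<And>i j. i \<in> I \<Longrightarrow> j \<in> I \<Longrightarrow> i \<noteq> j \<Longrightarrow> C i \<inter> C j = {}"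
    and split: "\<And>x. x \<in> S \<Longrightarrow> cov x \<subseteq> (\<Union>i\<in>I. C i) \<Longrightarrow> \<exists>i\<in>I. cov x \<subseteq> C i"
  shows "H (\<Union>i\<in>I. C i) J = (\<Sum>i\<in>I. H (C i) J)"
proof (rule antisym)
  let ?V = "\<Union>i\<in>I. C i"
  have CU: "C i \<subseteq> U" if "i \<in> I" for i using that assms(2) by auto
  have uniq: "i = j" if "x \<in> S" "cov x \<subseteq> C i" "cov x \<subseteq> C j" "i \<in> I" "j \<in> I" for x i j
    using that cov_nonempty[OF that(1)] assms(3)[of i j] by blast
  obtain M where M: "M \<in> EC ?V" "sum J M = H ?V J"
    using optimal_exists[OF assms(2), of J] by (auto simp: optimal_def)
  have MS: "M \<subseteq> S" "\<And>x. x \<in> M \<Longrightarrow> cov x \<subseteq> ?V" "\<And>v. v \<in> ?V \<Longrightarrow> \<exists>!x. x \<in> M \<and> v \<in> cov x"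
    using CollectD[OF M(1)[unfolded exact_covers_def]] by blast+
  define part where "part i = {x \<in> M. cov x \<subseteq> C i}" for i
  have M_eq: "M = (\<Union>i\<in>I. part i)" using MS split by (auto simp: part_def)
  have "sum J M = (\<Sum>i\<in>I. sum J (part i))"
    unfolding M_eq using uniq MS(1) assms(1) finite_EC_elem[OF M(1)]
    by (intro sum.UNION_disjoint) (auto simp: part_def)
  moreover have "H (C i) J \<le> sum J (part i)" if i: "i \<in> I" for i
  proof (rule H_le)
    have "\<exists>!x. x \<in> part i \<and> v \<in> cov x" if v: "v \<in> C i" for v
    proof -
      have "v \<in> ?V" using v i by (rule UN_I[rotated])
      from MS(3)[OF this] obtain x
        where x: "x \<in> M" "v \<in> cov x" "\<And>y. y \<in> M \<and> v \<in> cov y \<Longrightarrow> y = x"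
        by (elim ex1E conjE) metis
      obtain j where j: "j \<in> I" "cov x \<subseteq> C j"
        using split[OF subsetD[OF MS(1) x(1)] MS(2)[OF x(1)]] by blast
      then have "j = i" using assms(3)[OF i j(1)] x(2) v by blast
      then have "x \<in> part i" using x(1) j(2) by (simp add: part_def)
      moreover have "y = x" if "y \<in> part i \<and> v \<in> cov y" for y
        using x(3)[of y] that by (simp add: part_def)
      ultimately show ?thesis using x(2) by (intro ex1I[of _ x] conjI)
    qed
    moreover have "part i \<subseteq> S" "\<forall>x\<in>part i. cov x \<subseteq> C i" using MS(1) by (auto simp only: part_def)
    ultimately show "part i \<in> EC (C i)" unfolding exact_covers_def by simp
  qed
  ultimately show "(\<Sum>i\<in>I. H (C i) J) \<le> H ?V J" using M(2) by (simp add: sum_mono)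
  have "\<exists>N. optimal (C i) J N" if "i \<in> I" for i using optimal_exists[OF CU[OF that]] .
  then obtain N where N: "\<And>i. i \<in> I \<Longrightarrow> optimal (C i) J (N i)" by metis
  have NS: "N i \<subseteq> S" "\<And>x. x \<in> N i \<Longrightarrow> cov x \<subseteq> C i"
    "\<And>v. v \<in> C i \<Longrightarrow> \<exists>!x. x \<in> N i \<and> v \<in> cov x" if "i \<in> I" for i
    using N[OF that] by (simp_all add: optimal_def exact_covers_def)
  have "\<exists>!x. x \<in> (\<Union>i\<in>I. N i) \<and> v \<in> cov x" if v: "v \<in> C i" "i \<in> I" for v i
  proof -
    from NS(3)[OF v(2,1)] obtain x
      where x: "x \<in> N i" "v \<in> cov x" "\<And>y. y \<in> N i \<and> v \<in> cov y \<Longrightarrow> y = x"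
      by (elim ex1E conjE) metis
    have eq: "y = x" if "j \<in> I" "y \<in> N j" "v \<in> cov y" for y j
    proof -
      have "j = i" using NS(2)[OF that(1,2)] that(3) v(1) assms(3)[OF v(2) that(1)] by blast
      then show ?thesis using x(3) that by blast
    qed
    moreover have "x \<in> (\<Union>i\<in>I. N i)" using UN_I[of i I x N] x(1) v(2) by simp
    moreover have "y = x" if "y \<in> (\<Union>i\<in>I. N i) \<and> v \<in> cov y" for y
    proof -
      from that have "\<exists>j\<in>I. y \<in> N j" "v \<in> cov y" by simp_all
      then show ?thesis using eq by (elim bexE) simp
    qed
    ultimately show ?thesis using x(2) by (intro ex1I[of _ x] conjI)
  qed
  then have "\<forall>v\<in>?V. \<exists>!x. x \<in> (\<Union>i\<in>I. N i) \<and> v \<in> cov x"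
    by (intro ballI) (elim UN_E, simp only:)
  moreover have "(\<Union>i\<in>I. N i) \<subseteq> S" using NS(1) by (rule UN_least)
  moreover have "\<forall>x\<in>(\<Union>i\<in>I. N i). cov x \<subseteq> ?V" using NS(2) by (meson UN_E UN_upper subset_trans)
  ultimately have "(\<Union>i\<in>I. N i) \<in> EC ?V" unfolding exact_covers_def by simp
  then have "H ?V J \<le> sum J (\<Union>i\<in>I. N i)" by (rule H_le)
  also have "\<dots> = (\<Sum>i\<in>I. sum J (N i))"
  proof (rule sum.UNION_disjoint[OF assms(1)])
    show "\<forall>i\<in>I. finite (N i)" using N finite_EC_elem by (auto simp: optimal_def)
    show "\<forall>i\<in>I. \<forall>j\<in>I. i \<noteq> j \<longrightarrow> N i \<inter> N j = {}"
    proof (intro ballI impI, rule ccontr)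
      fix i j assume ij: "i \<in> I" "j \<in> I" "i \<noteq> j" "N i \<inter> N j \<noteq> {}"
      then obtain x where "x \<in> N i" "x \<in> N j" by blast
      then show False using uniq[of x i j] NS(1,2) ij by blast
    qed
  qed
  also have "\<dots> = (\<Sum>i\<in>I. H (C i) J)" using N by (intro sum.cong) (auto simp: optimal_def)
  finally show "H ?V J \<le> (\<Sum>i\<in>I. H (C i) J)" .
qed

end

text \<open>Only sites inside \<open>V\<close> matter, so within a cube the incidence of the torus
  can be exchanged for that of the lattice.\<close>

lemma cover_energy_cong:
  assumes "{x \<in> S. cov x \<subseteq> V} = {x \<in> S'. cov' x \<subseteq> V}"
    "\<And>x. x \<in> S \<Longrightarrow> cov x \<subseteq> V \<Longrightarrow> cov x = cov' x"
  shows "cover_energy cov S V = cover_energy cov' S' V"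
proof -
  have "M \<in> exact_covers cov S V \<longleftrightarrow> M \<in> exact_covers cov' S' V" for M
  proof (cases "M \<subseteq> {x \<in> S. cov x \<subseteq> V}")
    case True
    then have "cov x = cov' x" if "x \<in> M" for x using assms(2) that by auto
    then have "(\<exists>!x. x \<in> M \<and> v \<in> cov x) = (\<exists>!x. x \<in> M \<and> v \<in> cov' x)" for v by metis
    moreover have "M \<subseteq> S" "M \<subseteq> S'" "\<forall>x\<in>M. cov x \<subseteq> V" "\<forall>x\<in>M. cov' x \<subseteq> V"
      using True assms(1) by blast+
    ultimately show ?thesis by (simp add: exact_covers_def)
  next
    case False
    then show ?thesis using assms(1) unfolding exact_covers_def by blast
  qed
  then have "exact_covers cov S V = exact_covers cov' S' V" by blast
  then show ?thesis by (simp add: fun_eq_iff cover_energy_def)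
qed

section \<open>The Efron-Stein inequality\<close>

text \<open>The quantifiers range over all functions, not only those extensional on
  \<open>S\<close>. Hence \<open>f\<close> depends on the coordinates in \<open>S\<close> alone, and
  restrictions and updates can be inserted freely.\<close>

definition lipschitz_sum :: "real \<Rightarrow> 's set \<Rightarrow> (('s \<Rightarrow> real) \<Rightarrow> real) \<Rightarrow> bool" where
  "lipschitz_sum L S f \<longleftrightarrow> (\<forall>J J'. \<bar>f J - f J'\<bar> \<le> L * (\<Sum>x\<in>S. \<bar>J x - J' x\<bar>))"

lemma lipschitz_sum_cong:
  assumes "lipschitz_sum L S f" "\<And>x. x \<in> S \<Longrightarrow> J x = J' x" shows "f J = f J'"
proof -
  have "(\<Sum>x\<in>S. \<bar>J x - J' x\<bar>) = 0" using assms(2) by (intro sum.neutral) auto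
  then show ?thesis using assms(1) unfolding lipschitz_sum_def by (metis abs_le_zero_iff mult_zero_right right_minus_eq)
qed

lemma lipschitz_sum_update:
  assumes "lipschitz_sum L S f" "finite S" "x \<in> S"
  shows "\<bar>f (J(x := a)) - f (J(x := b))\<bar> \<le> L * \<bar>a - b\<bar>"
proof -
  have "(\<Sum>y\<in>S. \<bar>(J(x := a)) y - (J(x := b)) y\<bar>) = (\<Sum>y\<in>S. if y = x then \<bar>a - b\<bar> else 0)"
    by (intro sum.cong) auto
  also have "\<dots> = \<bar>a - b\<bar>" using assms(2,3) by simp
  finally show ?thesis using assms(1) unfolding lipschitz_sum_def by metis
qed

lemma power2_le_shift: "(a::real)\<^sup>2 \<le> 2 * (a - c)\<^sup>2 + 2 * c\<^sup>2"
proof -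
  have "2 * (a - c)\<^sup>2 + 2 * c\<^sup>2 - a\<^sup>2 = (a - 2 * c)\<^sup>2"
    by (simp add: power2_eq_square algebra_simps)
  then show ?thesis by (metis diff_ge_0_iff_ge zero_le_power2)
qed

lemma integrable_nonneg_bound:
  fixes f b :: "'a \<Rightarrow> real"
  assumes "integrable M b" "f \<in> borel_measurable M" "\<And>x. 0 \<le> f x" "\<And>x. f x \<le> b x"
  shows "integrable M f"
proof (rule Bochner_Integration.integrable_bound[OF assms(1,2)])
  have "norm (f x) \<le> norm (b x)" for x using assms(3,4)[of x] by simp
  then show "AE x in M. norm (f x) \<le> norm (b x)" by simp
qed

lemma (in prob_space) integrable_affine:
  fixes g :: "'a \<Rightarrow> real"
  shows "integrable M g \<Longrightarrow> integrable M (\<lambda>x. a + b * (c * g x))"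
  by simp

lemma (in prob_space) square_expectation_decomp:
  fixes F :: "'a \<Rightarrow> real"
  assumes "integrable M F" "integrable M (\<lambda>x. (F x)\<^sup>2)"
  shows "integrable M (\<lambda>x. (F x - c)\<^sup>2)"
    "expectation (\<lambda>x. (F x - c)\<^sup>2) = variance F + (expectation F - c)\<^sup>2"
proof -
  have eq: "(F x - c)\<^sup>2 = (F x)\<^sup>2 - 2 * c * F x + c\<^sup>2" for x c by (simp add: power2_diff)
  show "integrable M (\<lambda>x. (F x - c)\<^sup>2)" unfolding eq using assms by simp
  have "expectation (\<lambda>x. (F x - c)\<^sup>2) = expectation (\<lambda>x. (F x)\<^sup>2) - 2 * c * expectation F + c\<^sup>2" for c
    unfolding eq using assms by (simp add: prob_space)
  from this[of c] this[of "expectation F"]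
  show "expectation (\<lambda>x. (F x - c)\<^sup>2) = variance F + (expectation F - c)\<^sup>2"
    by (simp only:) (simp add: power2_eq_square algebra_simps)
qed

lemma (in prob_space) square_expectation_le:
  fixes F :: "'a \<Rightarrow> real"
  assumes "F \<in> borel_measurable M" "integrable M (\<lambda>x. (F x)\<^sup>2)"
  shows "(expectation F)\<^sup>2 \<le> expectation (\<lambda>x. (F x)\<^sup>2)"
  using square_expectation_decomp(2)[OF square_integrable_imp_integrable[OF assms] assms(2), of 0]
    variance_positive[of F] by simp

locale square_integrable_distribution = prob_space \<mu> for \<mu> :: "real measure" +
  assumes sets_\<mu> [measurable_cong]: "sets \<mu> = sets borel"
    and square_integrable: "integrable \<mu> (\<lambda>x. x\<^sup>2)"
begin

sublocale pm: product_prob_space "\<lambda>_. \<mu>" UNIV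
  by standard

lemma integrable_PiM_square:
  assumes "finite S" "x \<in> S" shows "integrable (PiM S (\<lambda>_. \<mu>)) (\<lambda>u. (u x)\<^sup>2)"
proof -
  have "distr (PiM S (\<lambda>_. \<mu>)) \<mu> (\<lambda>u. u x) = \<mu>"
    using assms by (intro distr_PiM_component) (auto intro: prob_space_axioms)
  then have "integrable (distr (PiM S (\<lambda>_. \<mu>)) \<mu> (\<lambda>u. u x)) (\<lambda>x. x\<^sup>2)"
    using square_integrable by simp
  then show ?thesis using assms(2) by (subst (asm) integrable_distr_eq) auto
qed

lemma integrable_square_lipschitz:
  assumes "finite S" "f \<in> borel_measurable (PiM S (\<lambda>_. \<mu>))" "lipschitz_sum L S f"
  shows "integrable (PiM S (\<lambda>_. \<mu>)) (\<lambda>u. (f u)\<^sup>2)" "integrable (PiM S (\<lambda>_. \<mu>)) f"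
proof -
  interpret S: prob_space "PiM S (\<lambda>_. \<mu>)" by (intro prob_space_PiM prob_space_axioms)
  let ?c = "f (\<lambda>_. 0)"
  let ?b = "\<lambda>u. 2 * ?c\<^sup>2 + 2 * L\<^sup>2 * (real (card S) * (\<Sum>x\<in>S. (u x)\<^sup>2))"
  have "(f u)\<^sup>2 \<le> ?b u" for u
  proof -
    have "\<bar>f u - ?c\<bar> \<le> L * (\<Sum>x\<in>S. \<bar>u x\<bar>)" 
      using assms(3)[unfolded lipschitz_sum_def, rule_format, of u "\<lambda>_. 0"] by simp
    then have "(f u - ?c)\<^sup>2 \<le> (L * (\<Sum>x\<in>S. \<bar>u x\<bar>))\<^sup>2" by (rule abs_le_square_iff[THEN iffD1, OF order_trans[OF _ abs_ge_self]])
    also have "\<dots> \<le> L\<^sup>2 * (real (card S) * (\<Sum>x\<in>S. (u x)\<^sup>2))"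
      using sum_squared_le_sum_of_squares[of "\<lambda>x. \<bar>u x\<bar>" S]
      by (simp add: power_mult_distrib mult_left_mono mult.commute)
    finally have "(f u - ?c)\<^sup>2 \<le> L\<^sup>2 * (real (card S) * (\<Sum>x\<in>S. (u x)\<^sup>2))" .
    moreover have "(f u)\<^sup>2 \<le> 2 * (f u - ?c)\<^sup>2 + 2 * ?c\<^sup>2"
      by (rule power2_le_shift)
    ultimately show ?thesis by linarith
  qed
  moreover have "integrable (PiM S (\<lambda>_. \<mu>)) ?b"
    by (intro S.integrable_affine Bochner_Integration.integrable_sum integrable_PiM_square[OF assms(1)])
  ultimately show sq: "integrable (PiM S (\<lambda>_. \<mu>)) (\<lambda>u. (f u)\<^sup>2)"
    by (rule integrable_nonneg_bound[where b = ?b, rotated 3]) (use assms(2) in auto)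
  show "integrable (PiM S (\<lambda>_. \<mu>)) f"
    by (rule S.square_integrable_imp_integrable[OF assms(2) sq])
qed

lemma square_integrable_section:
  assumes "finite S" "lipschitz_sum L S f" "i \<in> S"
  shows "(\<lambda>t. f (u(i := t))) \<in> borel_measurable \<mu>"
    "integrable \<mu> (\<lambda>t. (f (u(i := t)))\<^sup>2)" "integrable \<mu> (\<lambda>t. f (u(i := t)))"
proof -
  have lip: "\<bar>f (u(i := t)) - f (u(i := t'))\<bar> \<le> L * \<bar>t - t'\<bar>" for t t'
    by (rule lipschitz_sum_update[OF assms(2,1,3)])
  have Lnn: "0 \<le> L" using lip[of 0 1] by (simp add: order_trans[OF abs_ge_zero])
  \<comment> \<open>Continuity in one coordinate gives measurability of the section for every
    \<open>u\<close>, not just for almost every one.\<close>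
  have "L-lipschitz_on UNIV (\<lambda>t. f (u(i := t)))"
    using lip Lnn by (auto simp: lipschitz_on_def dist_real_def)
  then have "continuous_on UNIV (\<lambda>t. f (u(i := t)))" by (rule lipschitz_on_continuous_on)
  then show m: "(\<lambda>t. f (u(i := t))) \<in> borel_measurable \<mu>"
    using borel_measurable_continuous_onI by (simp cong: measurable_cong_sets add: measurable_cong_sets[OF sets_\<mu> refl])
  let ?c = "f (u(i := 0))"
  have "(f (u(i := t)))\<^sup>2 \<le> 2 * ?c\<^sup>2 + 2 * L\<^sup>2 * t\<^sup>2" for t
  proof -
    have "(f (u(i := t)) - ?c)\<^sup>2 \<le> (L * \<bar>t\<bar>)\<^sup>2"
      using lip[of t 0] by (intro abs_le_square_iff[THEN iffD1] order_trans[OF _ abs_ge_self]) simp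
    moreover have "(f (u(i := t)))\<^sup>2 \<le> 2 * (f (u(i := t)) - ?c)\<^sup>2 + 2 * ?c\<^sup>2"
      by (rule power2_le_shift)
    ultimately show ?thesis by (simp add: power_mult_distrib)
  qed
  then show sq: "integrable \<mu> (\<lambda>t. (f (u(i := t)))\<^sup>2)"
    by (rule integrable_nonneg_bound[of \<mu> "\<lambda>t. 2 * ?c\<^sup>2 + 2 * L\<^sup>2 * t\<^sup>2", rotated 3])
      (use m square_integrable in simp_all)
  show "integrable \<mu> (\<lambda>t. f (u(i := t)))" by (rule square_integrable_imp_integrable[OF m sq])
qed

lemma measurable_section_integral:
  fixes \<phi> :: "('s \<Rightarrow> real) \<Rightarrow> real"
  assumes "\<phi> \<in> borel_measurable (PiM (insert i S) (\<lambda>_. \<mu>))"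
  shows "(\<lambda>u. \<integral>t. \<phi> (u(i := t)) \<partial>\<mu>) \<in> borel_measurable (PiM S (\<lambda>_. \<mu>))"
proof (rule sigma_finite_measure.borel_measurable_lebesgue_integral[OF sigma_finite_measure_axioms,
      where f = "\<lambda>u t. \<phi> (u(i := t))"])
  show "case_prod (\<lambda>u t. \<phi> (u(i := t))) \<in> borel_measurable (PiM S (\<lambda>_. \<mu>) \<Otimes>\<^sub>M \<mu>)"
    using measurable_compose[OF measurable_add_dim assms] by (simp add: case_prod_unfold)
qed

lemma measurable_update_const [measurable (raw)]:
  fixes f :: "('s \<Rightarrow> real) \<Rightarrow> real"
  assumes "f \<in> borel_measurable (PiM S (\<lambda>_. \<mu>))" "i \<in> S"
  shows "(\<lambda>u. f (u(i := c))) \<in> borel_measurable (PiM S (\<lambda>_. \<mu>))"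
proof (rule measurable_compose[OF _ assms(1)])
  \<comment> \<open>The coordinatewise map below agrees with the update on functions extensional on
    \<open>S\<close>.\<close>
  have "(\<lambda>u. \<lambda>j\<in>S. if j = i then c else u j) \<in> PiM S (\<lambda>_. \<mu>) \<rightarrow>\<^sub>M PiM S (\<lambda>_. \<mu>)"
    by (intro measurable_restrict) (auto simp: measurable_const space_PiM sets_eq_imp_space_eq[OF sets_\<mu>])
  then show "(\<lambda>u. u(i := c)) \<in> PiM S (\<lambda>_. \<mu>) \<rightarrow>\<^sub>M PiM S (\<lambda>_. \<mu>)"
    by (rule measurable_cong[THEN iffD1, rotated])
      (use assms(2) in \<open>auto simp: space_PiM PiE_def extensional_def fun_eq_iff\<close>)
qed

text \<open>Averaging out a coordinate keeps the Lipschitz constant, so the induction for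
  Efron-Stein can continue with the averaged function.\<close>

lemma lipschitz_sum_section_integral:
  assumes "finite S" "i \<notin> S" "lipschitz_sum L (insert i S) f"
  shows "lipschitz_sum L S (\<lambda>u. \<integral>t. f (u(i := t)) \<partial>\<mu>)"
  unfolding lipschitz_sum_def
proof (intro allI)
  fix J J' :: "_ \<Rightarrow> real"
  have int: "integrable \<mu> (\<lambda>t. f (J(i := t)))" for J
    using assms by (intro square_integrable_section(3)[of "insert i S"]) auto
  have le: "\<bar>f (J(i := t)) - f (J'(i := t))\<bar> \<le> L * (\<Sum>x\<in>S. \<bar>J x - J' x\<bar>)" for t
  proof -
    have "(\<Sum>x\<in>S. \<bar>(J(i := t)) x - (J'(i := t)) x\<bar>) = (\<Sum>x\<in>S. \<bar>J x - J' x\<bar>)"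
      using assms(2) by (intro sum.cong) auto
    then show ?thesis
      using assms(3)[unfolded lipschitz_sum_def, rule_format, of "J(i := t)" "J'(i := t)"] assms(1,2)
      by simp
  qed
  have "\<bar>(\<integral>t. f (J(i := t)) \<partial>\<mu>) - (\<integral>t. f (J'(i := t)) \<partial>\<mu>)\<bar>
      = \<bar>\<integral>t. f (J(i := t)) - f (J'(i := t)) \<partial>\<mu>\<bar>"
    using int by (simp add: Bochner_Integration.integral_diff)
  also have "\<dots> \<le> (\<integral>t. \<bar>f (J(i := t)) - f (J'(i := t))\<bar> \<partial>\<mu>)" by (rule integral_abs_bound)
  also have "\<dots> \<le> (\<integral>t. L * (\<Sum>x\<in>S. \<bar>J x - J' x\<bar>) \<partial>\<mu>)"
    using int le by (intro integral_mono) auto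
  finally show "\<bar>(\<integral>t. f (J(i := t)) \<partial>\<mu>) - (\<integral>t. f (J'(i := t)) \<partial>\<mu>)\<bar>
      \<le> L * (\<Sum>x\<in>S. \<bar>J x - J' x\<bar>)" by (simp add: prob_space)
qed

lemma integrable_square_response:
  assumes "finite S" "f \<in> borel_measurable (PiM S (\<lambda>_. \<mu>))" "lipschitz_sum L S f" "x \<in> S"
  shows "integrable (PiM S (\<lambda>_. \<mu>)) (\<lambda>u. (f u - f (u(x := 0)))\<^sup>2)"
proof (rule integrable_nonneg_bound)
  show "integrable (PiM S (\<lambda>_. \<mu>)) (\<lambda>u. L\<^sup>2 * (u x)\<^sup>2)"
    using integrable_PiM_square[OF assms(1,4)] by simp
  have "(f u - f (u(x := 0)))\<^sup>2 \<le> (L * \<bar>u x\<bar>)\<^sup>2" for u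
    using lipschitz_sum_update[OF assms(3,1,4), of u "u x" 0]
    by (intro abs_le_square_iff[THEN iffD1] order_trans[OF _ abs_ge_self]) simp
  then show "(f u - f (u(x := 0)))\<^sup>2 \<le> L\<^sup>2 * (u x)\<^sup>2" for u
    by (simp add: power_mult_distrib)
  show "(\<lambda>u. (f u - f (u(x := 0)))\<^sup>2) \<in> borel_measurable (PiM S (\<lambda>_. \<mu>))"
    using assms(2,4) by measurable
qed simp

text \<open>Efron-Stein inequality in the form without an independent copy: resampling a coordinate is
  replaced by setting it to \<open>0\<close>.\<close>
lemma efron_stein_PiM:
  assumes "finite S" "f \<in> borel_measurable (PiM S (\<lambda>_. \<mu>))" "lipschitz_sum L S f"
  shows "(\<integral>u. (f u - (\<integral>u. f u \<partial>PiM S (\<lambda>_. \<mu>)))\<^sup>2 \<partial>PiM S (\<lambda>_. \<mu>))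
    \<le> (\<Sum>x\<in>S. \<integral>u. (f u - f (u(x := 0)))\<^sup>2 \<partial>PiM S (\<lambda>_. \<mu>))"
  using assms
proof (induction S arbitrary: f rule: finite_induct)
  case empty
  interpret S: prob_space "PiM {} (\<lambda>_. \<mu>) :: ('a \<Rightarrow> real) measure" by (intro prob_space_PiM prob_space_axioms)
  have "f u = f (\<lambda>_. 0)" for u by (rule lipschitz_sum_cong[OF empty(2)]) simp
  then obtain c where "f = (\<lambda>_. c)" by auto
  then show ?case by (simp add: S.prob_space)
next
  case (insert i S)
  let ?M = "PiM S (\<lambda>_. \<mu>)" and ?M' = "PiM (insert i S) (\<lambda>_. \<mu>)"
  interpret S: prob_space ?M by (intro prob_space_PiM prob_space_axioms)
  interpret S': prob_space ?M' by (intro prob_space_PiM prob_space_axioms)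
  have fin: "finite (insert i S)" using insert by simp
  \<comment> \<open>Conditioning on all coordinates except \<open>i\<close>: the second moment of
    \<open>f\<close> about \<open>m\<close> is the mean variance of the sections plus the second
    moment of \<open>g\<close> about \<open>m\<close>. The induction hypothesis handles
    \<open>g\<close>.\<close>
  define g where "g u = (\<integral>t. f (u(i := t)) \<partial>\<mu>)" for u
  define m where "m = integral\<^sup>L ?M' f"
  note f_int = integrable_square_lipschitz[OF fin insert.prems]
  note fub = pm.product_integral_insert[OF insert.hyps]
  note sec = square_integrable_section[OF fin insert.prems(2) insertI1]
  have g_meas: "g \<in> borel_measurable ?M"
    unfolding g_def by (rule measurable_section_integral[OF insert.prems(1)])
  have g_lip: "lipschitz_sum L S g"
    unfolding g_def by (rule lipschitz_sum_section_integral[OF insert.hyps insert.prems(2)])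
  note g_int = integrable_square_lipschitz[OF insert.hyps(1) g_meas g_lip]
  have m_g: "m = integral\<^sup>L ?M g" unfolding m_def g_def by (rule fub[OF f_int(2)])
  have resp_int: "integrable ?M' (\<lambda>u. (f u - f (u(x := 0)))\<^sup>2)" if "x \<in> insert i S" for x
    by (rule integrable_square_response[OF fin insert.prems that])
  define R where "R x u = (\<integral>t. (f (u(i := t)) - f (u(i := t, x := 0)))\<^sup>2 \<partial>\<mu>)" for x u
  have R_eq: "(\<integral>u. (f u - f (u(x := 0)))\<^sup>2 \<partial>?M') = (\<integral>u. R x u \<partial>?M)" if "x \<in> insert i S" for x
    unfolding R_def by (rule fub[OF resp_int[OF that]])
  have upd: "(f (u(i := t)) - f (u(i := t, x := 0)))\<^sup>2 \<le> L\<^sup>2 * ((u(i := t)) x)\<^sup>2"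
    if "x \<in> insert i S" for x u t
  proof -
    have "\<bar>f (u(i := t)) - f (u(i := t, x := 0))\<bar> \<le> L * \<bar>(u(i := t)) x\<bar>"
      using lipschitz_sum_update[OF insert.prems(2) fin that, of "u(i := t)" "(u(i := t)) x" 0]
      unfolding fun_upd_triv diff_0_right .
    then have "(f (u(i := t)) - f (u(i := t, x := 0)))\<^sup>2 \<le> (L * \<bar>(u(i := t)) x\<bar>)\<^sup>2"
      by (intro abs_le_square_iff[THEN iffD1] order_trans[OF _ abs_ge_self])
    then show ?thesis by (simp add: power_mult_distrib)
  qed
  have sq_i: "integrable \<mu> (\<lambda>t. L\<^sup>2 * ((u(i := t)) x)\<^sup>2)" for u x
    using square_integrable by (cases "x = i") auto
  have sec_x: "(\<lambda>t. f (u(i := t, x := 0))) \<in> borel_measurable \<mu>" for x u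
  proof (cases "x = i")
    case False
    show ?thesis using sec(1)[of "u(x := 0)"] unfolding fun_upd_twist[OF False] .
  qed simp
  have Rt_int: "integrable \<mu> (\<lambda>t. (f (u(i := t)) - f (u(i := t, x := 0)))\<^sup>2)"
    if "x \<in> insert i S" for x u
    by (rule integrable_nonneg_bound[OF sq_i[of u x] borel_measurable_power[OF
          borel_measurable_diff[OF sec(1) sec_x]] zero_le_power2 upd[OF that]])
  have R_nonneg: "0 \<le> R x u" for x u unfolding R_def by (intro integral_nonneg_AE AE_I2) simp
  have R_int: "integrable ?M (R x)" if x: "x \<in> insert i S" for x
  proof (rule integrable_nonneg_bound[OF _ _ R_nonneg])
    let ?b = "\<lambda>u. if x = i then L\<^sup>2 * (\<integral>t. t\<^sup>2 \<partial>\<mu>) else L\<^sup>2 * (u x)\<^sup>2"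
    show "integrable ?M ?b"
      using x integrable_PiM_square[OF insert.hyps(1), of x] by (cases "x = i") auto
    show "R x \<in> borel_measurable ?M"
      unfolding R_def
      by (rule measurable_section_integral[of "\<lambda>u. (f u - f (u(x := 0)))\<^sup>2"])
        (use insert.prems(1) x in measurable)
    have "R x u \<le> (\<integral>t. L\<^sup>2 * ((u(i := t)) x)\<^sup>2 \<partial>\<mu>)" for u
      unfolding R_def by (rule integral_mono[OF Rt_int[OF x] sq_i upd[OF x]])
    also have "(\<integral>t. L\<^sup>2 * ((u(i := t)) x)\<^sup>2 \<partial>\<mu>) = ?b u" for u
      by (simp add: prob_space)
    finally show "R x u \<le> ?b u" for u .
  qed
  \<comment> \<open>The variance of a section is at most its second moment about any constant. The
    constant \<open>f (u(i := 0))\<close> produces the term of coordinate \<open>i\<close>; this is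
    where setting to zero replaces resampling.\<close>
  have sec_var: "(\<integral>t. (f (u(i := t)) - m)\<^sup>2 \<partial>\<mu>) \<le> R i u + (g u - m)\<^sup>2" for u
  proof -
    have "variance (\<lambda>t. f (u(i := t))) \<le> R i u"
      using square_expectation_decomp(2)[OF sec(3,2), of u "f (u(i := 0))"]
      unfolding R_def fun_upd_upd by (metis add.commute le_add_same_cancel2 zero_le_power2)
    then show ?thesis
      using square_expectation_decomp(2)[OF sec(3,2), of u m] unfolding g_def by linarith
  qed
  \<comment> \<open>Jensen: the squared response of an average is at most the average of the squared
    responses.\<close>
  have R_g: "(g u - g (u(x := 0)))\<^sup>2 \<le> R x u" if x: "x \<in> S" for x u
  proof -
    have "x \<noteq> i" using x insert.hyps by auto
    have "g u - g (u(x := 0)) = (\<integral>t. f (u(i := t)) - f (u(i := t, x := 0)) \<partial>\<mu>)"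
      unfolding g_def
      using Bochner_Integration.integral_diff[OF sec(3)[of u] sec(3)[of "u(x := 0)"]]
      unfolding fun_upd_twist[OF \<open>x \<noteq> i\<close>] by (rule sym)
    then show ?thesis
      unfolding R_def using Rt_int[of x u] x sec(1) sec_x
      by (simp only:) (intro square_expectation_le borel_measurable_diff sec(1) sec_x; simp)
  qed
  have "(\<integral>u. (f u - m)\<^sup>2 \<partial>?M') = (\<integral>u. (\<integral>t. (f (u(i := t)) - m)\<^sup>2 \<partial>\<mu>) \<partial>?M)"
    by (rule fub[OF S'.square_expectation_decomp(1)[OF f_int(2,1)]])
  also have "\<dots> \<le> (\<integral>u. R i u + (g u - m)\<^sup>2 \<partial>?M)"
  proof (rule integral_mono_AE)
    show i: "integrable ?M (\<lambda>u. R i u + (g u - m)\<^sup>2)"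
      using R_int[OF insertI1] S.square_expectation_decomp(1)[OF g_int(2,1)] by simp
    have "(\<lambda>u. \<integral>t. (f (u(i := t)) - m)\<^sup>2 \<partial>\<mu>) \<in> borel_measurable ?M"
      by (rule measurable_section_integral[of "\<lambda>u. (f u - m)\<^sup>2"])
        (use insert.prems(1) in measurable)
    then show "integrable ?M (\<lambda>u. \<integral>t. (f (u(i := t)) - m)\<^sup>2 \<partial>\<mu>)"
      by (rule integrable_nonneg_bound[OF i]) (use sec_var in \<open>simp_all add: integral_nonneg_AE\<close>)
  qed (use sec_var in simp)
  also have "\<dots> = (\<integral>u. R i u \<partial>?M) + (\<integral>u. (g u - m)\<^sup>2 \<partial>?M)"
    using R_int[OF insertI1] S.square_expectation_decomp(1)[OF g_int(2,1)] by simp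
  also have "(\<integral>u. (g u - m)\<^sup>2 \<partial>?M) \<le> (\<Sum>x\<in>S. \<integral>u. (g u - g (u(x := 0)))\<^sup>2 \<partial>?M)"
    unfolding m_g by (rule insert.IH[OF g_meas g_lip])
  also have "\<dots> \<le> (\<Sum>x\<in>S. \<integral>u. R x u \<partial>?M)"
    using R_g R_int integrable_square_response[OF insert.hyps(1) g_meas g_lip]
    by (intro sum_mono integral_mono) auto
  also have "(\<integral>u. R i u \<partial>?M) + (\<Sum>x\<in>S. \<integral>u. R x u \<partial>?M)
      = (\<Sum>x\<in>insert i S. \<integral>u. (f u - f (u(x := 0)))\<^sup>2 \<partial>?M')"
    using insert.hyps R_eq by simp
  finally show ?case by (simp only: m_def)
qed

end

section \<open>Independent identically distributed weights\<close>

lemma (in prob_space) second_moment_indep_sum: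
  fixes Y :: "'i \<Rightarrow> 'a \<Rightarrow> real"
  assumes "finite A" "indep_vars (\<lambda>_. borel) Y A"
    "\<And>i. i \<in> A \<Longrightarrow> integrable M (\<lambda>x. (Y i x)\<^sup>2)" "\<And>i. i \<in> A \<Longrightarrow> expectation (Y i) = 0"
  shows "integrable M (\<lambda>x. (\<Sum>i\<in>A. Y i x)\<^sup>2)"
    "expectation (\<lambda>x. (\<Sum>i\<in>A. Y i x)\<^sup>2) = (\<Sum>i\<in>A. expectation (\<lambda>x. (Y i x)\<^sup>2))"
proof -
  have int: "integrable M (Y i)" if "i \<in> A" for i
    using assms(2) that unfolding indep_vars_def
    by (intro square_integrable_imp_integrable[OF _ assms(3)[OF that]]) blast
  have prod: "integrable M (\<lambda>x. Y i x * Y j x) \<and>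
      expectation (\<lambda>x. Y i x * Y j x) = (if i = j then expectation (\<lambda>x. (Y i x)\<^sup>2) else 0)"
    if ij: "i \<in> A" "j \<in> A" for i j
  proof (cases "i = j")
    case True
    then show ?thesis using assms(3)[OF ij(1)] by (simp add: power2_eq_square)
  next
    case False
    have ind: "indep_vars (\<lambda>_. borel) Y {i, j}" using indep_vars_subset[OF assms(2)] ij by simp
    have int2: "integrable M (Y k)" if "k \<in> {i, j}" for k using that ij int by auto
    have "(\<lambda>x. \<Prod>k\<in>{i, j}. Y k x) = (\<lambda>x. Y i x * Y j x)" using False by auto
    then show ?thesis
      using indep_vars_lebesgue_integral[OF _ ind int2] indep_vars_integrable[OF _ ind int2]
        assms(4) ij False by simp
  qed
  have sq: "(\<Sum>i\<in>A. Y i x)\<^sup>2 = (\<Sum>i\<in>A. \<Sum>j\<in>A. Y i x * Y j x)" for x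
    by (simp add: power2_eq_square sum_product)
  show "integrable M (\<lambda>x. (\<Sum>i\<in>A. Y i x)\<^sup>2)"
    unfolding sq using prod by (intro Bochner_Integration.integrable_sum) auto
  have "expectation (\<lambda>x. (\<Sum>i\<in>A. Y i x)\<^sup>2) = (\<Sum>i\<in>A. \<Sum>j\<in>A. expectation (\<lambda>x. Y i x * Y j x))"
    unfolding sq using prod
    by (subst Bochner_Integration.integral_sum, intro Bochner_Integration.integrable_sum)
      (auto intro!: sum.cong Bochner_Integration.integral_sum)
  also have "\<dots> = (\<Sum>i\<in>A. \<Sum>j\<in>A. if i = j then expectation (\<lambda>x. (Y i x)\<^sup>2) else 0)"
    using prod by (intro sum.cong refl) simp
  also have "\<dots> = (\<Sum>i\<in>A. expectation (\<lambda>x. (Y i x)\<^sup>2))" using assms(1) by (intro sum.cong) auto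
  finally show "expectation (\<lambda>x. (\<Sum>i\<in>A. Y i x)\<^sup>2) = (\<Sum>i\<in>A. expectation (\<lambda>x. (Y i x)\<^sup>2))" .
qed

locale iid_weights = prob_space P + dist: square_integrable_distribution \<mu>
  for P :: "'w measure" and \<mu> :: "real measure" +
  fixes X :: "'s \<Rightarrow> 'w \<Rightarrow> real" and I :: "'s set"
  assumes indep_X: "indep_vars (\<lambda>_. borel) X I"
    and distr_X: "x \<in> I \<Longrightarrow> distr P borel (X x) = \<mu>"
begin

abbreviation weights :: "'w \<Rightarrow> 's \<Rightarrow> real" where
  "weights w \<equiv> \<lambda>x. X x w"

lemma X_measurable: "x \<in> I \<Longrightarrow> X x \<in> borel_measurable P"
  using indep_X by (simp add: indep_vars_def)

lemma measurable_PiM_\<mu>: "borel_measurable (PiM S (\<lambda>_. \<mu>)) = borel_measurable (PiM S (\<lambda>_. borel))"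
  by (intro measurable_cong_sets sets_PiM_cong refl) (simp add: dist.sets_\<mu>)

lemma restrict_measurable:
  "S \<subseteq> I \<Longrightarrow> (\<lambda>w. \<lambda>x\<in>S. X x w) \<in> P \<rightarrow>\<^sub>M PiM S (\<lambda>_. borel)"
  using X_measurable by (intro measurable_restrict) auto

lemma distr_restrict:
  assumes "S \<subseteq> I" "S \<noteq> {}"
  shows "distr P (PiM S (\<lambda>_. borel)) (\<lambda>w. \<lambda>x\<in>S. X x w) = PiM S (\<lambda>_. \<mu>)"
proof -
  have "distr P (PiM S (\<lambda>_. borel)) (\<lambda>w. \<lambda>x\<in>S. X x w) = (\<Pi>\<^sub>M x\<in>S. distr P borel (X x))"
    using indep_vars_subset[OF indep_X assms(1)] assms X_measurable
    by (subst (asm) indep_vars_iff_distr_eq_PiM') auto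
  also have "\<dots> = PiM S (\<lambda>_. \<mu>)" using assms distr_X by (intro PiM_cong) auto
  finally show ?thesis .
qed

lemma weights_measurable:
  assumes "S \<subseteq> I" "f \<in> borel_measurable (PiM S (\<lambda>_. borel))" "\<And>J. f (restrict J S) = f J"
  shows "(\<lambda>w. f (weights w)) \<in> borel_measurable P"
  using measurable_compose[OF restrict_measurable[OF assms(1)] assms(2)] assms(3) by simp

text \<open>Since \<open>f\<close> ignores the coordinates outside \<open>S\<close>, it may be
  evaluated at \<open>weights w\<close> directly, and expectations become integrals over a product
  measure.\<close>

lemma integral_transfer:
  fixes f :: "('s \<Rightarrow> real) \<Rightarrow> real"
  assumes "S \<subseteq> I" "S \<noteq> {}" "f \<in> borel_measurable (PiM S (\<lambda>_. borel))" "\<And>J. f (restrict J S) = f J"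
  shows "(\<integral>w. f (weights w) \<partial>P) = (\<integral>u. f u \<partial>PiM S (\<lambda>_. \<mu>))"
    "integrable P (\<lambda>w. f (weights w)) \<longleftrightarrow> integrable (PiM S (\<lambda>_. \<mu>)) f"
  using integral_distr[OF restrict_measurable[OF assms(1)] assms(3)]
    integrable_distr_eq[OF restrict_measurable[OF assms(1)] assms(3)]
  unfolding distr_restrict[OF assms(1,2)] assms(4) by auto

lemma lipschitz_transfer:
  assumes "finite S" "S \<subseteq> I" "S \<noteq> {}" "f \<in> borel_measurable (PiM S (\<lambda>_. borel))" "lipschitz_sum L S f"
  shows "integrable P (\<lambda>w. (f (weights w))\<^sup>2)" "integrable P (\<lambda>w. f (weights w))"
    and efron_stein: "variance (\<lambda>w. f (weights w))
      \<le> (\<Sum>x\<in>S. \<integral>w. (f (weights w) - f ((weights w)(x := 0)))\<^sup>2 \<partial>P)"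
proof -
  have res: "f (restrict J S) = f J" for J by (rule lipschitz_sum_cong[OF assms(5)]) simp
  have res_upd: "f ((restrict J S)(x := 0)) = f (J(x := 0))" for J x
    by (rule lipschitz_sum_cong[OF assms(5)]) simp
  have fm: "f \<in> borel_measurable (PiM S (\<lambda>_. \<mu>))" using assms(4) by (simp add: measurable_PiM_\<mu>)
  note int = dist.integrable_square_lipschitz[OF assms(1) fm assms(5)]
  have f2: "(\<lambda>J. (f J - c)\<^sup>2) \<in> borel_measurable (PiM S (\<lambda>_. borel))" for c
    by (intro borel_measurable_power borel_measurable_diff assms(4) borel_measurable_const)
  have fx: "(\<lambda>J. (f J - f (J(x := 0)))\<^sup>2) \<in> borel_measurable (PiM S (\<lambda>_. borel))" if "x \<in> S" for x
    using dist.measurable_update_const[OF fm that, of 0] assms(4) unfolding measurable_PiM_\<mu>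
    by (intro borel_measurable_power borel_measurable_diff)
  show "integrable P (\<lambda>w. (f (weights w))\<^sup>2)"
    using integral_transfer(2)[OF assms(2,3) f2[of 0]] int(1) res by simp
  show "integrable P (\<lambda>w. f (weights w))"
    using integral_transfer(2)[OF assms(2,3,4)] int(2) res by simp
  have "(\<integral>w. f (weights w) \<partial>P) = (\<integral>u. f u \<partial>PiM S (\<lambda>_. \<mu>))"
    by (rule integral_transfer(1)[OF assms(2,3,4) res])
  then show "variance (\<lambda>w. f (weights w))
      \<le> (\<Sum>x\<in>S. \<integral>w. (f (weights w) - f ((weights w)(x := 0)))\<^sup>2 \<partial>P)"
    using dist.efron_stein_PiM[OF assms(1) fm assms(5)]
    by (simp add: integral_transfer(1)[OF assms(2,3) f2] integral_transfer(1)[OF assms(2,3) fx] res res_upd)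
qed

lemma indep_split:
  assumes "A \<subseteq> I" "B \<subseteq> I" "A \<inter> B = {}"
    "f \<in> borel_measurable (PiM A (\<lambda>_. borel))" "g \<in> borel_measurable (PiM B (\<lambda>_. borel))"
    "\<And>J. f (restrict J A) = f J" "\<And>J. g (restrict J B) = g J"
  shows "indep_var borel (\<lambda>w. f (weights w) :: real) borel (\<lambda>w. g (weights w) :: real)"
  using indep_var_compose[OF indep_var_restrict[OF indep_X assms(3,1,2)] assms(4,5)]
  by (simp add: comp_def assms(6,7))

lemma prob_split:
  assumes "A \<subseteq> I" "B \<subseteq> I" "A \<inter> B = {}"
    "Measurable.pred (PiM A (\<lambda>_. borel)) p" "Measurable.pred (PiM B (\<lambda>_. borel)) q"
    "\<And>J. p (restrict J A) = p J" "\<And>J. q (restrict J B) = q J"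
  shows "\<P>(w in P. p (weights w) \<and> q (weights w)) = \<P>(w in P. p (weights w)) * \<P>(w in P. q (weights w))"
proof -
  let ?A = "{u \<in> space (PiM A (\<lambda>_. borel)). p u}" and ?B = "{u \<in> space (PiM B (\<lambda>_. borel)). q u}"
  have *: "(\<lambda>x\<in>S. X x w) \<in> space (PiM S (\<lambda>_. borel))" for S w by (simp add: space_PiM)
  have "prob ((\<lambda>w. (\<lambda>x\<in>A. X x w, \<lambda>x\<in>B. X x w)) -` (?A \<times> ?B) \<inter> space P)
      = prob ((\<lambda>w. \<lambda>x\<in>A. X x w) -` ?A \<inter> space P) * prob ((\<lambda>w. \<lambda>x\<in>B. X x w) -` ?B \<inter> space P)"
    using assms(4,5) by (intro indep_varD[OF indep_var_restrict[OF indep_X assms(3,1,2)]]) auto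
  moreover have "(\<lambda>w. (\<lambda>x\<in>A. X x w, \<lambda>x\<in>B. X x w)) -` (?A \<times> ?B) \<inter> space P
      = {w \<in> space P. p (weights w) \<and> q (weights w)}"
    using * assms(6)[of "weights _"] assms(7)[of "weights _"] by blast
  moreover have "(\<lambda>w. \<lambda>x\<in>A. X x w) -` ?A \<inter> space P = {w \<in> space P. p (weights w)}"
    using * assms(6)[of "weights _"] by blast
  moreover have "(\<lambda>w. \<lambda>x\<in>B. X x w) -` ?B \<inter> space P = {w \<in> space P. q (weights w)}"
    using * assms(7)[of "weights _"] by blast
  ultimately show ?thesis by simp
qed

lemma prob_rectangle:
  assumes "finite A" "A \<subseteq> I" "\<And>x. x \<in> A \<Longrightarrow> E x \<in> sets borel"
  shows "\<P>(w in P. \<forall>x\<in>A. X x w \<in> E x) = (\<Prod>x\<in>A. measure \<mu> (E x))"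
proof (cases "A = {}")
  case True
  then show ?thesis by (simp add: prob_space)
next
  case False
  have "\<P>(w in P. \<forall>x\<in>A. X x w \<in> E x) = prob (\<Inter>x\<in>A. X x -` E x \<inter> space P)"
    using False by (intro arg_cong[where f = prob]) auto
  also have "\<dots> = (\<Prod>x\<in>A. prob (X x -` E x \<inter> space P))"
    by (rule indep_varsD[OF indep_X False assms])
  also have "\<dots> = (\<Prod>x\<in>A. measure \<mu> (E x))"
  proof (rule prod.cong)
    fix x assume x: "x \<in> A"
    then have "x \<in> I" using assms(2) by auto
    then show "prob (X x -` E x \<inter> space P) = measure \<mu> (E x)"
      using distr_X[of x] measure_distr[OF X_measurable[of x] assms(3)[OF x]] by simp
  qed simp
  finally show ?thesis .
qed

lemma prob_rectangle_ge:
  assumes "finite A" "A \<subseteq> I" "\<And>x. x \<in> A \<Longrightarrow> E x \<in> sets borel"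
    "0 < c" "c \<le> 1" "\<And>x. x \<in> A \<Longrightarrow> c \<le> measure \<mu> (E x)" "card A \<le> N"
  shows "c ^ N \<le> \<P>(w in P. \<forall>x\<in>A. X x w \<in> E x)"
proof -
  have "c ^ N \<le> c ^ card A" using assms by (intro power_decreasing) auto
  also have "\<dots> = (\<Prod>x\<in>A. c)" by simp
  also have "\<dots> \<le> (\<Prod>x\<in>A. measure \<mu> (E x))" using assms by (intro prod_mono) auto
  finally show ?thesis using prob_rectangle[OF assms(1-3)] by simp
qed

text \<open>Used twice: for the monomer weights alone, indexed by vertices, and for the weights seen
  from a translated cube.\<close>

lemma iid_reindex:
  assumes "inj_on \<tau> A" "\<tau> ` A \<subseteq> I" shows "iid_weights P \<mu> (\<lambda>x. X (\<tau> x)) A"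
proof
  have "indep_vars (\<lambda>x. PiM {\<tau> x} (\<lambda>_. borel)) (\<lambda>x w. restrict (\<lambda>i. X i w) {\<tau> x}) A"
    using assms by (intro indep_vars_restrict[OF indep_X]) (auto simp: disjoint_family_on_def inj_on_def)
  then have "indep_vars (\<lambda>_. borel) (\<lambda>x w. (\<lambda>f. f (\<tau> x)) (restrict (\<lambda>i. X i w) {\<tau> x})) A"
    by (rule indep_vars_compose2) (rule measurable_component_singleton, simp)
  then show "indep_vars (\<lambda>_. borel) (\<lambda>x. X (\<tau> x)) A" by simp
  show "x \<in> A \<Longrightarrow> distr P borel (X (\<tau> x)) = \<mu>" for x using assms(2) by (intro distr_X) auto
qed

lemma iid_subset: "A \<subseteq> I \<Longrightarrow> iid_weights P \<mu> X A"
  using iid_reindex[of "\<lambda>x. x" A] by simp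

lemma distr_weights:
  fixes f :: "('s \<Rightarrow> real) \<Rightarrow> real"
  assumes "S \<subseteq> I" "S \<noteq> {}" "f \<in> borel_measurable (PiM S (\<lambda>_. borel))" "\<And>J. f (restrict J S) = f J"
  shows "distr P borel (\<lambda>w. f (weights w)) = distr (PiM S (\<lambda>_. \<mu>)) borel f"
proof -
  have "distr (distr P (PiM S (\<lambda>_. borel)) (\<lambda>w. \<lambda>x\<in>S. X x w)) borel f = distr P borel (f \<circ> (\<lambda>w. \<lambda>x\<in>S. X x w))"
    by (rule distr_distr[OF assms(3) restrict_measurable[OF assms(1)]])
  then show ?thesis unfolding distr_restrict[OF assms(1,2)] by (simp add: comp_def assms(4))
qed

lemma indep_blocks:
  fixes f :: "'i \<Rightarrow> ('s \<Rightarrow> real) \<Rightarrow> real"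
  assumes "\<And>z. z \<in> A \<Longrightarrow> K z \<subseteq> I" "disjoint_family_on K A"
    "\<And>z. z \<in> A \<Longrightarrow> f z \<in> borel_measurable (PiM (K z) (\<lambda>_. borel))" "\<And>z J. z \<in> A \<Longrightarrow> f z (restrict J (K z)) = f z J"
  shows "indep_vars (\<lambda>_. borel) (\<lambda>z w. f z (weights w)) A"
proof -
  have "indep_vars (\<lambda>_. borel) (\<lambda>z w. f z (restrict (\<lambda>i. X i w) (K z))) A"
    by (rule indep_vars_compose2[OF indep_vars_restrict[OF indep_X assms(1,2)] assms(3)])
  then show ?thesis
    by (rule indep_vars_cong[THEN iffD1, rotated -1]) (auto simp: assms(4))
qed

lemma expectation_weight:
  fixes f :: "real \<Rightarrow> real"
  assumes "x \<in> I" "f \<in> borel_measurable borel"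
  shows "(\<integral>w. f (X x w) \<partial>P) = (\<integral>t. f t \<partial>\<mu>)" "integrable P (\<lambda>w. f (X x w)) \<longleftrightarrow> integrable \<mu> f"
  using integral_distr[OF X_measurable[OF assms(1)] assms(2)]
    integrable_distr_eq[OF X_measurable[OF assms(1)] assms(2)] distr_X[OF assms(1)] by auto

end

section \<open>Localization of the cavity fields\<close>

lemma borel_measurable_pred_le:
  fixes f g :: "'a \<Rightarrow> real"
  shows "f \<in> borel_measurable M \<Longrightarrow> g \<in> borel_measurable M \<Longrightarrow> Measurable.pred M (\<lambda>w. f w \<le> g w)"
  unfolding Measurable.pred_def by (rule borel_measurable_le)

locale disordered_cover = cover_system cov S U mon + iid_weights P \<mu> X S
  for cov :: "'s \<Rightarrow> 'v set" and S :: "'s set" and U :: "'v set" and mon :: "'v \<Rightarrow> 's"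
    and P :: "'w measure" and \<mu> :: "real measure" and X :: "'s \<Rightarrow> 'w \<Rightarrow> real"
begin

section \<open>Measurability of energies, cavity fields and status events\<close>

lemma H_measurable:
  assumes "V \<subseteq> U" "\<And>x. x \<in> S \<Longrightarrow> cov x \<subseteq> V \<Longrightarrow> x \<in> B"
  shows "H V \<in> borel_measurable (PiM B (\<lambda>_. borel))"
proof -
  have sum_meas: "(\<lambda>J. sum J M) \<in> borel_measurable (PiM B (\<lambda>_. borel :: real measure))" if "M \<in> EC V" for M
  proof (intro borel_measurable_sum measurable_component_singleton)
    fix x assume "x \<in> M"
    then show "x \<in> B" using assms(2)[of x] that by (auto simp: exact_covers_def)
  qed
  show ?thesis
    using borel_measurable_Min[OF finite_EC[of V], of "\<lambda>M J. sum J M", OF sum_meas]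
    unfolding cover_energy_def[abs_def] by simp
qed

lemma H_restrict:
  assumes "\<And>x. x \<in> S \<Longrightarrow> cov x \<subseteq> V \<Longrightarrow> x \<in> B" shows "H V (restrict J B) = H V J"
  using assms by (intro H_cong) auto

text \<open>The point is that \<open>B\<close> may omit all sites at \<open>v\<close>. Measurability
  with respect to the remaining coordinates is what yields independence of the cavity fields from
  the weights at \<open>v\<close>.\<close>

lemma cavity_measurable:
  assumes "V \<subseteq> U" "v \<in> cov x" "S - sites_at v \<subseteq> B"
  shows "cavity v V x \<in> borel_measurable (PiM B (\<lambda>_. borel))"
  unfolding cavity_def[abs_def]
proof (intro borel_measurable_diff H_measurable)
  fix y assume "y \<in> S" "cov y \<subseteq> V - cov x" then show "y \<in> B" using assms by (auto simp: sites_at_def)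
next
  fix y assume "y \<in> S" "cov y \<subseteq> V - {v}" then show "y \<in> B" using assms by (auto simp: sites_at_def)
qed (use assms in auto)

lemma cavity_restrict:
  assumes "v \<in> cov x" "S - sites_at v \<subseteq> B"
  shows "cavity v V x (restrict J B) = cavity v V x J"
  using assms by (intro cavity_cong) (auto simp: sites_at_def)

lemma status_differs_pred:
  assumes "V \<subseteq> U" "V' \<subseteq> U" "v \<in> U"
  shows "Measurable.pred (PiM S (\<lambda>_. borel)) (status_differs V V' v)"
proof -
  have c: "(\<lambda>J. J y + cavity v V0 y J) \<in> borel_measurable (PiM S (\<lambda>_. borel))"
    if "y \<in> sites_at v" "V0 \<subseteq> U" for y V0
    using that by (intro borel_measurable_add measurable_component_singleton cavity_measurable)
      (auto simp: sites_at_def)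
  have m: "(\<lambda>J. J (mon v)) \<in> borel_measurable (PiM S (\<lambda>_. borel :: real measure))"
    by (rule measurable_component_singleton[OF mon_in[OF assms(3)]])
  show ?thesis
    unfolding status_differs_def[abs_def]
    by (intro pred_intros_logic pred_intros_finite finite_sites_at finite_Diff borel_measurable_pred_less c m)
      (use assms in auto)
qed

lemma status_differs_restrict:
  assumes "v \<in> U" shows "status_differs V V' v (restrict J S) = status_differs V V' v J"
proof -
  have "cavity v V0 y (restrict J S) = cavity v V0 y J" if "y \<in> sites_at v" for y V0
    using that by (intro cavity_restrict) (auto simp: sites_at_def)
  moreover have "restrict J S y = J y" if "y \<in> sites_at v" for y using that by (simp add: sites_at_def)
  ultimately show ?thesis using mon_in[OF assms] by (simp add: status_differs_def)
qed

text \<open>If the cavity fields of \<open>y\<close> in \<open>V\<close> and \<open>V'\<close> are separated by \<open>[g, g + \<eta>/2]\<close>, the weights at \<open>v\<close>,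
  which are independent of the cavity fields, fall with probability at least \<open>c ^ D\<close> into a window
  where \<open>v\<close> is covered by \<open>y\<close> in \<open>V\<close> but is a monomer in \<open>V'\<close>.\<close>
lemma status_differs_prob_ge:
  assumes V: "V \<subseteq> U" "V' \<subseteq> U" and v: "v \<in> U" and y: "y \<in> sites_at v" "y \<noteq> mon v"
    and c: "0 < c" "c \<le> 1" "c \<le> measure \<mu> {s<..<s + \<eta>/4}"
      "c \<le> measure \<mu> {s + g + \<eta>/4<..<s + g + \<eta>/2}" "c \<le> measure \<mu> {T<..}"
    and T: "s + g + \<eta>/2 + K \<le> T" and D: "card (sites_at v) \<le> D"
  shows "c ^ D * \<P>(w in P. cavity v V y (weights w) \<le> g \<and> g + \<eta>/2 \<le> cavity v V' y (weights w) \<and>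
      (\<forall>x\<in>sites_at v. - K \<le> cavity v V' x (weights w)))
    \<le> \<P>(w in P. status_differs V V' v (weights w))"
proof -
  \<comment> \<open>In \<open>V\<close> the site \<open>y\<close> costs less than
    \<open>s + g + \<eta>/4\<close>, in \<open>V'\<close> more than \<open>s + g + \<eta>/2\<close>,
    and the monomer weight falls strictly between. The remaining weights exceed \<open>T\<close>,
    which outweighs cavity fields as low as \<open>-K\<close>.\<close>
  define E where "E x = (if x = y then {s<..<s + \<eta>/4} else if x = mon v
    then {s + g + \<eta>/4<..<s + g + \<eta>/2} else {T<..})" for x
  define p where "p J \<longleftrightarrow> (\<forall>x\<in>sites_at v. J x \<in> E x)" for J :: "'s \<Rightarrow> real"
  define q where "q J \<longleftrightarrow> cavity v V y J \<le> g \<and> g + \<eta>/2 \<le> cavity v V' y J \<and>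
      (\<forall>x\<in>sites_at v. - K \<le> cavity v V' x J)" for J
  have E_sets: "E x \<in> sets borel" for x by (simp add: E_def)
  have sub: "sites_at v \<subseteq> S" by (auto simp: sites_at_def)
  have vin: "v \<in> cov x" if "x \<in> sites_at v" for x using that by (simp add: sites_at_def)
  have mon_v: "mon v \<in> sites_at v" using mon_in[OF v] cov_mon[OF v] by (simp add: sites_at_def)
  have p_meas: "Measurable.pred (PiM (sites_at v) (\<lambda>_. borel)) p"
    unfolding p_def[abs_def]
    by (intro pred_intros_finite finite_sites_at pred_sets2[OF E_sets] measurable_component_singleton)
  have cm: "cavity v V0 x \<in> borel_measurable (PiM (S - sites_at v) (\<lambda>_. borel))"
    if "x \<in> sites_at v" "V0 \<subseteq> U" for x V0
    using that vin by (intro cavity_measurable) auto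
  have q_meas: "Measurable.pred (PiM (S - sites_at v) (\<lambda>_. borel)) q"
    unfolding q_def[abs_def]
    by (intro pred_intros_logic pred_intros_finite finite_sites_at borel_measurable_pred_le cm
        borel_measurable_const y V)
  have q_res: "q (restrict J (S - sites_at v)) = q J" for J
    using vin y by (simp add: q_def cavity_restrict cong: ball_cong)
  have "c ^ D \<le> \<P>(w in P. \<forall>x\<in>sites_at v. X x w \<in> E x)"
    using c by (intro prob_rectangle_ge finite_sites_at sub E_sets D) (auto simp: E_def)
  then have "c ^ D * \<P>(w in P. q (weights w)) \<le> \<P>(w in P. p (weights w)) * \<P>(w in P. q (weights w))"
    by (intro mult_right_mono) (auto simp: p_def)
  also have "\<dots> = \<P>(w in P. p (weights w) \<and> q (weights w))"
    by (rule prob_split[symmetric, OF sub _ _ p_meas q_meas _ q_res]) (auto simp: p_def)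
  also have "\<dots> \<le> \<P>(w in P. status_differs V V' v (weights w))"
  proof (rule finite_measure_mono)
    have "status_differs V V' v J" if pq: "p J" "q J" for J
    proof -
      have J: "J x \<in> E x" if "x \<in> sites_at v" for x using pq(1) that by (simp add: p_def)
      have y': "s < J y" "J y < s + \<eta>/4" using J[OF y(1)] by (auto simp: E_def)
      have m: "s + g + \<eta>/4 < J (mon v)" "J (mon v) < s + g + \<eta>/2"
        using J[OF mon_v] y(2) by (auto simp: E_def split: if_splits)
      have "J y + cavity v V y J < J (mon v)" using pq(2) y' m by (auto simp: q_def)
      moreover have "J (mon v) < J x + cavity v V' x J" if x: "x \<in> sites_at v" "x \<noteq> mon v" for x
      proof (cases "x = y")
        case True
        then show ?thesis using pq(2) y' m by (auto simp: q_def)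
      next
        case False
        then have "T < J x" using J[OF x(1)] x(2) by (auto simp: E_def)
        moreover have "- K \<le> cavity v V' x J" using pq(2) x(1) by (simp add: q_def)
        ultimately show ?thesis using m T by linarith
      qed
      ultimately show ?thesis using y(1) by (auto simp: status_differs_def)
    qed
    then show "{w \<in> space P. p (weights w) \<and> q (weights w)}
        \<subseteq> {w \<in> space P. status_differs V V' v (weights w)}" by blast
    show "{w \<in> space P. status_differs V V' v (weights w)} \<in> events"
      using measurable_compose[OF restrict_measurable[OF order_refl] status_differs_pred[OF V v]]
      unfolding status_differs_restrict[OF v] by (simp add: pred_def)
  qed
  finally show ?thesis by (simp add: q_def)
qed

lemma status_differs_event:
  assumes "V \<subseteq> U" "V' \<subseteq> U" "v \<in> U"
  shows "{w \<in> space P. status_differs V V' v (weights w)} \<in> events"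
  using measurable_compose[OF restrict_measurable[OF order_refl] status_differs_pred[OF assms]]
  unfolding status_differs_restrict[OF assms(3)] by (simp add: pred_def)

lemma cavity_weights_measurable:
  assumes "V \<subseteq> U" "v \<in> cov x"
  shows "(\<lambda>w. cavity v V x (weights w)) \<in> borel_measurable P"
  using assms
  by (intro weights_measurable[where S = S] cavity_measurable cavity_restrict) (auto simp: sites_at_def)

text \<open>A single variable dominating all cavity fields at \<open>v\<close>, for every vertex set
  that contains the vertices of the sites at \<open>v\<close>. Markov's inequality is then needed
  only once per vertex.\<close>

definition neighbourhood_bound :: "'v \<Rightarrow> ('s \<Rightarrow> real) \<Rightarrow> real" where
  "neighbourhood_bound v J = (\<Sum>x\<in>sites_at v. \<Sum>a\<in>cov x. local_bound a J)"

lemma cavity_le_neighbourhood_bound: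
  assumes "V \<subseteq> U" "x \<in> sites_at v" "cov x \<subseteq> V"
  shows "\<bar>cavity v V x J\<bar> \<le> neighbourhood_bound v J"
proof -
  have "(\<Sum>a\<in>cov x. local_bound a J) \<le> neighbourhood_bound v J"
    unfolding neighbourhood_bound_def using assms(2) local_bound_nonneg
    by (intro member_le_sum[of x _ "\<lambda>x. \<Sum>a\<in>cov x. local_bound a J"] sum_nonneg finite_sites_at) auto
  then show ?thesis using cavity_bound[OF assms, of J] by linarith
qed

lemma card_cov_le: "x \<in> S \<Longrightarrow> card (cov x) \<le> 2"
  using cov_cases by fastforce

definition "abs_mean = (\<integral>t. \<bar>t\<bar> \<partial>\<mu>)"

lemma abs_mean_nonneg: "0 \<le> abs_mean"
  unfolding abs_mean_def by simp

lemma weight_abs_integral: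
  assumes "x \<in> S"
  shows "integrable P (\<lambda>w. \<bar>X x w\<bar>)" "(\<integral>w. \<bar>X x w\<bar> \<partial>P) = abs_mean"
proof -
  have "integrable \<mu> (\<lambda>t. t)"
    by (rule dist.square_integrable_imp_integrable[OF _ dist.square_integrable])
      (simp add: measurable_cong_sets[OF dist.sets_\<mu> refl])
  then have "integrable \<mu> (\<lambda>t. \<bar>t\<bar>)" by simp
  then show "integrable P (\<lambda>w. \<bar>X x w\<bar>)" "(\<integral>w. \<bar>X x w\<bar> \<partial>P) = abs_mean"
    using expectation_weight[OF assms, of "\<lambda>t. \<bar>t\<bar>"] by (simp_all add: abs_mean_def)
qed

text \<open>The factor counts weights: at most \<open>D\<close> sites at \<open>v\<close>, two
  vertices on each, \<open>D\<close> sites at each of those, and three weights per site (its own and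
  at most two monomers).\<close>

lemma neighbourhood_bound_integral:
  assumes "v \<in> U" "\<And>v. v \<in> U \<Longrightarrow> card (sites_at v) \<le> D"
  shows "integrable P (\<lambda>w. neighbourhood_bound v (weights w))"
    "(\<integral>w. neighbourhood_bound v (weights w) \<partial>P) \<le> 6 * (real D)\<^sup>2 * abs_mean"
proof -
  have sS: "x \<in> S" if "x \<in> sites_at a" for x a using that by (simp add: sites_at_def)
  have mS: "mon b \<in> S" if "x \<in> S" "b \<in> cov x" for x b using cov_subset[OF that(1)] that(2) mon_in by auto
  have aU: "a \<in> U" if "x \<in> sites_at v" "a \<in> cov x" for x a using cov_subset[OF sS[OF that(1)]] that(2) by auto
  have int_term: "integrable P (\<lambda>w. \<bar>X x w\<bar> + (\<Sum>b\<in>cov x. \<bar>X (mon b) w\<bar>))" if "x \<in> S" for x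
    using that mS[OF that] by (intro Bochner_Integration.integrable_add Bochner_Integration.integrable_sum
        weight_abs_integral(1))
  have lb_int: "integrable P (\<lambda>w. local_bound a (weights w))" for a
    unfolding local_bound_def by (intro Bochner_Integration.integrable_sum int_term sS)
  show "integrable P (\<lambda>w. neighbourhood_bound v (weights w))"
    unfolding neighbourhood_bound_def by (intro Bochner_Integration.integrable_sum lb_int)
  have term_le: "(\<integral>w. \<bar>X x w\<bar> + (\<Sum>b\<in>cov x. \<bar>X (mon b) w\<bar>) \<partial>P) \<le> 3 * abs_mean" if x: "x \<in> S" for x
  proof -
    have "(\<integral>w. \<bar>X x w\<bar> + (\<Sum>b\<in>cov x. \<bar>X (mon b) w\<bar>) \<partial>P) = abs_mean + (\<Sum>b\<in>cov x. abs_mean)"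
      using x mS[OF x] weight_abs_integral by (subst Bochner_Integration.integral_add) auto
    also have "\<dots> \<le> abs_mean + 2 * abs_mean"
      using card_cov_le[OF x] abs_mean_nonneg by (auto intro!: mult_right_mono)
    finally show ?thesis by simp
  qed
  have lb_le: "(\<integral>w. local_bound a (weights w) \<partial>P) \<le> real D * (3 * abs_mean)" if "a \<in> U" for a
  proof -
    have "(\<integral>w. local_bound a (weights w) \<partial>P)
        = (\<Sum>x\<in>sites_at a. \<integral>w. \<bar>X x w\<bar> + (\<Sum>b\<in>cov x. \<bar>X (mon b) w\<bar>) \<partial>P)"
      unfolding local_bound_def by (intro Bochner_Integration.integral_sum int_term sS)
    also have "\<dots> \<le> (\<Sum>x\<in>sites_at a. 3 * abs_mean)" by (intro sum_mono term_le sS)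
    also have "\<dots> \<le> real D * (3 * abs_mean)"
      using assms(2)[OF that] abs_mean_nonneg by (simp add: mult_right_mono)
    finally show ?thesis .
  qed
  have "(\<integral>w. neighbourhood_bound v (weights w) \<partial>P)
      = (\<Sum>x\<in>sites_at v. \<Sum>a\<in>cov x. \<integral>w. local_bound a (weights w) \<partial>P)"
    unfolding neighbourhood_bound_def
    by (subst Bochner_Integration.integral_sum, intro Bochner_Integration.integrable_sum lb_int)
      (intro sum.cong refl Bochner_Integration.integral_sum lb_int)
  also have "\<dots> \<le> (\<Sum>x\<in>sites_at v. \<Sum>a\<in>cov x. real D * (3 * abs_mean))"
    by (intro sum_mono lb_le aU)
  also have "\<dots> \<le> (\<Sum>x\<in>sites_at v. 2 * (real D * (3 * abs_mean)))"
  proof (rule sum_mono)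
    fix x assume "x \<in> sites_at v"
    then show "(\<Sum>a\<in>cov x. real D * (3 * abs_mean)) \<le> 2 * (real D * (3 * abs_mean))"
      using card_cov_le[OF sS] abs_mean_nonneg
      by (simp only: sum_constant, intro mult_right_mono mult_nonneg_nonneg) fastforce+
  qed
  also have "\<dots> \<le> real D * (2 * (real D * (3 * abs_mean)))"
    using assms(2)[OF assms(1)] abs_mean_nonneg by (simp add: mult_right_mono)
  finally show "(\<integral>w. neighbourhood_bound v (weights w) \<partial>P) \<le> 6 * (real D)\<^sup>2 * abs_mean"
    by (simp add: power2_eq_square algebra_simps)
qed

text \<open>Markov's inequality discards the event that some cavity field exceeds \<open>K\<close>.
  Otherwise round the smaller of the two fields up to a grid point \<open>g\<close>, losing at most
  \<eta>/4; a gap above \<eta> then still contains the interval from \<open>g\<close> to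
  \<open>g + \<eta>/2\<close>. A union bound over \<open>y\<close>, over \<open>g\<close> and over
  the two orders of \<open>V\<close> and \<open>V'\<close> gives the factor
  \<open>2 * real D * real (card \<Gamma>)\<close>.\<close>

lemma cavity_differs_prob_le:
  assumes V: "V \<subseteq> U" "V' \<subseteq> U" and v: "v \<in> V" "v \<in> V'"
    and sub: "\<And>x. x \<in> sites_at v \<Longrightarrow> cov x \<subseteq> V" "\<And>x. x \<in> sites_at v \<Longrightarrow> cov x \<subseteq> V'"
    and \<Gamma>: "finite \<Gamma>" "\<And>h. \<bar>h\<bar> \<le> K \<Longrightarrow> \<exists>g\<in>\<Gamma>. h \<le> g \<and> g \<le> h + \<eta>/4"
    and c: "0 < c" "c \<le> 1" "c \<le> measure \<mu> {s<..<s + \<eta>/4}"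
      "\<And>g. g \<in> \<Gamma> \<Longrightarrow> c \<le> measure \<mu> {s + g + \<eta>/4<..<s + g + \<eta>/2}" "c \<le> measure \<mu> {T<..}"
    and T: "\<And>g. g \<in> \<Gamma> \<Longrightarrow> s + g + \<eta>/2 + K \<le> T" and pos: "0 < \<eta>" "0 < K"
    and D: "\<And>v. v \<in> U \<Longrightarrow> card (sites_at v) \<le> D"
  shows "\<P>(w in P. \<exists>y\<in>sites_at v. \<eta> < \<bar>cavity v V y (weights w) - cavity v V' y (weights w)\<bar>)
    \<le> 6 * (real D)\<^sup>2 * abs_mean / K + 2 * real D * real (card \<Gamma>) / c ^ D *
        \<P>(w in P. status_differs V V' v (weights w) \<or> status_differs V' V v (weights w))"
proof -
  have vU: "v \<in> U" using V v by auto
  have vin: "v \<in> cov y" if "y \<in> sites_at v" for y using that by (simp add: sites_at_def)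
  define q where "q V V' y g w \<longleftrightarrow> cavity v V y (weights w) \<le> g \<and> g + \<eta>/2 \<le> cavity v V' y (weights w) \<and>
      (\<forall>x\<in>sites_at v. - K \<le> cavity v V' x (weights w))" for V V' y g w
  let ?big = "{w \<in> space P. K \<le> neighbourhood_bound v (weights w)}"
  let ?Q = "\<lambda>V V' y g. {w \<in> space P. q V V' y g w}"
  let ?Y = "sites_at v - {mon v}"
  let ?p = "\<P>(w in P. status_differs V V' v (weights w) \<or> status_differs V' V v (weights w))"
  note nb = neighbourhood_bound_integral[OF vU D]
  have big_ev: "?big \<in> events" using nb(1) by measurable
  have Q_ev: "?Q V V' y g \<in> events" if "V \<subseteq> U" "V' \<subseteq> U" "y \<in> sites_at v" for V V' y g
  proof -
    have "Measurable.pred P (q V V' y g)"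
      unfolding q_def[abs_def]
      by (intro pred_intros_logic pred_intros_finite finite_sites_at borel_measurable_pred_le
        cavity_weights_measurable borel_measurable_const that vin)
    then show ?thesis by (rule predE)
  qed
  have or_ev: "{w \<in> space P. status_differs V V' v (weights w) \<or> status_differs V' V v (weights w)} \<in> events"
    using status_differs_event[OF V vU] status_differs_event[OF V(2,1) vU]
    by (simp add: Collect_disj_eq conj_disj_distribL sets.Un)
  have Q_le: "prob (?Q V V' y g) \<le> ?p / c ^ D" "prob (?Q V' V y g) \<le> ?p / c ^ D"
    if y: "y \<in> ?Y" and g: "g \<in> \<Gamma>" for y g
  proof -
    have "c ^ D * prob (?Q V V' y g) \<le> \<P>(w in P. status_differs V V' v (weights w))"
      unfolding q_def using y by (intro status_differs_prob_ge[OF V vU _ _ c(1-3) c(4)[OF g] c(5) T[OF g] D[OF vU]]) auto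
    also have "\<dots> \<le> ?p" by (rule finite_measure_mono[OF _ or_ev]) auto
    finally show "prob (?Q V V' y g) \<le> ?p / c ^ D" using c(1) by (simp add: field_simps)
    have "c ^ D * prob (?Q V' V y g) \<le> \<P>(w in P. status_differs V' V v (weights w))"
      unfolding q_def using y by (intro status_differs_prob_ge[OF V(2,1) vU _ _ c(1-3) c(4)[OF g] c(5) T[OF g] D[OF vU]]) auto
    also have "\<dots> \<le> ?p" by (rule finite_measure_mono[OF _ or_ev]) auto
    finally show "prob (?Q V' V y g) \<le> ?p / c ^ D" using c(1) by (simp add: field_simps)
  qed
  have cover: "{w \<in> space P. \<exists>y\<in>sites_at v. \<eta> < \<bar>cavity v V y (weights w) - cavity v V' y (weights w)\<bar>}
      \<subseteq> ?big \<union> (\<Union>y\<in>?Y. \<Union>g\<in>\<Gamma>. ?Q V V' y g \<union> ?Q V' V y g)"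
  proof
    fix w assume w: "w \<in> {w \<in> space P. \<exists>y\<in>sites_at v. \<eta> < \<bar>cavity v V y (weights w) - cavity v V' y (weights w)\<bar>}"
    then obtain y where y: "y \<in> sites_at v"
      "\<eta> < \<bar>cavity v V y (weights w) - cavity v V' y (weights w)\<bar>" by blast
    show "w \<in> ?big \<union> (\<Union>y\<in>?Y. \<Union>g\<in>\<Gamma>. ?Q V V' y g \<union> ?Q V' V y g)"
    proof (cases "K \<le> neighbourhood_bound v (weights w)")
      case False
      have b: "\<bar>cavity v V x (weights w)\<bar> \<le> K" "\<bar>cavity v V' x (weights w)\<bar> \<le> K" if "x \<in> sites_at v" for x
        using cavity_le_neighbourhood_bound[OF V(1) that sub(1)[OF that], of "weights w"]
          cavity_le_neighbourhood_bound[OF V(2) that sub(2)[OF that], of "weights w"] False by linarith+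
      have lo: "\<forall>x\<in>sites_at v. - K \<le> cavity v V x (weights w)" "\<forall>x\<in>sites_at v. - K \<le> cavity v V' x (weights w)"
        using b unfolding abs_le_iff by (metis minus_le_iff)+
      \<comment> \<open>The cavity field of a monomer is zero for both vertex sets, so it cannot
        show a gap.\<close>
      have "y \<noteq> mon v" using y(2) pos by (auto simp: cavity_mon[OF vU])
      then have yY: "y \<in> ?Y" using y(1) by simp
      have "\<exists>g\<in>\<Gamma>. q V V' y g w \<or> q V' V y g w"
      proof (cases "cavity v V y (weights w) < cavity v V' y (weights w)")
        case True
        obtain g where "g \<in> \<Gamma>" "cavity v V y (weights w) \<le> g" "g \<le> cavity v V y (weights w) + \<eta>/4"
          using \<Gamma>(2)[OF b(1)[OF y(1)]] by blast
        then show ?thesis using True y(2) lo pos by (intro bexI[of _ g]) (auto simp: q_def)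
      next
        case False
        obtain g where "g \<in> \<Gamma>" "cavity v V' y (weights w) \<le> g" "g \<le> cavity v V' y (weights w) + \<eta>/4"
          using \<Gamma>(2)[OF b(2)[OF y(1)]] by blast
        then show ?thesis using False y(2) lo pos by (intro bexI[of _ g]) (auto simp: q_def)
      qed
      then show ?thesis using yY w by blast
    qed (use w in blast)
  qed
  have "\<P>(w in P. \<exists>y\<in>sites_at v. \<eta> < \<bar>cavity v V y (weights w) - cavity v V' y (weights w)\<bar>)
      \<le> prob (?big \<union> (\<Union>y\<in>?Y. \<Union>g\<in>\<Gamma>. ?Q V V' y g \<union> ?Q V' V y g))"
    using Q_ev V \<Gamma>(1) finite_sites_at big_ev
    by (intro finite_measure_mono[OF cover] sets.Un sets.finite_UN) auto
  also have "\<dots> \<le> prob ?big + prob (\<Union>y\<in>?Y. \<Union>g\<in>\<Gamma>. ?Q V V' y g \<union> ?Q V' V y g)"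
    using Q_ev V \<Gamma>(1) finite_sites_at big_ev
    by (intro measure_Un_le sets.Un sets.finite_UN) auto
  also have "prob (\<Union>y\<in>?Y. \<Union>g\<in>\<Gamma>. ?Q V V' y g \<union> ?Q V' V y g)
      \<le> (\<Sum>y\<in>?Y. prob (\<Union>g\<in>\<Gamma>. ?Q V V' y g \<union> ?Q V' V y g))"
    using Q_ev V \<Gamma>(1) finite_sites_at
    by (intro measure_UNION_le sets.Un sets.finite_UN) auto
  also have "\<dots> \<le> (\<Sum>y\<in>?Y. \<Sum>g\<in>\<Gamma>. prob (?Q V V' y g \<union> ?Q V' V y g))"
    using Q_ev V \<Gamma>(1) by (intro sum_mono measure_UNION_le sets.Un) auto
  also have "\<dots> \<le> (\<Sum>y\<in>?Y. \<Sum>g\<in>\<Gamma>. 2 * (?p / c ^ D))"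
  proof (intro sum_mono)
    fix y g assume yg: "y \<in> ?Y" "g \<in> \<Gamma>"
    have "prob (?Q V V' y g \<union> ?Q V' V y g) \<le> prob (?Q V V' y g) + prob (?Q V' V y g)"
      using Q_ev V yg by (intro measure_Un_le) auto
    then show "prob (?Q V V' y g \<union> ?Q V' V y g) \<le> 2 * (?p / c ^ D)" using Q_le[OF yg] by linarith
  qed
  also have "\<dots> = real (card ?Y) * (real (card \<Gamma>) * (2 * (?p / c ^ D)))" by simp
  also have "\<dots> \<le> real D * (real (card \<Gamma>) * (2 * (?p / c ^ D)))"
    using D[OF vU] card_mono[of "sites_at v" ?Y] finite_sites_at c(1)
    by (intro mult_right_mono mult_nonneg_nonneg divide_nonneg_nonneg) (auto simp: order_trans)
  also have "prob ?big \<le> 6 * (real D)\<^sup>2 * abs_mean / K"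
  proof -
    have "prob ?big \<le> (\<integral>w. neighbourhood_bound v (weights w) \<partial>P) / K"
      using local_bound_nonneg
      by (intro integral_Markov_inequality_measure[where A = "{}"] nb(1) pos)
        (auto simp: neighbourhood_bound_def intro!: sum_nonneg)
    also have "\<dots> \<le> 6 * (real D)\<^sup>2 * abs_mean / K" using nb(2) pos by (intro divide_right_mono) auto
    finally show ?thesis .
  qed
  finally show ?thesis by (simp add: algebra_simps)
qed

subsection \<open>Variance bounds\<close>

definition "square_mean = (\<integral>t. t\<^sup>2 \<partial>\<mu>)"

lemma square_mean_nonneg: "0 \<le> square_mean"
  unfolding square_mean_def by simp

lemma weight_square_integral:
  assumes "x \<in> S"
  shows "integrable P (\<lambda>w. (X x w)\<^sup>2)" "(\<integral>w. (X x w)\<^sup>2 \<partial>P) = square_mean"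
  using expectation_weight[OF assms, of "\<lambda>t. t\<^sup>2"] dist.square_integrable
  by (simp_all add: square_mean_def)

lemma S_nonempty: "U \<noteq> {} \<Longrightarrow> S \<noteq> {}"
  using mon_in by blast

lemma H_lipschitz_sum: "V \<subseteq> U \<Longrightarrow> lipschitz_sum 1 S (H V)"
  using H_lipschitz by (simp add: lipschitz_sum_def)

lemma H_diff_lipschitz_sum:
  assumes "V \<subseteq> U" "V' \<subseteq> U" shows "lipschitz_sum 2 S (\<lambda>J. H V J - H V' J)"
  unfolding lipschitz_sum_def
proof (intro allI)
  fix J J'
  show "\<bar>H V J - H V' J - (H V J' - H V' J')\<bar> \<le> 2 * (\<Sum>x\<in>S. \<bar>J x - J' x\<bar>)"
    using H_lipschitz[OF assms(1), of J J'] H_lipschitz[OF assms(2), of J J'] by linarith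
qed

lemma H_meas: "V \<subseteq> U \<Longrightarrow> H V \<in> borel_measurable (PiM S (\<lambda>_. borel))"
  by (rule H_measurable)

lemma H_update_weights_measurable:
  assumes "V \<subseteq> U" "x \<in> S"
  shows "(\<lambda>w. H V ((weights w)(x := t))) \<in> borel_measurable P"
proof (rule weights_measurable[where S = S and f = "\<lambda>J. H V (J(x := t))", OF order_refl])
  show "(\<lambda>J. H V (J(x := t))) \<in> borel_measurable (PiM S (\<lambda>_. borel))"
    using dist.measurable_update_const[of "H V" S x t] H_meas[OF assms(1)] assms(2)
    unfolding measurable_PiM_\<mu> by blast
  show "H V ((restrict J S)(x := t)) = H V (J(x := t))" for J
    by (rule H_cong) auto
qed

lemma H_weights_measurable: "V \<subseteq> U \<Longrightarrow> (\<lambda>w. H V (weights w)) \<in> borel_measurable P"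
  by (rule weights_measurable[OF order_refl H_meas H_restrict])

lemma H_weights_integrable:
  assumes "V \<subseteq> U" "U \<noteq> {}"
  shows "integrable P (\<lambda>w. (H V (weights w))\<^sup>2)" "integrable P (\<lambda>w. H V (weights w))"
  using lipschitz_transfer(1,2)[OF finite_S order_refl S_nonempty[OF assms(2)] H_meas[OF assms(1)]
      H_lipschitz_sum[OF assms(1)]] by auto

text \<open>Expectation of the pointwise count \<open>card_status_differs\<close>. The bound does
  not grow with \<open>G\<close>, so the average probability over \<open>G\<close> is small as soon
  as \<open>W\<close> is sparse.\<close>

lemma status_differs_sum_le:
  assumes "W \<subseteq> U" "G \<subseteq> U - W" "\<And>v x. v \<in> G \<Longrightarrow> x \<in> sites_at v \<Longrightarrow> cov x \<subseteq> U - W"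
  shows "(\<Sum>v\<in>G. \<P>(w in P. status_differs U (U - W) v (weights w) \<or> status_differs (U - W) U v (weights w)))
    \<le> real (card W)"
proof -
  let ?st = "\<lambda>v J. status_differs U (U - W) v J \<or> status_differs (U - W) U v J"
  let ?A = "\<lambda>v. {w \<in> space P. ?st v (weights w)}"
  have fin: "finite G" using assms(2) finite_U finite_subset by (metis Diff_subset subset_trans)
  have ev: "?A v \<in> events" if "v \<in> G" for v
  proof -
    have "v \<in> U" using that assms(2) by auto
    then show ?thesis
      using status_differs_event[of U "U - W" v] status_differs_event[of "U - W" U v]
      by (simp add: Collect_disj_eq conj_disj_distribL sets.Un)
  qed
  have "(\<Sum>v\<in>G. prob (?A v)) = (\<Sum>v\<in>G. \<integral>w. indicator (?A v) w \<partial>P)"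
    using ev by (intro sum.cong refl) (simp add: Int_absorb2 sets.sets_into_space)
  also have "\<dots> = (\<integral>w. (\<Sum>v\<in>G. indicator (?A v) w) \<partial>P)"
    using ev by (intro Bochner_Integration.integral_sum[symmetric] integrable_real_indicator)
      (auto simp: emeasure_eq_measure)
  also have "\<dots> \<le> (\<integral>w. real (card W) \<partial>P)"
  proof (rule integral_mono)
    show "integrable P (\<lambda>w. \<Sum>v\<in>G. indicator (?A v) w :: real)"
      using ev by (intro Bochner_Integration.integrable_sum integrable_real_indicator)
        (auto simp: emeasure_eq_measure)
    fix w assume w: "w \<in> space P"
    have "(\<Sum>v\<in>G. indicator (?A v) w :: real) = (\<Sum>v\<in>G. of_bool (?st v (weights w)))"
      using w by (intro sum.cong) (auto simp: indicator_def)
    also have "\<dots> = real (card {v \<in> G. ?st v (weights w)})"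
      unfolding of_bool_def sum.inter_filter[OF fin, symmetric] by simp
    also have "\<dots> \<le> real (card W)"
      using card_status_differs[OF assms, where J = "weights w"] by simp
    finally show "(\<Sum>v\<in>G. indicator (?A v) w :: real) \<le> real (card W)" .
  qed simp
  finally show ?thesis by (simp add: prob_space)
qed

text \<open>A vertex outside \<open>G\<close> lies in \<open>W\<close> or shares a site with a
  vertex of \<open>W\<close>. Every vertex of \<open>W\<close> has at most \<open>D\<close> sites
  and each covers at most two vertices; members of \<open>W\<close> are reached through their own
  monomers.\<close>

lemma card_touching_le:
  assumes "W \<subseteq> U" "\<And>v. v \<in> U \<Longrightarrow> card (sites_at v) \<le> D"
    "G = {v \<in> U - W. \<forall>x\<in>sites_at v. cov x \<subseteq> U - W}"
  shows "card (U - G) \<le> 2 * D * card W"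
proof -
  have sS: "x \<in> S" if "x \<in> sites_at a" for x a using that by (simp add: sites_at_def)
  have finW: "finite W" using assms(1) finite_U finite_subset by blast
  have "U - G \<subseteq> (\<Union>w\<in>W. \<Union>x\<in>sites_at w. cov x)"
  proof
    fix v assume v: "v \<in> U - G"
    show "v \<in> (\<Union>w\<in>W. \<Union>x\<in>sites_at w. cov x)"
    proof (cases "v \<in> W")
      case True
      then have "mon v \<in> sites_at v" "v \<in> cov (mon v)"
        using assms(1) mon_in[of v] cov_mon[of v] by (auto simp: sites_at_def)
      then show ?thesis using True by blast
    next
      case False
      then obtain x where x: "x \<in> sites_at v" "\<not> cov x \<subseteq> U - W" using v assms(3) by auto
      then obtain a where a: "a \<in> cov x" "a \<in> W" using cov_subset[OF sS[OF x(1)]] by auto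
      then have "x \<in> sites_at a" "v \<in> cov x" using x(1) by (auto simp: sites_at_def)
      then show ?thesis using a(2) by blast
    qed
  qed
  moreover have "finite (\<Union>w\<in>W. \<Union>x\<in>sites_at w. cov x)"
    using finW finite_sites_at finite_cov sS by blast
  ultimately have "card (U - G) \<le> card (\<Union>w\<in>W. \<Union>x\<in>sites_at w. cov x)" by (intro card_mono)
  also have "\<dots> \<le> (\<Sum>w\<in>W. card (\<Union>x\<in>sites_at w. cov x))" by (rule card_UN_le[OF finW])
  also have "\<dots> \<le> (\<Sum>w\<in>W. \<Sum>x\<in>sites_at w. card (cov x))"
    by (intro sum_mono card_UN_le finite_sites_at)
  also have "\<dots> \<le> (\<Sum>w\<in>W. \<Sum>x\<in>sites_at w. 2)" by (intro sum_mono card_cov_le sS)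
  also have "\<dots> \<le> (\<Sum>w\<in>W. D * 2)" using assms(1,2) by (intro sum_mono) auto
  finally show ?thesis by (simp add: mult.commute mult.left_commute)
qed

text \<open>Efron-Stein for the difference of the two energies, with sites grouped by vertex. Far
  from \<open>W\<close> the response is at most twice \<eta> unless the cavity fields show a gap,
  and the gap probabilities sum to a small multiple of \<open>card U\<close> plus a constant times
  \<open>card W\<close>. Vertices touching \<open>W\<close> get the trivial bound and are few. In
  the result the first term is made small by \<eta> and \<open>K\<close>, and only afterwards the
  second by the density of \<open>W\<close>.\<close>

lemma variance_diff_le:
  assumes W: "W \<subseteq> U" and U: "U \<noteq> {}"
    and \<Gamma>: "finite \<Gamma>" "\<And>h. \<bar>h\<bar> \<le> K \<Longrightarrow> \<exists>g\<in>\<Gamma>. h \<le> g \<and> g \<le> h + \<eta>/4"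
    and c: "0 < c" "c \<le> 1" "c \<le> measure \<mu> {s<..<s + \<eta>/4}"
      "\<And>g. g \<in> \<Gamma> \<Longrightarrow> c \<le> measure \<mu> {s + g + \<eta>/4<..<s + g + \<eta>/2}" "c \<le> measure \<mu> {T<..}"
    and T: "\<And>g. g \<in> \<Gamma> \<Longrightarrow> s + g + \<eta>/2 + K \<le> T" and pos: "0 < \<eta>" "0 < K"
    and D: "\<And>v. v \<in> U \<Longrightarrow> card (sites_at v) \<le> D"
  shows "variance (\<lambda>w. H U (weights w) - H (U - W) (weights w))
    \<le> real D * (real (card U) * (4 * \<eta>\<^sup>2 + 24 * (real D)\<^sup>2 * abs_mean * square_mean / K)
      + real (card W) * (8 * real D * real (card \<Gamma>) / c ^ D + 8 * real D) * square_mean)"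
proof -
  define f where "f J = H U J - H (U - W) J" for J
  define G where "G = {v \<in> U - W. \<forall>x\<in>sites_at v. cov x \<subseteq> U - W}"
  define R where "R x = (\<integral>w. (f (weights w) - f ((weights w)(x := 0)))\<^sup>2 \<partial>P)" for x
  \<comment> \<open>This event is determined by the weights away from \<open>v\<close>, hence
    independent of each weight at \<open>v\<close>. The second moment of that weight on the event
    therefore factorises.\<close>
  define gap where "gap v J \<longleftrightarrow> (\<exists>y\<in>sites_at v. \<eta> < \<bar>cavity v U y J - cavity v (U - W) y J\<bar>)" for v J
  define p where "p v = \<P>(w in P. gap v (weights w))" for v
  have sS: "x \<in> S" if "x \<in> sites_at a" for x a using that by (simp add: sites_at_def)
  have UW: "U - W \<subseteq> U" by auto
  have f_lip: "lipschitz_sum 2 S f" unfolding f_def by (rule H_diff_lipschitz_sum[OF order_refl UW])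
  have f_meas: "f \<in> borel_measurable (PiM S (\<lambda>_. borel))"
    unfolding f_def[abs_def] by (intro borel_measurable_diff H_meas order_refl UW)
  have r_le: "(f J - f (J(x := 0)))\<^sup>2 \<le> 4 * (J x)\<^sup>2" if "x \<in> S" for J x
  proof -
    have "\<bar>f J - f (J(x := 0))\<bar> \<le> 2 * \<bar>J x\<bar>"
      using lipschitz_sum_update[OF f_lip finite_S that, of J "J x" 0] by simp
    then have "(f J - f (J(x := 0)))\<^sup>2 \<le> (2 * \<bar>J x\<bar>)\<^sup>2"
      by (intro abs_le_square_iff[THEN iffD1] order_trans[OF _ abs_ge_self])
    then show ?thesis by (simp add: power_mult_distrib)
  qed
  have r_int: "integrable P (\<lambda>w. (f (weights w) - f ((weights w)(x := 0)))\<^sup>2)" if "x \<in> S" for x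
  proof (rule integrable_nonneg_bound)
    show "integrable P (\<lambda>w. 4 * (X x w)\<^sup>2)" using weight_square_integral(1)[OF that] by simp
    show "(\<lambda>w. (f (weights w) - f ((weights w)(x := 0)))\<^sup>2) \<in> borel_measurable P"
      unfolding f_def
      by (intro borel_measurable_power borel_measurable_diff H_weights_measurable
          H_update_weights_measurable order_refl UW that)
  qed (use r_le[OF that] in auto)
  have R_nonneg: "0 \<le> R x" for x unfolding R_def by simp
  have R_le: "R x \<le> 4 * square_mean" if "x \<in> S" for x
  proof -
    have "R x \<le> (\<integral>w. 4 * (X x w)\<^sup>2 \<partial>P)"
      unfolding R_def using weight_square_integral(1)[OF that]
      by (intro integral_mono r_int that r_le) simp
    then show ?thesis using weight_square_integral(2)[OF that] by simp
  qed
  have R_good: "R x \<le> 4 * \<eta>\<^sup>2 + 4 * square_mean * p v" if v: "v \<in> G" and x: "x \<in> sites_at v" for v x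
  proof -
    have vU: "v \<in> U" "v \<in> U - W" and sub: "\<And>x. x \<in> sites_at v \<Longrightarrow> cov x \<subseteq> U - W"
      using v by (auto simp: G_def)
    have sub': "\<And>x. x \<in> sites_at v \<Longrightarrow> cov x \<subseteq> U" using sub by blast
    have vin: "v \<in> cov y" if "y \<in> sites_at v" for y using that by (simp add: sites_at_def)
    have gap_meas: "Measurable.pred (PiM (S - sites_at v) (\<lambda>_. borel)) (gap v)"
      unfolding gap_def[abs_def]
      by (intro pred_intros_finite finite_sites_at borel_measurable_pred_less borel_measurable_const
          borel_measurable_abs borel_measurable_diff cavity_measurable vin UW order_refl)
    have gap_res: "gap v (restrict J (S - sites_at v)) = gap v J" for J
      using vin by (simp add: gap_def cavity_restrict cong: bex_cong)
    have gi_meas: "(\<lambda>J. of_bool (gap v J) :: real) \<in> borel_measurable (PiM (S - sites_at v) (\<lambda>_. borel))"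
      using gap_meas by measurable
    have sq_meas: "(\<lambda>J. (J x)\<^sup>2 :: real) \<in> borel_measurable (PiM (sites_at v) (\<lambda>_. borel))"
      using x by measurable
    have ind: "indep_var borel (\<lambda>w. (X x w)\<^sup>2) borel (\<lambda>w. of_bool (gap v (weights w)) :: real)"
      using indep_split[OF _ _ _ sq_meas gi_meas] x sS gap_res by auto
    have gap_ev: "{w \<in> space P. gap v (weights w)} \<in> events"
      using measurable_compose[OF restrict_measurable[of "S - sites_at v"] gap_meas]
      unfolding gap_res by (simp add: pred_def)
    have ob: "(\<lambda>w. of_bool (gap v (weights w)) :: real) \<in> borel_measurable P"
      using indep_var_rv2[OF ind] .
    have ob_int: "integrable P (\<lambda>w. of_bool (gap v (weights w)) :: real)"
      by (rule Bochner_Integration.integrable_bound[OF integrable_const[of "1::real"] ob]) simp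
    have "(\<integral>w. of_bool (gap v (weights w)) \<partial>P) = (\<integral>w. indicator {w \<in> space P. gap v (weights w)} w \<partial>P)"
      by (intro Bochner_Integration.integral_cong) (auto simp: indicator_def)
    also have "\<dots> = p v" using gap_ev by (simp add: p_def Int_absorb2 sets.sets_into_space)
    finally have ob_eq: "(\<integral>w. of_bool (gap v (weights w)) \<partial>P) = p v" .
    note sqi = weight_square_integral[OF sS[OF x]]
    \<comment> \<open>Without a gap \<open>local_response\<close> applies. With a gap only the
      Lipschitz bound by twice the modulus of \<open>J x\<close> remains.\<close>
    have "(f J - f (J(x := 0)))\<^sup>2 \<le> 4 * \<eta>\<^sup>2 + 4 * ((J x)\<^sup>2 * of_bool (gap v J))" for J
    proof (cases "gap v J")
      case True
      then show ?thesis using r_le[OF sS[OF x], of J] zero_le_power2[of \<eta>]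
        by (simp only: of_bool_def if_True)
    next
      case False
      have "\<bar>f J - f (J(x := 0))\<bar> \<le> 2 * \<eta>"
        unfolding f_def
        by (rule local_response[OF order_refl UW vU sub' sub _ x])
          (use False in \<open>auto simp: gap_def not_less\<close>)
      then have "(f J - f (J(x := 0)))\<^sup>2 \<le> (2 * \<eta>)\<^sup>2"
        by (intro abs_le_square_iff[THEN iffD1] order_trans[OF _ abs_ge_self])
      then show ?thesis using False by (simp add: power_mult_distrib)
    qed
    then have "R x \<le> (\<integral>w. 4 * \<eta>\<^sup>2 + 4 * ((X x w)\<^sup>2 * of_bool (gap v (weights w))) \<partial>P)"
      unfolding R_def
      using indep_var_integrable[OF ind sqi(1) ob_int]
      by (intro integral_mono r_int sS[OF x]) (simp, blast)
    also have "\<dots> = 4 * \<eta>\<^sup>2 + 4 * (square_mean * p v)"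
      using indep_var_integrable[OF ind sqi(1) ob_int] indep_var_lebesgue_integral[OF ind sqi(1) ob_int]
        sqi(2) ob_eq by (simp add: prob_space)
    finally show ?thesis by simp
  qed
  have p_le: "p v \<le> 6 * (real D)\<^sup>2 * abs_mean / K + 2 * real D * real (card \<Gamma>) / c ^ D *
      \<P>(w in P. status_differs U (U - W) v (weights w) \<or> status_differs (U - W) U v (weights w))"
    (is "_ \<le> ?a + ?b * ?st v") if v: "v \<in> G" for v
  proof -
    have *: "v \<in> U" "v \<in> U - W" "\<And>x. x \<in> sites_at v \<Longrightarrow> cov x \<subseteq> U - W"
      using v by (auto simp: G_def)
    then have "\<And>x. x \<in> sites_at v \<Longrightarrow> cov x \<subseteq> U" by blast
    then show ?thesis
      unfolding p_def gap_def
      by (intro cavity_differs_prob_le[OF order_refl UW *(1,2) _ *(3) \<Gamma> c T pos D]) auto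
  qed
  have finG: "finite G" using finite_U by (simp add: G_def)
  have GU: "G \<subseteq> U" by (auto simp: G_def)
  have b_nonneg: "0 \<le> ?b" using c(1) by simp
  have "(\<Sum>v\<in>G. p v) \<le> (\<Sum>v\<in>G. ?a + ?b * ?st v)" by (intro sum_mono p_le)
  also have "\<dots> = real (card G) * ?a + ?b * (\<Sum>v\<in>G. ?st v)"
    by (simp add: sum.distrib sum_distrib_left)
  also have "\<dots> \<le> real (card U) * ?a + ?b * real (card W)"
  proof (intro add_mono mult_right_mono mult_left_mono b_nonneg)
    show "(\<Sum>v\<in>G. ?st v) \<le> real (card W)"
      by (rule status_differs_sum_le[OF W]) (auto simp: G_def)
    show "real (card G) \<le> real (card U)" using card_mono[OF finite_U GU] by simp
    show "0 \<le> ?a" using abs_mean_nonneg pos by simp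
  qed
  finally have p_sum: "(\<Sum>v\<in>G. p v) \<le> real (card U) * ?a + ?b * real (card W)" .
  have p_nonneg: "0 \<le> p v" for v by (simp add: p_def)
  have "variance (\<lambda>w. f (weights w)) \<le> (\<Sum>x\<in>S. R x)"
    unfolding R_def by (rule efron_stein[OF finite_S order_refl S_nonempty[OF U] f_meas f_lip])
  \<comment> \<open>Every site is charged to each vertex it covers, of which there is at least one.
    This allows the splitting into vertices of \<open>G\<close> and the others.\<close>
  also have "\<dots> \<le> (\<Sum>x\<in>S. \<Sum>v\<in>{v \<in> U. v \<in> cov x}. R x)"
  proof (rule sum_mono)
    fix x assume x: "x \<in> S"
    have "{v \<in> U. v \<in> cov x} = cov x" using cov_subset[OF x] by auto
    moreover have "1 \<le> card (cov x)" using cov_nonempty[OF x] finite_cov[OF x] by (simp add: Suc_leI card_gt_0_iff)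
    ultimately show "R x \<le> (\<Sum>v\<in>{v \<in> U. v \<in> cov x}. R x)"
      using R_nonneg[of x] by (simp add: mult_le_cancel_right1)
  qed
  also have "\<dots> = (\<Sum>v\<in>U. \<Sum>x\<in>sites_at v. R x)"
    unfolding sites_at_def by (rule sum.swap_restrict[OF finite_S finite_U])
  also have "\<dots> = (\<Sum>v\<in>G. \<Sum>x\<in>sites_at v. R x) + (\<Sum>v\<in>U - G. \<Sum>x\<in>sites_at v. R x)"
    by (rule sum.subset_diff[OF GU finite_U, THEN trans]) simp
  also have "(\<Sum>v\<in>G. \<Sum>x\<in>sites_at v. R x) \<le> (\<Sum>v\<in>G. real D * (4 * \<eta>\<^sup>2 + 4 * square_mean * p v))"
  proof (rule sum_mono)
    fix v assume v: "v \<in> G"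
    have "(\<Sum>x\<in>sites_at v. R x) \<le> (\<Sum>x\<in>sites_at v. 4 * \<eta>\<^sup>2 + 4 * square_mean * p v)"
      by (intro sum_mono R_good v)
    also have "\<dots> \<le> real D * (4 * \<eta>\<^sup>2 + 4 * square_mean * p v)"
      using D[of v] v GU square_mean_nonneg p_nonneg[of v] by (auto intro!: mult_right_mono)
    finally show "(\<Sum>x\<in>sites_at v. R x) \<le> real D * (4 * \<eta>\<^sup>2 + 4 * square_mean * p v)" .
  qed
  also have "\<dots> = real D * (real (card G) * (4 * \<eta>\<^sup>2) + 4 * square_mean * (\<Sum>v\<in>G. p v))"
    by (simp add: sum_distrib_left[symmetric] sum.distrib)
  also have "\<dots> \<le> real D * (real (card U) * (4 * \<eta>\<^sup>2)
      + 4 * square_mean * (real (card U) * ?a + ?b * real (card W)))"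
    using card_mono[OF finite_U GU] p_sum square_mean_nonneg
    by (intro mult_left_mono add_mono mult_right_mono) auto
  also have "(\<Sum>v\<in>U - G. \<Sum>x\<in>sites_at v. R x) \<le> (\<Sum>v\<in>U - G. real D * (4 * square_mean))"
  proof (rule sum_mono)
    fix v assume v: "v \<in> U - G"
    have "(\<Sum>x\<in>sites_at v. R x) \<le> (\<Sum>x\<in>sites_at v. 4 * square_mean)"
      by (intro sum_mono R_le sS)
    also have "\<dots> \<le> real D * (4 * square_mean)"
      using D[of v] v square_mean_nonneg by (auto intro!: mult_right_mono)
    finally show "(\<Sum>x\<in>sites_at v. R x) \<le> real D * (4 * square_mean)" .
  qed
  also have "\<dots> = real (card (U - G)) * (real D * (4 * square_mean))" by simp
  also have "\<dots> \<le> real (2 * D * card W) * (real D * (4 * square_mean))"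
    using card_touching_le[OF W D G_def] square_mean_nonneg
    by (intro mult_right_mono) (auto simp del: of_nat_mult)
  finally have "variance (\<lambda>w. f (weights w)) \<le> real D * (real (card U) * (4 * \<eta>\<^sup>2)
      + 4 * square_mean * (real (card U) * ?a + ?b * real (card W)))
      + real (2 * D * card W) * (real D * (4 * square_mean))" by simp
  also have "\<dots> = real D * (real (card U) * (4 * \<eta>\<^sup>2 + 24 * (real D)\<^sup>2 * abs_mean * square_mean / K)
      + real (card W) * (8 * real D * real (card \<Gamma>) / c ^ D + 8 * real D) * square_mean)"
    by (simp add: algebra_simps)
  finally show ?thesis unfolding f_def .
qed

section \<open>Lower bound for the variance\<close>

text \<open>On this event, lowering the monomer weight at \<open>v\<close> to \<open>t\<close> decreases the energy by at least \<open>1\<close>.\<close>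
definition monomer_event :: "real \<Rightarrow> real \<Rightarrow> 'v \<Rightarrow> 's \<Rightarrow> real set" where
  "monomer_event t s v x = (if x = mon v then {t + 1<..}
     else if x \<in> sites_at v then {t + 1 + s<..} else {..<s})"

definition monomer_sites :: "'v \<Rightarrow> 's set" where
  "monomer_sites v = sites_at v \<union> mon ` (\<Union>x\<in>sites_at v. cov x)"

lemma sites_at_S: "x \<in> sites_at v \<Longrightarrow> x \<in> S"
  by (simp add: sites_at_def)

lemma monomer_sites_subset: "monomer_sites v \<subseteq> S"
  using cov_subset mon_in sites_at_S unfolding monomer_sites_def by blast

lemma card_monomer_sites:
  assumes "card (sites_at v) \<le> D" shows "card (monomer_sites v) \<le> 3 * D"
proof -
  have fin: "finite (\<Union>x\<in>sites_at v. cov x)" using finite_sites_at finite_cov sites_at_S by blast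
  have "card (\<Union>x\<in>sites_at v. cov x) \<le> (\<Sum>x\<in>sites_at v. card (cov x))"
    by (rule card_UN_le[OF finite_sites_at])
  also have "\<dots> \<le> (\<Sum>x\<in>sites_at v. 2)" by (intro sum_mono card_cov_le sites_at_S)
  also have "\<dots> \<le> 2 * D" using assms by simp
  finally have "card (mon ` (\<Union>x\<in>sites_at v. cov x)) \<le> 2 * D"
    using card_image_le[OF fin, of mon] by linarith
  then show ?thesis unfolding monomer_sites_def
    using card_Un_le[of "sites_at v" "mon ` (\<Union>x\<in>sites_at v. cov x)"] assms by linarith
qed

lemma mon_in_sites_at:
  assumes "v \<in> U" shows "mon a \<in> sites_at v \<Longrightarrow> a \<in> U \<Longrightarrow> a = v"
  using cov_mon by (auto simp: sites_at_def)

text \<open>The neighbouring monomer weights stay below \<open>s\<close>, so by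
  \<open>cavity_ge\<close> the cavity fields at \<open>v\<close> are at least \<open>-s\<close> and
  every way of covering \<open>v\<close> costs at least \<open>t + 1\<close>. After the change,
  covering \<open>v\<close> costs at most \<open>t\<close>, and the energy without \<open>v\<close>
  is untouched.\<close>

lemma H_drop_monomer_event:
  assumes v: "v \<in> U" and J: "\<And>x. x \<in> monomer_sites v \<Longrightarrow> J x \<in> monomer_event t s v x" and "0 \<le> s"
  shows "1 \<le> H U J - H U (J(mon v := t))"
proof -
  have mv: "mon v \<in> sites_at v" using mon_in[OF v] cov_mon[OF v] by (simp add: sites_at_def)
  have Jm: "t + 1 < J (mon v)" using J[of "mon v"] mv by (simp add: monomer_sites_def monomer_event_def)
  obtain x where x: "x \<in> S" "v \<in> cov x" "cov x \<subseteq> U" "H U J - H (U - {v}) J = J x + cavity v U x J"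
    using H_local_attained[OF order_refl v] by blast
  have xv: "x \<in> sites_at v" using x by (simp add: sites_at_def)
  have "t + 1 \<le> J x + cavity v U x J"
  proof (cases "x = mon v")
    case True
    then show ?thesis using Jm cavity_mon[OF v] by simp
  next
    case False
    then have Jx: "t + 1 + s < J x" using J[of x] xv by (simp add: monomer_sites_def monomer_event_def)
    show ?thesis
    proof (cases "cov x = {v}")
      case True
      then have "cavity v U x J = 0" by (simp add: cavity_def)
      then show ?thesis using Jx assms(3) by simp
    next
      case cov: False
      have "- s \<le> cavity v U x J"
      proof (rule cavity_ge[OF order_refl xv x(3) _ cov])
        fix a assume a: "a \<in> cov x - {v}"
        then have aU: "a \<in> U" using x(3) by auto
        have "mon a \<notin> sites_at v" using mon_in_sites_at[OF v _ aU] a by auto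
        moreover have "mon a \<in> monomer_sites v" using a xv by (auto simp: monomer_sites_def)
        moreover have "mon a \<noteq> mon v" using calculation(1) mv by auto
        ultimately have "J (mon a) < s" using J[of "mon a"] by (simp add: monomer_event_def)
        then show "J (mon a) \<le> s" by simp
      qed
      then show ?thesis using Jx by linarith
    qed
  qed
  moreover have "H U (J(mon v := t)) - H (U - {v}) (J(mon v := t)) \<le> t"
    using H_local_le[OF order_refl mon_in[OF v], of "J(mon v := t)" v] cov_mon[OF v] v cavity_mon[OF v]
    by simp
  moreover have "H (U - {v}) (J(mon v := t)) = H (U - {v}) J"
    using cov_mon[OF v] by (intro H_minus_vertex_cong) auto
  ultimately show ?thesis using x(4) by linarith
qed

text \<open>The energy is tested against \<open>L\<close>, a sum of centered bounded functions of
  the monomer weights. These are independent, so \<open>L\<close> has second moment at most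
  \<open>card U\<close>, while each summand has covariance at least \<open>a\<close> with the
  energy. In \<open>a\<close>, one factor \<open>c\<close> bounds \<open>1 - q\<close> and the power
  bounds the probability of the monomer event, which constrains at most \<open>3 * D\<close>
  weights.\<close>

lemma variance_ge:
  assumes U: "U \<noteq> {}" and D: "\<And>v. v \<in> U \<Longrightarrow> card (sites_at v) \<le> D" and s: "0 \<le> s"
    and c: "0 < c" "c \<le> 1" "c \<le> measure \<mu> {..t}" "c \<le> measure \<mu> {t + 1<..}" "c \<le> measure \<mu> {t + 1 + s<..}"
      "c \<le> measure \<mu> {..<s}"
  shows "(c * c ^ (3 * D))\<^sup>2 * real (card U) \<le> variance (\<lambda>w. H U (weights w))"
proof -
  define a where "a = c * c ^ (3 * D)"
  define q where "q = measure \<mu> {t<..}"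
  \<comment> \<open>Centered because \<open>q\<close> is the mass above \<open>t\<close>. The change
    of sign at \<open>t\<close> matches the monotonicity of the energy in a monomer weight.\<close>
  define \<phi> where "\<phi> r = of_bool (t < r) - q" for r :: real
  have borel_sets: "A \<in> sets borel \<Longrightarrow> A \<in> sets \<mu>" for A using dist.sets_\<mu> by simp
  have q01: "0 \<le> q" "q \<le> 1" by (simp_all add: q_def)
  have "measure \<mu> {t<..} = 1 - measure \<mu> {..t}"
    using dist.prob_compl[OF borel_sets, of "{..t}"] sets_eq_imp_space_eq[OF dist.sets_\<mu>]
    by (simp add: Compl_eq_Diff_UNIV[symmetric] Compl_atMost)
  then have q_c: "c \<le> 1 - q" using c(3) by (simp add: q_def)
  have \<phi>_meas: "\<phi> \<in> borel_measurable borel" unfolding \<phi>_def[abs_def] by measurable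
  have \<phi>_le: "\<bar>\<phi> r\<bar> \<le> 1" for r using q01 by (auto simp: \<phi>_def abs_le_iff)
  have \<phi>_mean: "(\<integral>r. \<phi> r \<partial>\<mu>) = 0"
  proof -
    have "(\<integral>r. of_bool (t < r) \<partial>\<mu>) = (\<integral>r. indicator {t<..} r \<partial>\<mu>)"
      by (intro Bochner_Integration.integral_cong) (auto simp: indicator_def)
    also have "\<dots> = q" using sets_eq_imp_space_eq[OF dist.sets_\<mu>] by (simp add: q_def)
    finally have *: "(\<integral>r. of_bool (t < r) \<partial>\<mu>) = q" .
    have "integrable \<mu> (\<lambda>r. of_bool (t < r) :: real)"
      by (rule dist.integrable_const_bound[where B = 1])
        (auto simp: measurable_cong_sets[OF dist.sets_\<mu> refl])
    then show ?thesis unfolding \<phi>_def using * by (simp add: dist.prob_space)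
  qed
  have monS: "mon v \<in> S" if "v \<in> U" for v using mon_in[OF that] .
  have X\<phi>: "(\<lambda>w. \<phi> (X (mon v) w)) \<in> borel_measurable P" if "v \<in> U" for v
    using measurable_compose[OF X_measurable[OF monS[OF that]] \<phi>_meas] .
  have \<phi>_int: "integrable P (\<lambda>w. \<phi> (X (mon v) w))" if "v \<in> U" for v
    using X\<phi>[OF that] \<phi>_le by (intro integrable_const_bound[where B = 1]) auto
  have \<phi>_exp: "(\<integral>w. \<phi> (X (mon v) w) \<partial>P) = 0" if "v \<in> U" for v
    using expectation_weight(1)[OF monS[OF that] \<phi>_meas] \<phi>_mean by simp
  note Hint = H_weights_integrable[OF order_refl U]
  have H\<phi>_int: "integrable P (\<lambda>w. F w * \<phi> (X (mon v) w))" if "v \<in> U" "integrable P F" for v and F :: "_ \<Rightarrow> real"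
  proof (rule Bochner_Integration.integrable_bound[OF that(2)])
    show "(\<lambda>w. F w * \<phi> (X (mon v) w)) \<in> borel_measurable P"
      using X\<phi>[OF that(1)] that(2) by measurable
    have "\<bar>F w * \<phi> (X (mon v) w)\<bar> \<le> \<bar>F w\<bar>" for w
      using mult_left_mono[OF \<phi>_le, of "\<bar>F w\<bar>" "X (mon v) w"] by (simp add: abs_mult)
    then show "AE w in P. norm (F w * \<phi> (X (mon v) w)) \<le> norm (F w)" by simp
  qed
  have cov_ge: "a \<le> (\<integral>w. H U (weights w) * \<phi> (X (mon v) w) \<partial>P)" if v: "v \<in> U" for v
  proof -
    \<comment> \<open>With the monomer weight at \<open>v\<close> frozen at \<open>t\<close>, the
      energy is independent of the centered factor. It can be subtracted without changing the
      covariance.\<close>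
    let ?H0 = "\<lambda>J. H U (J(mon v := t))"
    have H0_res: "?H0 (restrict J (S - {mon v})) = ?H0 J" for J by (rule H_cong) auto
    have H0_meas: "?H0 \<in> borel_measurable (PiM (S - {mon v}) (\<lambda>_. borel))"
    proof -
      have "(\<lambda>J. \<lambda>x\<in>S. if x = mon v then t else J x) \<in> PiM (S - {mon v}) (\<lambda>_. borel) \<rightarrow>\<^sub>M PiM S (\<lambda>_. borel)"
      proof (rule measurable_restrict)
        show "(\<lambda>J. if x = mon v then t else J x) \<in> borel_measurable (PiM (S - {mon v}) (\<lambda>_. borel))"
          if "x \<in> S" for x
          using that by (cases "x = mon v") auto
      qed
      from measurable_compose[OF this H_meas[OF order_refl]]
      have "(\<lambda>J. H U (\<lambda>x\<in>S. if x = mon v then t else J x)) \<in> borel_measurable (PiM (S - {mon v}) (\<lambda>_. borel))" .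
      moreover have "H U (\<lambda>x\<in>S. if x = mon v then t else J x) = ?H0 J" for J by (rule H_cong) auto
      ultimately show ?thesis by simp
    qed
    have \<phi>_pm: "(\<lambda>J. \<phi> (J (mon v))) \<in> borel_measurable (PiM {mon v} (\<lambda>_. borel))"
      by (rule measurable_compose[where f = "\<lambda>J. J (mon v)", OF _ \<phi>_meas]) simp
    have ind: "indep_var borel (\<lambda>w. ?H0 (weights w)) borel (\<lambda>w. \<phi> (X (mon v) w))"
      using indep_split[OF _ _ _ H0_meas \<phi>_pm H0_res] monS[OF v] by auto
    have H0_int: "integrable P (\<lambda>w. ?H0 (weights w))"
    proof (rule Bochner_Integration.integrable_bound)
      show "integrable P (\<lambda>w. \<bar>H U (weights w)\<bar> + (\<bar>X (mon v) w\<bar> + \<bar>t\<bar>))"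
        by (intro Bochner_Integration.integrable_add integrable_abs[OF Hint(2)]
            weight_abs_integral(1)[OF monS[OF v]] integrable_const)
      have "\<bar>?H0 J\<bar> \<le> \<bar>H U J\<bar> + (\<bar>J (mon v)\<bar> + \<bar>t\<bar>)" for J
        using H_update[OF order_refl monS[OF v], of J t] by linarith
      then show "AE w in P. norm (?H0 (weights w)) \<le> norm (\<bar>H U (weights w)\<bar> + (\<bar>X (mon v) w\<bar> + \<bar>t\<bar>))"
        by (intro AE_I2) (simp only: real_norm_def, rule order_trans[OF _ abs_ge_self])
    qed (rule H_update_weights_measurable[OF order_refl monS[OF v]])
    have zero: "(\<integral>w. ?H0 (weights w) * \<phi> (X (mon v) w) \<partial>P) = 0"
      using indep_var_lebesgue_integral[OF ind H0_int \<phi>_int[OF v]] \<phi>_exp[OF v] by simp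
    let ?E = "{w \<in> space P. \<forall>x\<in>monomer_sites v. X x w \<in> monomer_event t s v x}"
    have fin: "finite (monomer_sites v)" using monomer_sites_subset finite_S finite_subset by blast
    have E_sets: "monomer_event t s v x \<in> sets borel" for x by (simp add: monomer_event_def)
    have E_ev: "?E \<in> events"
    proof (rule predE, intro pred_intros_finite fin pred_sets2[OF E_sets])
      show "x \<in> monomer_sites v \<Longrightarrow> X x \<in> borel_measurable P" for x
        using X_measurable monomer_sites_subset by blast
    qed
    have E_prob: "c ^ (3 * D) \<le> prob ?E"
      using c by (intro prob_rectangle_ge fin monomer_sites_subset E_sets card_monomer_sites D v)
        (auto simp: monomer_event_def)
    \<comment> \<open>The energy difference and the centered factor never have opposite signs, so
      their product is nonnegative. On \<open>?E\<close> the difference is at least one and the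
      factor equals \<open>1 - q\<close>.\<close>
    have pt: "(1 - q) * indicator ?E w \<le> (H U (weights w) - ?H0 (weights w)) * \<phi> (X (mon v) w)"
      if w: "w \<in> space P" for w
    proof (cases "t < X (mon v) w")
      case True
      then have ph: "\<phi> (X (mon v) w) = 1 - q" by (simp add: \<phi>_def)
      have ge0: "?H0 (weights w) \<le> H U (weights w)" using True by (intro H_mono order_refl) auto
      show ?thesis
      proof (cases "w \<in> ?E")
        case True
        then have "1 \<le> H U (weights w) - ?H0 (weights w)"
          by (intro H_drop_monomer_event[OF v _ s]) auto
        then have "(1 - q) * 1 \<le> (1 - q) * (H U (weights w) - ?H0 (weights w))"
          using q01 by (intro mult_left_mono) auto
        then show ?thesis using True ph by (simp add: mult.commute)
      next
        case False
        then show ?thesis using ge0 ph q01 by simp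
      qed
    next
      case False
      then have ph: "\<phi> (X (mon v) w) = - q" by (simp add: \<phi>_def)
      have "H U (weights w) \<le> ?H0 (weights w)" using False by (intro H_mono order_refl) auto
      moreover have "w \<notin> ?E"
      proof
        assume "w \<in> ?E"
        moreover have "mon v \<in> monomer_sites v"
          using monS[OF v] cov_mon[OF v] by (simp add: monomer_sites_def sites_at_def)
        ultimately have "X (mon v) w \<in> monomer_event t s v (mon v)" by blast
        then show False using False by (simp add: monomer_event_def)
      qed
      ultimately show ?thesis using ph q01 by (simp add: mult_nonneg_nonpos2 mult_nonpos_nonpos)
    qed
    have "a \<le> (1 - q) * prob ?E" unfolding a_def
      using q_c E_prob c q01 by (intro mult_mono) auto
    also have "\<dots> = (\<integral>w. (1 - q) * indicator ?E w \<partial>P)"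
      using E_ev by (simp add: Int_absorb2 sets.sets_into_space)
    also have "\<dots> \<le> (\<integral>w. (H U (weights w) - ?H0 (weights w)) * \<phi> (X (mon v) w) \<partial>P)"
    proof (rule integral_mono[OF _ _ pt])
      show "integrable P (\<lambda>w. (1 - q) * indicator ?E w)"
        using E_ev by (intro integrable_mult_right integrable_real_indicator) (auto simp: emeasure_eq_measure)
      show "integrable P (\<lambda>w. (H U (weights w) - ?H0 (weights w)) * \<phi> (X (mon v) w))"
        by (rule H\<phi>_int[OF v Bochner_Integration.integrable_diff[OF Hint(2) H0_int]])
    qed
    also have "\<dots> = (\<integral>w. H U (weights w) * \<phi> (X (mon v) w) \<partial>P)"
      using H\<phi>_int[OF v Hint(2)] H\<phi>_int[OF v H0_int] zero
      by (simp add: left_diff_distrib Bochner_Integration.integral_diff)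
    finally show ?thesis .
  qed
  define L where "L w = (\<Sum>v\<in>U. \<phi> (X (mon v) w))" for w
  have "inj_on mon U" using cov_mon by (intro inj_onI) (metis singleton_inject)
  then interpret mon: iid_weights P \<mu> "\<lambda>v. X (mon v)" U using monS by (intro iid_reindex) auto
  have ind: "indep_vars (\<lambda>_. borel) (\<lambda>v w. \<phi> (X (mon v) w)) U"
    by (rule indep_vars_compose2[OF mon.indep_X \<phi>_meas])
  have \<phi>2_int: "integrable P (\<lambda>w. (\<phi> (X (mon v) w))\<^sup>2)" if "v \<in> U" for v
    using H\<phi>_int[OF that \<phi>_int[OF that]] by (simp add: power2_eq_square)
  note L2 = second_moment_indep_sum[OF finite_U ind \<phi>2_int \<phi>_exp]
  have L2_int: "integrable P (\<lambda>w. (L w)\<^sup>2)" unfolding L_def by (rule L2(1))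
  have "(\<integral>w. (\<phi> (X (mon v) w))\<^sup>2 \<partial>P) \<le> (\<integral>w. 1 \<partial>P)" if "v \<in> U" for v
    using \<phi>_le by (intro integral_mono \<phi>2_int that) (auto simp: abs_square_le_1)
  then have "(\<Sum>v\<in>U. \<integral>w. (\<phi> (X (mon v) w))\<^sup>2 \<partial>P) \<le> (\<Sum>v\<in>U. 1)"
    by (intro sum_mono) (simp add: prob_space)
  then have L2_le: "(\<integral>w. (L w)\<^sup>2 \<partial>P) \<le> real (card U)" unfolding L_def using L2(2) by simp
  have L_int: "integrable P L" unfolding L_def[abs_def] by (intro Bochner_Integration.integrable_sum \<phi>_int)
  have L_exp: "(\<integral>w. L w \<partial>P) = 0"
    unfolding L_def using \<phi>_int \<phi>_exp by (subst Bochner_Integration.integral_sum) auto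
  have HL_int: "integrable P (\<lambda>w. H U (weights w) * L w)"
    unfolding L_def sum_distrib_left by (intro Bochner_Integration.integrable_sum H\<phi>_int Hint(2))
  have HL_ge: "real (card U) * a \<le> (\<integral>w. H U (weights w) * L w \<partial>P)"
  proof -
    have "real (card U) * a = (\<Sum>v\<in>U. a)" by simp
    also have "\<dots> \<le> (\<Sum>v\<in>U. \<integral>w. H U (weights w) * \<phi> (X (mon v) w) \<partial>P)" by (intro sum_mono cov_ge)
    also have "\<dots> = (\<integral>w. H U (weights w) * L w \<partial>P)"
      unfolding L_def sum_distrib_left
      by (intro Bochner_Integration.integral_sum[symmetric] H\<phi>_int Hint(2))
    finally show ?thesis .
  qed
  define m where "m = (\<integral>w. H U (weights w) \<partial>P)"
  have var_int: "integrable P (\<lambda>w. (H U (weights w) - m)\<^sup>2)"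
    by (rule square_expectation_decomp(1)[OF Hint(2,1)])
  have hL_int: "integrable P (\<lambda>w. (H U (weights w) - m) * L w)"
    unfolding left_diff_distrib using HL_int L_int by simp
  have hL: "(\<integral>w. (H U (weights w) - m) * L w \<partial>P) = (\<integral>w. H U (weights w) * L w \<partial>P)"
    unfolding left_diff_distrib using HL_int L_int L_exp by (simp add: Bochner_Integration.integral_diff)
  \<comment> \<open>Expanding the square gives a variance of at least
    \<open>2 * a * (real (card U) * a) - a\<^sup>2 * real (card U)\<close>. The coefficient
    \<open>a\<close> of \<open>L\<close> is the best one for the bounds at hand.\<close>
  have "0 \<le> (\<integral>w. (H U (weights w) - m - a * L w)\<^sup>2 \<partial>P)" by simp
  also have "\<dots> = (\<integral>w. (H U (weights w) - m)\<^sup>2 - 2 * a * ((H U (weights w) - m) * L w) + a\<^sup>2 * (L w)\<^sup>2 \<partial>P)"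
    by (intro Bochner_Integration.integral_cong refl) (simp add: power2_eq_square algebra_simps)
  also have "\<dots> = (\<integral>w. (H U (weights w) - m)\<^sup>2 \<partial>P) - 2 * a * (\<integral>w. (H U (weights w) - m) * L w \<partial>P)
      + a\<^sup>2 * (\<integral>w. (L w)\<^sup>2 \<partial>P)"
    using var_int hL_int L2_int by simp
  also have "\<dots> \<le> (\<integral>w. (H U (weights w) - m)\<^sup>2 \<partial>P) - 2 * a * (real (card U) * a) + a\<^sup>2 * real (card U)"
    unfolding hL using HL_ge L2_le c by (intro add_mono diff_mono mult_left_mono) (auto simp: a_def)
  finally show ?thesis unfolding m_def a_def[symmetric] by (simp add: power2_eq_square algebra_simps)
qed

end

section \<open>Normal approximation\<close>

lemma cmod_iexp_diff: "cmod (iexp x - iexp y) \<le> \<bar>x - y\<bar>"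
proof -
  have "iexp x - iexp y = iexp y * (iexp (x - y) - 1)"
    by (simp add: algebra_simps flip: exp_add)
  then have "cmod (iexp x - iexp y) = cmod (iexp (x - y) - 1)" by (simp add: norm_mult)
  also have "\<dots> \<le> \<bar>x - y\<bar>" using iexp_approx1[of "x - y" 0] by simp
  finally show ?thesis .
qed

text \<open>The exponential is Lipschitz with constant the modulus of \<open>t\<close>, and the
  first absolute moment of the difference is at most its norm in L2.\<close>

lemma (in prob_space) char_diff_le:
  fixes Y Z :: "'a \<Rightarrow> real"
  assumes [measurable]: "Y \<in> borel_measurable M" "Z \<in> borel_measurable M"
    and int: "integrable M (\<lambda>x. (Y x - Z x)\<^sup>2)"
  shows "cmod (char (distr M borel Y) t - char (distr M borel Z) t)
    \<le> \<bar>t\<bar> * sqrt (expectation (\<lambda>x. (Y x - Z x)\<^sup>2))"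
proof -
  have int1: "integrable M (\<lambda>x. iexp (t * F x))" if [measurable]: "F \<in> borel_measurable M" for F :: "'a \<Rightarrow> real"
    by (rule integrable_const_bound[where B = 1]) auto
  have char_eq: "char (distr M borel F) t = expectation (\<lambda>x. iexp (t * F x))"
    if "F \<in> borel_measurable M" for F :: "'a \<Rightarrow> real"
    unfolding char_def by (rule integral_distr[OF that]) measurable
  have d_int: "integrable M (\<lambda>x. Y x - Z x)"
    by (rule square_integrable_imp_integrable[OF _ int]) measurable
  have "char (distr M borel Y) t - char (distr M borel Z) t
      = expectation (\<lambda>x. iexp (t * Y x) - iexp (t * Z x))"
    using char_eq[OF assms(1)] char_eq[OF assms(2)]
    by (simp only: Bochner_Integration.integral_diff[OF int1[OF assms(1)] int1[OF assms(2)]])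
  also have "cmod \<dots> \<le> expectation (\<lambda>x. cmod (iexp (t * Y x) - iexp (t * Z x)))"
    by (rule integral_norm_bound)
  also have "\<dots> \<le> expectation (\<lambda>x. \<bar>t\<bar> * \<bar>Y x - Z x\<bar>)"
  proof (rule integral_mono)
    show "integrable M (\<lambda>x. cmod (iexp (t * Y x) - iexp (t * Z x)))"
      by (intro integrable_norm Bochner_Integration.integrable_diff int1) measurable
    show "integrable M (\<lambda>x. \<bar>t\<bar> * \<bar>Y x - Z x\<bar>)" using d_int by simp
    show "cmod (iexp (t * Y x) - iexp (t * Z x)) \<le> \<bar>t\<bar> * \<bar>Y x - Z x\<bar>" for x
      using cmod_iexp_diff[of "t * Y x" "t * Z x"] by (simp add: abs_mult flip: right_diff_distrib)
  qed
  also have "\<dots> = \<bar>t\<bar> * expectation (\<lambda>x. \<bar>Y x - Z x\<bar>)" by simp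
  also have "\<dots> \<le> \<bar>t\<bar> * sqrt (expectation (\<lambda>x. (Y x - Z x)\<^sup>2))"
  proof (intro mult_left_mono real_le_rsqrt)
    have "(expectation (\<lambda>x. \<bar>Y x - Z x\<bar>))\<^sup>2 \<le> expectation (\<lambda>x. \<bar>Y x - Z x\<bar>\<^sup>2)"
      using variance_positive[of "\<lambda>x. \<bar>Y x - Z x\<bar>"] d_int int
      by (subst (asm) variance_eq) auto
    then show "(expectation (\<lambda>x. \<bar>Y x - Z x\<bar>))\<^sup>2 \<le> expectation (\<lambda>x. (Y x - Z x)\<^sup>2)" by simp
  qed simp
  finally show ?thesis .
qed

text \<open>A small error relative to the second moment survives when each variable is divided by
  its own norm. The bound \<kappa> \<le> 1/4 forces the norm of \<open>T\<close> to be at least half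
  that of \<open>S\<close>, so the second normalization is legitimate.\<close>

lemma (in prob_space) normalized_distance_le:
  fixes S T :: "'a \<Rightarrow> real"
  assumes [measurable]: "S \<in> borel_measurable M" "T \<in> borel_measurable M"
    and int: "integrable M (\<lambda>x. (S x)\<^sup>2)" "integrable M (\<lambda>x. (T x)\<^sup>2)"
    and pos: "0 < expectation (\<lambda>x. (S x)\<^sup>2)" and \<kappa>: "0 < \<kappa>" "\<kappa> \<le> 1/4"
    and close: "expectation (\<lambda>x. (S x - T x)\<^sup>2) \<le> \<kappa> * expectation (\<lambda>x. (S x)\<^sup>2)"
  shows "integrable M (\<lambda>x. (S x / sqrt (expectation (\<lambda>x. (S x)\<^sup>2)) - T x / sqrt (expectation (\<lambda>x. (T x)\<^sup>2)))\<^sup>2)"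
    "expectation (\<lambda>x. (S x / sqrt (expectation (\<lambda>x. (S x)\<^sup>2)) - T x / sqrt (expectation (\<lambda>x. (T x)\<^sup>2)))\<^sup>2)
      \<le> 2 * \<kappa>"
    "0 < expectation (\<lambda>x. (T x)\<^sup>2)"
proof -
  define a b q e where "a = sqrt (expectation (\<lambda>x. (S x)\<^sup>2))" and "b = sqrt (expectation (\<lambda>x. (T x)\<^sup>2))"
    and "q = expectation (\<lambda>x. (S x - T x)\<^sup>2)" and "e = expectation (\<lambda>x. S x * T x)"
  have ST_int: "integrable M (\<lambda>x. S x * T x)"
  proof (rule Bochner_Integration.integrable_bound)
    show "integrable M (\<lambda>x. (S x)\<^sup>2 + (T x)\<^sup>2)" using int by simp
    have "\<bar>S x * T x\<bar> \<le> (S x)\<^sup>2 + (T x)\<^sup>2" for x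
    proof -
      have "2 * (\<bar>S x\<bar> * \<bar>T x\<bar>) \<le> (S x)\<^sup>2 + (T x)\<^sup>2"
        using sum_squares_bound[of "\<bar>S x\<bar>" "\<bar>T x\<bar>"] by (simp add: mult.assoc)
      moreover have "0 \<le> \<bar>S x\<bar> * \<bar>T x\<bar>" by simp
      ultimately show ?thesis unfolding abs_mult by linarith
    qed
    then show "AE x in M. norm (S x * T x) \<le> norm ((S x)\<^sup>2 + (T x)\<^sup>2)" by simp
  qed measurable
  have a2: "a\<^sup>2 = expectation (\<lambda>x. (S x)\<^sup>2)" and a_pos: "0 < a" using pos by (simp_all add: a_def)
  have b2: "b\<^sup>2 = expectation (\<lambda>x. (T x)\<^sup>2)" and b_nonneg: "0 \<le> b" by (simp_all add: b_def)
  have "q = expectation (\<lambda>x. (S x)\<^sup>2 - 2 * (S x * T x) + (T x)\<^sup>2)"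
    unfolding q_def by (intro Bochner_Integration.integral_cong refl) (simp add: power2_diff algebra_simps)
  also have "\<dots> = a\<^sup>2 - 2 * e + b\<^sup>2" using int ST_int by (simp add: a2 b2 e_def)
  finally have q: "q = a\<^sup>2 - 2 * e + b\<^sup>2" .
  have q_int: "integrable M (\<lambda>x. (S x - T x)\<^sup>2)"
  proof -
    have "(\<lambda>x. (S x - T x)\<^sup>2) = (\<lambda>x. (S x)\<^sup>2 - 2 * (S x * T x) + (T x)\<^sup>2)"
      by (auto simp: power2_diff algebra_simps)
    then show ?thesis using int ST_int by simp
  qed
  have q_le: "q \<le> \<kappa> * a\<^sup>2" using close by (simp add: q_def a2)
  have q4: "q \<le> a\<^sup>2 / 4" using q_le mult_right_mono[OF \<kappa>(2), of "a\<^sup>2"] by simp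
  have "a\<^sup>2 \<le> 2 * q + 2 * b\<^sup>2"
  proof -
    have "a\<^sup>2 \<le> expectation (\<lambda>x. 2 * (S x - T x)\<^sup>2 + 2 * (T x)\<^sup>2)"
      unfolding a2
    proof (rule integral_mono[OF int(1)])
      show "integrable M (\<lambda>x. 2 * (S x - T x)\<^sup>2 + 2 * (T x)\<^sup>2)" using q_int int by simp
      show "(S x)\<^sup>2 \<le> 2 * (S x - T x)\<^sup>2 + 2 * (T x)\<^sup>2" for x
        by (rule power2_le_shift)
    qed
    also have "\<dots> = 2 * q + 2 * b\<^sup>2" using q_int int by (simp add: q_def b2)
    finally show ?thesis .
  qed
  then have "(a/2)\<^sup>2 \<le> b\<^sup>2" using q4 by (simp add: power_divide)
  then have b_ge: "a/2 \<le> b" using b_nonneg by (rule power2_le_imp_le)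
  then have b_pos: "0 < b" using a_pos by simp
  then show "0 < expectation (\<lambda>x. (T x)\<^sup>2)" by (simp add: b_def)
  have eq: "(S x / a - T x / b)\<^sup>2 = (S x)\<^sup>2 / a\<^sup>2 - 2 / (a * b) * (S x * T x) + (T x)\<^sup>2 / b\<^sup>2" for x
    by (simp add: power2_diff power_divide)
  show "integrable M (\<lambda>x. (S x / sqrt (expectation (\<lambda>x. (S x)\<^sup>2)) - T x / sqrt (expectation (\<lambda>x. (T x)\<^sup>2)))\<^sup>2)"
    unfolding a_def[symmetric] b_def[symmetric] eq using int ST_int by simp
  have "expectation (\<lambda>x. (S x / a - T x / b)\<^sup>2) = a\<^sup>2 / a\<^sup>2 - 2 / (a * b) * e + b\<^sup>2 / b\<^sup>2"
    unfolding eq using int ST_int by (simp add: a2 b2 e_def)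
  \<comment> \<open>Substituting the cross moment from \<open>q\<close> leaves a term
    \<open>-(a - b)\<^sup>2\<close>, so the difference of the two norms only helps.\<close>
  also have "\<dots> = (q - (a - b)\<^sup>2) / (a * b)"
    using a_pos b_pos unfolding q by (simp add: field_simps power2_eq_square)
  also have "\<dots> \<le> q / (a * b)" using a_pos b_pos by (intro divide_right_mono) auto
  also have "\<dots> \<le> \<kappa> * a\<^sup>2 / (a * (a/2))"
    using q_le b_ge a_pos b_pos \<kappa> by (intro frac_le mult_left_mono) auto
  also have "\<dots> = 2 * \<kappa>" using a_pos by (simp add: power2_eq_square)
  finally show "expectation (\<lambda>x. (S x / sqrt (expectation (\<lambda>x. (S x)\<^sup>2)) - T x / sqrt (expectation (\<lambda>x. (T x)\<^sup>2)))\<^sup>2)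
      \<le> 2 * \<kappa>" unfolding a_def b_def .
qed

text \<open>The approximating sequence may depend on the accuracy \<epsilon>, which is fixed before
  \<open>n\<close> tends to infinity. Its own limit theorem is only asked for when its second
  moments are eventually positive, since a degenerate sequence cannot be normalized; positivity is
  then supplied by closeness to \<open>S\<close>.\<close>

lemma (in prob_space) clt_by_approximation:
  fixes S :: "nat \<Rightarrow> 'a \<Rightarrow> real" and w :: "nat \<Rightarrow> real"
  assumes meas: "\<And>n. S n \<in> borel_measurable M" and c: "0 < c"
    and S: "\<forall>\<^sub>F n in sequentially. 0 < w n \<and> integrable M (\<lambda>x. (S n x)\<^sup>2) \<and>
      c * w n \<le> expectation (\<lambda>x. (S n x)\<^sup>2)"
    and approx: "\<And>\<epsilon>. 0 < \<epsilon> \<Longrightarrow> \<exists>T. (\<forall>n. T n \<in> borel_measurable M) \<and>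
      (\<forall>\<^sub>F n in sequentially. integrable M (\<lambda>x. (T n x)\<^sup>2) \<and>
        expectation (\<lambda>x. (S n x - T n x)\<^sup>2) \<le> \<epsilon> * w n) \<and>
      ((\<forall>\<^sub>F n in sequentially. 0 < expectation (\<lambda>x. (T n x)\<^sup>2)) \<longrightarrow>
        (\<forall>t. (\<lambda>n. char (distr M borel (\<lambda>x. T n x / sqrt (expectation (\<lambda>x. (T n x)\<^sup>2)))) t)
        \<longlonglongrightarrow> char std_normal_distribution t))"
  shows "weak_conv_m (\<lambda>n. distr M borel (\<lambda>x. S n x / sqrt (expectation (\<lambda>x. (S n x)\<^sup>2))))
    std_normal_distribution"
proof (rule levy_continuity)
  let ?Z = "\<lambda>n x. S n x / sqrt (expectation (\<lambda>x. (S n x)\<^sup>2))"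
  note [measurable] = meas
  show "real_distribution (distr M borel (?Z n))" for n
    by (rule real_distribution_distr) measurable
  show "real_distribution std_normal_distribution" by (rule real_dist_normal_dist)
  fix t :: real
  show "(\<lambda>n. char (distr M borel (?Z n)) t) \<longlonglongrightarrow> char std_normal_distribution t"
  proof (rule tendstoI)
    fix r :: real assume r: "0 < r"
    \<comment> \<open>The bound 1/4 is the requirement of \<open>normalized_distance_le\<close>. The
      other term makes the error of the characteristic functions less than \<open>r/2\<close>;
      adding one to the square of \<open>t\<close> covers \<open>t = 0\<close>.\<close>
    define \<kappa> where "\<kappa> = min (1/4) (r\<^sup>2 / (16 * (t\<^sup>2 + 1)))"
    have t1: "0 < t\<^sup>2 + 1" by (simp add: add_nonneg_pos)
    have \<kappa>: "0 < \<kappa>" using r t1 by (simp add: \<kappa>_def)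
    have \<kappa>4: "\<kappa> \<le> 1/4" unfolding \<kappa>_def by (rule min.cobounded1)
    have frac: "x * (2 * (y / (16 * A))) = x / A * (y / 8)" for x y A :: real by simp
    have "t\<^sup>2 * (2 * \<kappa>) < (r/2)\<^sup>2"
    proof -
      have "t\<^sup>2 * (2 * \<kappa>) \<le> t\<^sup>2 * (2 * (r\<^sup>2 / (16 * (t\<^sup>2 + 1))))"
        unfolding \<kappa>_def by (intro mult_left_mono) auto
      also have "\<dots> = t\<^sup>2 / (t\<^sup>2 + 1) * (r\<^sup>2 / 8)" by (rule frac)
      also have "\<dots> \<le> 1 * (r\<^sup>2 / 8)" using t1 by (intro mult_right_mono) (auto simp: field_simps)
      also have "\<dots> < (r/2)\<^sup>2" using r by (simp add: power_divide)
      finally show ?thesis .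
    qed
    then have "sqrt (t\<^sup>2 * (2 * \<kappa>)) < sqrt ((r/2)\<^sup>2)" by (rule real_sqrt_less_mono)
    then have small: "\<bar>t\<bar> * sqrt (2 * \<kappa>) < r/2" using r by (simp add: real_sqrt_mult)
    have "0 < \<kappa> * c" using \<kappa> c by simp
    from approx[OF this] obtain T where T[measurable]: "\<And>n. T n \<in> borel_measurable M"
      and ev: "\<forall>\<^sub>F n in sequentially. integrable M (\<lambda>x. (T n x)\<^sup>2) \<and>
        expectation (\<lambda>x. (S n x - T n x)\<^sup>2) \<le> \<kappa> * c * w n"
      and lim: "(\<forall>\<^sub>F n in sequentially. 0 < expectation (\<lambda>x. (T n x)\<^sup>2)) \<Longrightarrow>
        (\<lambda>n. char (distr M borel (\<lambda>x. T n x / sqrt (expectation (\<lambda>x. (T n x)\<^sup>2)))) t)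
        \<longlonglongrightarrow> char std_normal_distribution t" by blast
    let ?Y = "\<lambda>n x. T n x / sqrt (expectation (\<lambda>x. (T n x)\<^sup>2))"
    have both: "\<forall>\<^sub>F n in sequentially. 0 < expectation (\<lambda>x. (T n x)\<^sup>2) \<and>
        cmod (char (distr M borel (?Z n)) t - char (distr M borel (?Y n)) t) < r/2"
      using ev S
    proof eventually_elim
      case (elim n)
      have pos: "0 < expectation (\<lambda>x. (S n x)\<^sup>2)" using elim c by (meson less_le_trans mult_pos_pos)
      have "\<kappa> * c * w n \<le> \<kappa> * expectation (\<lambda>x. (S n x)\<^sup>2)"
        using elim \<kappa> by (simp add: mult.assoc)
      then have close: "expectation (\<lambda>x. (S n x - T n x)\<^sup>2) \<le> \<kappa> * expectation (\<lambda>x. (S n x)\<^sup>2)"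
        using elim by linarith
      have iS: "integrable M (\<lambda>x. (S n x)\<^sup>2)" and iT: "integrable M (\<lambda>x. (T n x)\<^sup>2)" using elim by auto
      note nd = normalized_distance_le[OF meas T iS iT pos \<kappa> \<kappa>4 close]
      have "cmod (char (distr M borel (?Z n)) t - char (distr M borel (?Y n)) t)
          \<le> \<bar>t\<bar> * sqrt (expectation (\<lambda>x. (?Z n x - ?Y n x)\<^sup>2))"
        by (rule char_diff_le[OF _ _ nd(1)]) measurable
      also have "\<dots> \<le> \<bar>t\<bar> * sqrt (2 * \<kappa>)" using nd(2) by (intro mult_left_mono) auto
      finally show ?case using small nd(3) by linarith
    qed
    have "\<forall>\<^sub>F n in sequentially. 0 < expectation (\<lambda>x. (T n x)\<^sup>2)"
      using both by eventually_elim auto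
    from tendstoD[OF lim[OF this], of "r/2"] r
    have "\<forall>\<^sub>F n in sequentially. dist (char (distr M borel (?Y n)) t) (char std_normal_distribution t) < r/2"
      by simp
    with both show "\<forall>\<^sub>F n in sequentially.
        dist (char (distr M borel (?Z n)) t) (char std_normal_distribution t) < r"
    proof eventually_elim
      case (elim n)
      have "dist (char (distr M borel (?Z n)) t) (char (distr M borel (?Y n)) t) < r/2"
        using elim by (simp add: dist_norm)
      then show ?case
        using dist_triangle[of "char (distr M borel (?Z n)) t" "char std_normal_distribution t"
            "char (distr M borel (?Y n)) t"] elim by linarith
    qed
  qed
qed

section \<open>Windows of uniformly positive probability\<close>

lemma window_constants:
  fixes \<mu> :: "real measure" and b0 \<eta> K :: real
  assumes pos: "\<And>a b. b0 \<le> a \<Longrightarrow> a < b \<Longrightarrow> 0 < measure \<mu> {a<..<b}"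
    "\<And>a. 0 < measure \<mu> {a<..}" and \<eta>: "0 < \<eta>" and K: "0 < K"
  shows "\<exists>\<Gamma> s T c. finite \<Gamma> \<and> (\<forall>h. \<bar>h\<bar> \<le> K \<longrightarrow> (\<exists>g\<in>\<Gamma>. h \<le> g \<and> g \<le> h + \<eta>/4)) \<and>
    0 < c \<and> c \<le> 1 \<and> c \<le> measure \<mu> {s<..<s + \<eta>/4} \<and>
    (\<forall>g\<in>\<Gamma>. c \<le> measure \<mu> {s + g + \<eta>/4<..<s + g + \<eta>/2}) \<and> c \<le> measure \<mu> {T<..} \<and>
    (\<forall>g\<in>\<Gamma>. s + g + \<eta>/2 + K \<le> T)"
proof -
  \<comment> \<open>Mesh \<eta>/4 is what \<open>cavity_differs_prob_le\<close> expects. These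
    indices suffice for rounding any value of modulus at most \<open>K\<close> up to the
    grid.\<close>
  define N where "N = \<lceil>4 * K / \<eta>\<rceil> + 1"
  define \<Gamma> where "\<Gamma> = (\<lambda>j::int. of_int j * (\<eta>/4)) ` {-N..N}"
  define B where "B = of_int N * (\<eta>/4)"
  \<comment> \<open>Grid points are at least \<open>-B\<close>, so starting from
    \<open>b0 + B\<close> puts every window above \<open>b0\<close>, where intervals have positive
    mass.\<close>
  define s where "s = b0 + B"
  define T where "T = s + B + \<eta>/2 + K"
  have fin: "finite \<Gamma>" by (simp add: \<Gamma>_def)
  have bound: "- B \<le> g" "g \<le> B" if g: "g \<in> \<Gamma>" for g
  proof -
    from g have "\<exists>j\<in>{-N..N}. g = of_int j * (\<eta>/4)" unfolding \<Gamma>_def image_iff .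
    then obtain j where "j \<in> {-N..N}" and j: "g = of_int j * (\<eta>/4)" by (elim bexE)
    then have jN: "-N \<le> j" "j \<le> N" by simp_all
    have le: "real_of_int (- N) \<le> of_int j" "real_of_int j \<le> of_int N"
      using jN by (simp_all only: of_int_le_iff)
    show "- B \<le> g" "g \<le> B"
      using mult_right_mono[OF le(1), of "\<eta>/4"] mult_right_mono[OF le(2), of "\<eta>/4"] \<eta>
      unfolding j B_def by simp_all
  qed
  have "0 < 4 * K / \<eta>" using \<eta> K by simp
  then have N0: "0 \<le> N" unfolding N_def by linarith
  have B0: "0 \<le> B" using N0 \<eta> by (simp add: B_def)
  have grid: "\<exists>g\<in>\<Gamma>. h \<le> g \<and> g \<le> h + \<eta>/4" if h: "\<bar>h\<bar> \<le> K" for h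
  proof -
    define j where "j = \<lceil>4 * h / \<eta>\<rceil>"
    have j: "4 * h / \<eta> \<le> of_int j" "of_int j \<le> 4 * h / \<eta> + 1"
      unfolding j_def by (auto intro: of_int_ceiling_le_add_one)
    have "4 * h / \<eta> \<le> 4 * K / \<eta>" "- (4 * K / \<eta>) \<le> 4 * h / \<eta>"
      using h \<eta> by (auto simp: field_simps abs_le_iff)
    then have "j \<le> N" "- N \<le> j"
      using j le_of_int_ceiling[of "4 * K / \<eta>"] unfolding N_def j_def
      by (auto simp: ceiling_mono intro: order_trans) linarith+
    then have "of_int j * (\<eta>/4) \<in> \<Gamma>" by (auto simp: \<Gamma>_def)
    moreover have "h \<le> of_int j * (\<eta>/4)" "of_int j * (\<eta>/4) \<le> h + \<eta>/4"
      using j \<eta> by (auto simp: field_simps)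
    ultimately show ?thesis by blast
  qed
  \<comment> \<open>Finitely many positive masses have a positive minimum. The finite grid is thus
    what makes \<open>c\<close> uniform over all cavity fields up to \<open>K\<close>; the member 1
    ensures \<open>c \<le> 1\<close>.\<close>
  define A where "A = {1, measure \<mu> {s<..<s + \<eta>/4}, measure \<mu> {T<..}} \<union>
    (\<lambda>g. measure \<mu> {s + g + \<eta>/4<..<s + g + \<eta>/2}) ` \<Gamma>"
  define c where "c = Min A"
  have finA: "finite A" "A \<noteq> {}" using fin by (auto simp: A_def)
  have "\<forall>a\<in>A. 0 < a"
  proof
    fix a assume "a \<in> A"
    then consider "a = 1" | "a = measure \<mu> {s<..<s + \<eta>/4}" | "a = measure \<mu> {T<..}"
      | g where "g \<in> \<Gamma>" "a = measure \<mu> {s + g + \<eta>/4<..<s + g + \<eta>/2}" by (auto simp: A_def)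
    then show "0 < a"
    proof cases
      case 2 then show ?thesis using pos(1)[of s "s + \<eta>/4"] B0 \<eta> by (simp add: s_def)
    next
      case 3 then show ?thesis using pos(2) by simp
    next
      case (4 g)
      then show ?thesis using pos(1)[of "s + g + \<eta>/4" "s + g + \<eta>/2"] bound(1)[of g] \<eta> by (simp add: s_def)
    qed simp
  qed
  then have "0 < c" unfolding c_def using finA by simp
  moreover have "c \<le> a" if "a \<in> A" for a unfolding c_def using finA that by simp
  ultimately show ?thesis
    using fin grid bound
    by (intro exI[of _ \<Gamma>] exI[of _ s] exI[of _ T] exI[of _ c]) (auto simp: A_def T_def)
qed

lemma good_distribution_positive:
  assumes "good_distribution \<mu>"
  shows "\<exists>b0. \<forall>a b. b0 \<le> a \<longrightarrow> a < b \<longrightarrow> 0 < emeasure \<mu> {a<..<b}"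
proof -
  obtain p :: "real \<Rightarrow> real" and \<beta> :: ereal where \<beta>: "\<beta> \<noteq> \<infinity>"
    and \<mu>: "\<mu> = density lborel (\<lambda>x. ennreal (p x))"
    and p: "\<And>x. ereal x < \<beta> \<Longrightarrow> p x = 0" "\<And>x. \<beta> < ereal x \<Longrightarrow> 0 < p x"
    and cont: "continuous_on {x. \<beta> < ereal x} p"
    using assms unfolding good_distribution_def by blast
  let ?S = "{x. \<beta> < ereal x}"
  have S_open: "open ?S" by (intro open_Collect_less continuous_intros)
  have ind_meas: "(\<lambda>x. indicator ?S x *\<^sub>R p x) \<in> borel_measurable borel"
    using cont S_open by (intro borel_measurable_continuous_on_indicator) auto
  have S_borel: "?S \<in> sets borel" using S_open by simp
  define r where "r = real_of_ereal \<beta>"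
  \<comment> \<open>Measurability of \<open>p\<close> has to be derived. It is continuous on the
    open set above \<beta> and zero below \<beta>, so only its value at the single point \<beta> is
    left open.\<close>
  have p_eq: "p x = (if x \<in> ?S then indicator ?S x *\<^sub>R p x else if \<beta> = - \<infinity> then 0 else if x = r then p r else 0)" for x
  proof (cases "x \<in> ?S")
    case False
    then have le: "ereal x \<le> \<beta>" by simp
    then have "\<beta> \<noteq> - \<infinity>" by auto
    then have "\<beta> = ereal r" using \<beta> by (cases \<beta>) (auto simp: r_def)
    then show ?thesis using False le p(1)[of x] by auto
  qed simp
  have p_meas: "p \<in> borel_measurable borel"
  proof -
    have "(\<lambda>x. if x \<in> ?S then indicator ?S x *\<^sub>R p x else if \<beta> = - \<infinity> then 0 else if x = r then p r else 0)
        \<in> borel_measurable borel"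
      using ind_meas S_borel by measurable
    then show ?thesis by (subst (asm) p_eq[symmetric])
  qed
  obtain b0 :: real where b0: "\<beta> < ereal b0" using \<beta> less_PInf_Ex_of_nat[of \<beta>] by auto
  have "0 < emeasure \<mu> {a<..<b}" if ab: "b0 \<le> a" "a < b" for a b
  proof (rule ccontr)
    assume "\<not> ?thesis"
    then have "emeasure \<mu> {a<..<b} = 0" by simp
    then have "(\<integral>\<^sup>+x. ennreal (p x) * indicator {a<..<b} x \<partial>lborel) = 0"
      using p_meas unfolding \<mu> by (subst (asm) emeasure_density) auto
    then have "AE x in lborel. ennreal (p x) * indicator {a<..<b} x = 0"
      using p_meas by (subst (asm) nn_integral_0_iff_AE) auto
    then have "AE x in lborel. x \<notin> {a<..<b}"
    proof eventually_elim
      case (elim x)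
      have "0 < p x" if "x \<in> {a<..<b}"
      proof (rule p(2))
        have "b0 < x" using ab that by simp
        then show "\<beta> < ereal x" using b0 by (metis less_ereal.simps(1) less_trans)
      qed
      then show ?case using elim by (auto simp: indicator_def)
    qed
    then have "emeasure lborel {a<..<b} = 0"
      by (subst (asm) AE_iff_measurable[of "{a<..<b}"]) auto
    then show False using ab by simp
  qed
  then show ?thesis by blast
qed

section \<open>The torus and its cubes\<close>

lemma torus_vertices_eq: "torus_vertices n d = {v. set v \<subseteq> {0..<int n} \<and> length v = d}"
  unfolding torus_vertices_def by (auto simp: in_set_conv_nth subset_iff)

lemma finite_torus_vertices: "finite (torus_vertices n d)"
  unfolding torus_vertices_eq by (rule finite_lists_length_eq) simp

lemma card_torus_vertices: "card (torus_vertices n d) = n ^ d"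
  unfolding torus_vertices_eq by (subst card_lists_length_eq) auto

lemma torus_shift_in:
  assumes "v \<in> torus_vertices n d" "i < d" shows "torus_shift n v i \<in> torus_vertices n d"
proof -
  have "0 < int n" using assms by (auto simp: torus_vertices_def intro: le_less_trans)
  then show ?thesis using assms by (auto simp: torus_vertices_def torus_shift_def nth_list_update)
qed

lemma finite_torus_sites: "finite (torus_sites n d)"
proof -
  have "torus_sites n d \<subseteq> Vtx ` torus_vertices n d \<union>
      (\<lambda>(v, i). Edg v i) ` (torus_vertices n d \<times> {..<d})"
    by (auto simp: torus_sites_def)
  then show ?thesis using finite_torus_vertices finite_subset by blast
qed

lemma covers_subset: "x \<in> torus_sites n d \<Longrightarrow> covers n x \<subseteq> torus_vertices n d"
  by (auto simp: torus_sites_def torus_shift_in)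

text \<open>The first case occurs on the torus with \<open>n = 1\<close>, where an edge is a loop
  and covers a single vertex.\<close>

lemma doubleton_cases: "(\<exists>v. {a, b} = {v}) \<or> (\<exists>v w. v \<noteq> w \<and> {a, b} = {v, w})"
proof (cases "a = b")
  case True
  then show ?thesis by auto
next
  case False
  then show ?thesis by blast
qed

lemma torus_cover_system: "cover_system (covers n) (torus_sites n d) (torus_vertices n d) Vtx"
proof
  fix x assume "x \<in> torus_sites n d"
  then show "(\<exists>v. covers n x = {v}) \<or> (\<exists>v w. v \<noteq> w \<and> covers n x = {v, w})"
    using doubleton_cases by (cases x) simp_all
next
  fix v assume "v \<in> torus_vertices n d"
  then show "Vtx v \<in> torus_sites n d" by (simp add: torus_sites_def)
qed (simp_all add: finite_torus_sites finite_torus_vertices covers_subset)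

lemma card_torus_sites_at:
  assumes "v \<in> torus_vertices n d"
  shows "card {x \<in> torus_sites n d. v \<in> covers n x} \<le> 2 * d + 1"
proof -
  \<comment> \<open>The predecessor of \<open>v\<close> in direction \<open>i\<close>. Sites at
    \<open>v\<close> are the vertex, \<open>d\<close> outgoing and \<open>d\<close> incoming edges;
    coincidences on small tori only lower the count.\<close>
  let ?pre = "\<lambda>i. v[i := (v ! i - 1) mod int n]"
  have "{x \<in> torus_sites n d. v \<in> covers n x} \<subseteq>
      insert (Vtx v) (Edg v ` {..<d} \<union> (\<lambda>i. Edg (?pre i) i) ` {..<d})"
  proof
    fix x assume x: "x \<in> {x \<in> torus_sites n d. v \<in> covers n x}"
    show "x \<in> insert (Vtx v) (Edg v ` {..<d} \<union> (\<lambda>i. Edg (?pre i) i) ` {..<d})"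
    proof (cases x)
      case (Vtx u)
      then show ?thesis using x by simp
    next
      case (Edg u i)
      have u: "u \<in> torus_vertices n d" "i < d" and "v = u \<or> v = torus_shift n u i"
        using x Edg by (auto simp: torus_sites_def)
      then consider "v = u" | "v = torus_shift n u i" by blast
      then show ?thesis
      proof cases
        case 2
        have len: "i < length u" and r: "0 \<le> u ! i" "u ! i < int n"
          using u by (auto simp: torus_vertices_def)
        have "(v ! i - 1) mod int n = ((u ! i + 1) mod int n - 1) mod int n"
          using 2 len by (simp add: torus_shift_def)
        also have "\<dots> = u ! i" using r by (simp add: mod_diff_left_eq)
        finally have "?pre i = u" using 2 len by (simp add: torus_shift_def)
        then show ?thesis using Edg u by force
      qed (use Edg u in auto)
    qed
  qed
  then have "card {x \<in> torus_sites n d. v \<in> covers n x} \<le>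
      card (insert (Vtx v) (Edg v ` {..<d} \<union> (\<lambda>i. Edg (?pre i) i) ` {..<d}))"
    by (intro card_mono) auto
  also have "\<dots> \<le> Suc (card (Edg v ` {..<d} \<union> (\<lambda>i. Edg (?pre i) i) ` {..<d}))"
    by (rule card_insert_le_m1[THEN order_trans]) (auto simp: card_insert_if)
  also have "\<dots> \<le> Suc (d + d)"
    using card_Un_le[of "Edg v ` {..<d}" "(\<lambda>i. Edg (?pre i) i) ` {..<d}"]
      card_image_le[of "{..<d}" "Edg v"] card_image_le[of "{..<d}" "\<lambda>i. Edg (?pre i) i"] by simp
  finally show ?thesis by simp
qed

lemma matching_iff: "matching n d M \<longleftrightarrow> M \<in> exact_covers (covers n) (torus_sites n d) (torus_vertices n d)"
proof -
  have "card A = 1 \<longleftrightarrow> (\<exists>!x. x \<in> A)" for A :: "site set"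
    by (metis card_1_singletonE is_singletonI' is_singleton_altdef empty_iff singletonD singletonI)
  then have "card {x \<in> M. v \<in> covers n x} = 1 \<longleftrightarrow> (\<exists>!x. x \<in> M \<and> v \<in> covers n x)" for v
    by simp
  then show ?thesis
    unfolding matching_def exact_covers_def using covers_subset by blast
qed

text \<open>All ground states share the minimal energy, so the choice made by \<open>SOME\<close>
  does not matter, with or without uniqueness.\<close>

lemma ground_state_energy_eq:
  "ground_state_energy n d J = cover_energy (covers n) (torus_sites n d) (torus_vertices n d) J"
proof -
  interpret cover_system "covers n" "torus_sites n d" "torus_vertices n d" Vtx
    by (rule torus_cover_system)
  have eq: "ground_state n d J M \<longleftrightarrow> optimal (torus_vertices n d) J M" for M
  proof
    assume gs: "ground_state n d J M"
    obtain M' where M': "optimal (torus_vertices n d) J M'" using optimal_exists by blast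
    then show "optimal (torus_vertices n d) J M"
      using gs H_le[of M "torus_vertices n d" J]
      by (auto simp: optimal_def ground_state_def matching_iff energy_def intro: antisym)
  next
    assume "optimal (torus_vertices n d) J M"
    then show "ground_state n d J M"
      using H_le by (auto simp: optimal_def ground_state_def matching_iff energy_def)
  qed
  have "optimal (torus_vertices n d) J (SOME M. ground_state n d J M)"
    unfolding eq using optimal_exists[OF order_refl] by (rule someI_ex)
  then show ?thesis by (simp add: ground_state_energy_def optimal_def energy_def)
qed

section \<open>Cubes of the lattice inside the torus\<close>

fun lattice_covers :: "site \<Rightarrow> int list set" where
  "lattice_covers (Vtx v) = {v}"
| "lattice_covers (Edg v i) = {v, v[i := v ! i + 1]}"

text \<open>Side length \<open>k - 1\<close> in a grid of spacing \<open>k\<close>: the omitted last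
  layer in each direction forms the walls, so that no edge joins two cubes.\<close>

definition cube :: "nat \<Rightarrow> nat \<Rightarrow> int list \<Rightarrow> int list set" where
  "cube d k z = {v. length v = d \<and>
     (\<forall>j<d. int k * z ! j \<le> v ! j \<and> v ! j \<le> int k * z ! j + int k - 2)}"

definition cube_sites :: "nat \<Rightarrow> nat \<Rightarrow> int list \<Rightarrow> site set" where
  "cube_sites d k z = {x \<in> sites_Zd d. lattice_covers x \<subseteq> cube d k z}"

text \<open>Formed with \<open>lattice_covers\<close> instead of \<open>covers n\<close>, so that
  one function of the weights serves all \<open>n\<close>; \<open>torus_cube_energy\<close> provides
  the link.\<close>

definition cube_energy :: "nat \<Rightarrow> nat \<Rightarrow> int list \<Rightarrow> (site \<Rightarrow> real) \<Rightarrow> real" where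
  "cube_energy d k z = cover_energy lattice_covers (cube_sites d k z) (cube d k z)"

lemma cube_div:
  assumes "v \<in> cube d k z" "0 < k" "j < d" shows "v ! j div int k = z ! j"
proof -
  have "0 \<le> v ! j - int k * z ! j" "v ! j - int k * z ! j < int k"
    using assms by (auto simp: cube_def)
  then have "(v ! j - int k * z ! j) div int k = 0" by simp
  moreover have "v ! j = (v ! j - int k * z ! j) + z ! j * int k" by simp
  ultimately show ?thesis using assms(2) by (metis add.left_neutral add.commute div_mult_self1 of_nat_0_less_iff less_irrefl)
qed

lemma cube_disjoint:
  assumes "0 < k" "length z = d" "length z' = d" "z \<noteq> z'" shows "cube d k z \<inter> cube d k z' = {}"
proof (rule ccontr)
  assume "cube d k z \<inter> cube d k z' \<noteq> {}"
  then obtain v where "v \<in> cube d k z" "v \<in> cube d k z'" by auto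
  then have "z ! j = z' ! j" if "j < d" for j using cube_div[OF _ assms(1) that] by metis
  then show False using assms by (metis nth_equalityI)
qed

lemma cube_subset_torus:
  assumes "z \<in> torus_vertices m d" "m * k \<le> n" shows "cube d k z \<subseteq> torus_vertices n d"
proof
  fix v assume v: "v \<in> cube d k z"
  have "0 \<le> v ! j \<and> v ! j < int n" if j: "j < d" for j
  proof -
    have z: "0 \<le> z ! j" "z ! j \<le> int m - 1" using assms(1) j by (auto simp: torus_vertices_def)
    have "int k * z ! j \<le> int k * (int m - 1)" using z by (intro mult_left_mono) auto
    also have "\<dots> \<le> int n - int k"
      using assms(2) by (simp add: right_diff_distrib mult.commute flip: of_nat_mult)
    finally have "int k * z ! j \<le> int n - int k" .
    moreover have "0 \<le> int k * z ! j" using z by simp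
    ultimately show ?thesis using v j by (auto simp: cube_def)
  qed
  then show "v \<in> torus_vertices n d" using v by (auto simp: torus_vertices_def cube_def)
qed

text \<open>Because the last layer is missing, even the upper neighbour of a cube vertex stays
  within coordinates below \<open>n\<close>, also for the outermost cubes.\<close>

lemma cube_no_wrap:
  assumes "z \<in> torus_vertices m d" "m * k \<le> n" "v \<in> cube d k z" "i < d"
  shows "v ! i + 1 < int n" "torus_shift n v i = v[i := v ! i + 1]"
proof -
  have z: "0 \<le> z ! i" "z ! i \<le> int m - 1" using assms by (auto simp: torus_vertices_def)
  have "int k * z ! i \<le> int k * (int m - 1)" using z by (intro mult_left_mono) auto
  also have "\<dots> \<le> int n - int k"
    using assms(2) by (simp add: right_diff_distrib mult.commute flip: of_nat_mult)
  finally have *: "int k * z ! i \<le> int n - int k" .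
  then show "v ! i + 1 < int n" using assms by (auto simp: cube_def)
  moreover have "0 \<le> int k * z ! i" using z by simp
  then have "0 \<le> v ! i" using assms by (force simp: cube_def)
  ultimately show "torus_shift n v i = v[i := v ! i + 1]" by (simp add: torus_shift_def)
qed

lemma finite_cube: "finite (cube d k z)"
proof -
  define B where "B = Max (insert 0 ((\<lambda>j. \<bar>int k * z ! j\<bar> + int k) ` {..<d}))"
  have "cube d k z \<subseteq> {v. set v \<subseteq> {- B..B} \<and> length v = d}"
  proof (safe)
    fix v a assume v: "v \<in> cube d k z" "a \<in> set v"
    then obtain j where j: "j < d" "a = v ! j" by (auto simp: cube_def in_set_conv_nth)
    have "\<bar>int k * z ! j\<bar> + int k \<le> B" unfolding B_def using j by (intro Max_ge) auto
    moreover have "int k * z ! j \<le> v ! j" "v ! j \<le> int k * z ! j + int k - 2"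
      using v j by (auto simp: cube_def)
    ultimately show "a \<in> {- B..B}" using j(2) by auto
  qed (auto simp: cube_def)
  then show ?thesis using finite_lists_length_eq[of "{- B..B}" d] finite_subset by blast
qed

lemma finite_cube_sites: "finite (cube_sites d k z)"
proof -
  have "cube_sites d k z \<subseteq> Vtx ` cube d k z \<union> (\<lambda>(v, i). Edg v i) ` (cube d k z \<times> {..<d})"
    by (auto simp: cube_sites_def sites_Zd_def)
  then show ?thesis using finite_cube finite_subset by blast
qed

lemma cube_cover_system: "cover_system lattice_covers (cube_sites d k z) (cube d k z) Vtx"
proof
  fix x assume "x \<in> cube_sites d k z"
  then show "(\<exists>v. lattice_covers x = {v}) \<or> (\<exists>v w. v \<noteq> w \<and> lattice_covers x = {v, w})"
    using doubleton_cases by (cases x) simp_all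
next
  fix v assume "v \<in> cube d k z"
  then show "Vtx v \<in> cube_sites d k z" by (simp add: cube_sites_def sites_Zd_def cube_def)
next
  fix x assume "x \<in> cube_sites d k z"
  then show "lattice_covers x \<subseteq> cube d k z" by (simp add: cube_sites_def)
qed (simp_all add: finite_cube_sites finite_cube)

lemma torus_cube_energy:
  assumes "z \<in> torus_vertices m d" "m * k \<le> n"
  shows "cover_energy (covers n) (torus_sites n d) (cube d k z) = cube_energy d k z"
  unfolding cube_energy_def
proof (rule cover_energy_cong)
  have eq: "covers n x = lattice_covers x"
    if "x \<in> sites_Zd d" "covers n x \<subseteq> cube d k z \<or> lattice_covers x \<subseteq> cube d k z" for x
    using that cube_no_wrap(2)[OF assms] by (cases x) (auto simp: sites_Zd_def)
  have sub: "torus_sites n d \<subseteq> sites_Zd d"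
    by (auto simp: torus_sites_def sites_Zd_def torus_vertices_def)
  have mem: "x \<in> torus_sites n d" if "x \<in> sites_Zd d" "lattice_covers x \<subseteq> cube d k z" for x
    using that cube_subset_torus[OF assms] by (cases x) (auto simp: sites_Zd_def torus_sites_def)
  show "{x \<in> torus_sites n d. covers n x \<subseteq> cube d k z}
      = {x \<in> cube_sites d k z. lattice_covers x \<subseteq> cube d k z}"
    using eq sub mem unfolding cube_sites_def by blast
  show "covers n x = lattice_covers x" if "x \<in> torus_sites n d" "covers n x \<subseteq> cube d k z" for x
    using eq sub that by blast
qed

lemma torus_energy_cubes:
  assumes "m * k \<le> n" "2 \<le> k"
  shows "cover_energy (covers n) (torus_sites n d) (\<Union>z\<in>torus_vertices m d. cube d k z) J
    = (\<Sum>z\<in>torus_vertices m d. cube_energy d k z J)"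
proof -
  interpret cover_system "covers n" "torus_sites n d" "torus_vertices n d" Vtx
    by (rule torus_cover_system)
  have len: "length z = d" if "z \<in> torus_vertices m d" for z using that by (simp add: torus_vertices_def)
  have "H (\<Union>z\<in>torus_vertices m d. cube d k z) J = (\<Sum>z\<in>torus_vertices m d. H (cube d k z) J)"
  proof (rule H_disjoint_Union[OF finite_torus_vertices])
    show "(\<Union>z\<in>torus_vertices m d. cube d k z) \<subseteq> torus_vertices n d"
      using cube_subset_torus[OF _ assms(1)] by blast
    show "cube d k z \<inter> cube d k z' = {}"
      if "z \<in> torus_vertices m d" "z' \<in> torus_vertices m d" "z \<noteq> z'" for z z'
      using that assms(2) len by (intro cube_disjoint) auto
    fix x assume x: "x \<in> torus_sites n d" "covers n x \<subseteq> (\<Union>z\<in>torus_vertices m d. cube d k z)"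
    show "\<exists>z\<in>torus_vertices m d. covers n x \<subseteq> cube d k z"
    proof (cases x)
      case (Edg v i)
      have i: "i < d" "v \<in> torus_vertices n d" using x(1) Edg by (auto simp: torus_sites_def)
      obtain z z' where z: "z \<in> torus_vertices m d" "v \<in> cube d k z"
        and z': "z' \<in> torus_vertices m d" "torus_shift n v i \<in> cube d k z'"
        using x(2) Edg by auto
      note sh = cube_no_wrap(2)[OF z(1) assms(1) z(2) i(1)]
      have lv: "length v = d" using z(2) by (simp add: cube_def)
      have "z ! j = z' ! j" if j: "j < d" for j
      proof (cases "j = i")
        case False
        then show ?thesis
          using cube_div[OF z(2) _ j] cube_div[OF z'(2) _ j] assms(2) by (simp add: sh)
      next
        case True
        have "(v ! i + 1) div int k = z' ! i"
          using cube_div[OF z'(2) _ i(1)] assms(2) lv i(1) by (simp add: sh)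
        \<comment> \<open>A cube coordinate is at most \<open>int k * z ! i + int k - 2\<close>, so
          one step up still has quotient \<open>z ! i\<close>. Both endpoints of the edge thus have
          the same cube index.\<close>
        moreover have "(v ! i + 1) div int k = z ! i"
        proof -
          have "0 \<le> v ! i + 1 - int k * z ! i" "v ! i + 1 - int k * z ! i < int k"
            using z(2) i(1) by (auto simp: cube_def)
          then have "(v ! i + 1 - int k * z ! i) div int k = 0" by simp
          moreover have "v ! i + 1 = (v ! i + 1 - int k * z ! i) + z ! i * int k" by simp
          ultimately show ?thesis using assms(2)
            by (metis add.left_neutral add.commute div_mult_self1 of_nat_0_eq_iff not_numeral_le_zero)
        qed
        ultimately show ?thesis using True by simp
      qed
      then have "z = z'" using len z(1) z'(1) by (metis nth_equalityI)
      then show ?thesis using z z' Edg by auto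
    qed (use x in auto)
  qed
  also have "\<dots> = (\<Sum>z\<in>torus_vertices m d. cube_energy d k z J)"
    using torus_cube_energy[OF _ assms(1)] by (intro sum.cong) auto
  finally show ?thesis .
qed

lemma bij_betw_cube: 
  assumes "length z = d"
  shows "bij_betw (\<lambda>u. map (\<lambda>j. u ! j + int k * z ! j) [0..<d]) {v. set v \<subseteq> {0..int k - 2} \<and> length v = d} (cube d k z)"
proof (rule bij_betwI[where g = "\<lambda>v. map (\<lambda>j. v ! j - int k * z ! j) [0..<d]"])
  show "(\<lambda>u. map (\<lambda>j. u ! j + int k * z ! j) [0..<d]) \<in>
      {v. set v \<subseteq> {0..int k - 2} \<and> length v = d} \<rightarrow> cube d k z"
    by (fastforce simp: cube_def subset_iff in_set_conv_nth)
  show "(\<lambda>v. map (\<lambda>j. v ! j - int k * z ! j) [0..<d]) \<in>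
      cube d k z \<rightarrow> {v. set v \<subseteq> {0..int k - 2} \<and> length v = d}"
    by (fastforce simp: cube_def in_set_conv_nth)
qed (auto simp: cube_def intro!: nth_equalityI)

lemma card_cube: "length z = d \<Longrightarrow> 1 \<le> k \<Longrightarrow> card (cube d k z) = (k - 1) ^ d"
  using bij_betw_same_card[OF bij_betw_cube[of z d k]] card_lists_length_eq[of "{0..int k - 2}" d]
  by (simp add: nat_diff_distrib of_nat_diff)

section \<open>Relabelling and translation of cubes\<close>

lemma cover_energy_image:
  assumes inj: "inj_on \<tau> S" and S': "\<tau> ` S = S'" and \<phi>: "inj_on \<phi> V" "\<phi> ` V = V'"
    and cov: "\<And>x. x \<in> S \<Longrightarrow> cov x \<subseteq> V" "\<And>x. x \<in> S \<Longrightarrow> cov' (\<tau> x) = \<phi> ` cov x"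
  shows "cover_energy cov' S' V' J = cover_energy cov S V (\<lambda>x. J (\<tau> x))"
proof -
  have mem: "M \<in> exact_covers cov S V \<longleftrightarrow> \<tau> ` M \<in> exact_covers cov' S' V'" if M: "M \<subseteq> S" for M
  proof -
    have "cov' (\<tau> x) \<subseteq> V'" if "x \<in> M" for x
      using cov[of x] that M unfolding \<phi>(2)[symmetric] by blast
    then have sub: "\<tau> ` M \<subseteq> S'" "\<forall>x\<in>\<tau> ` M. cov' x \<subseteq> V'" using M S' by auto
    have "(\<exists>!x. x \<in> \<tau> ` M \<and> \<phi> v \<in> cov' x) \<longleftrightarrow> (\<exists>!x. x \<in> M \<and> v \<in> cov x)" if v: "v \<in> V" for v
    proof -
      have cov_iff: "\<phi> v \<in> cov' (\<tau> x) \<longleftrightarrow> v \<in> cov x" if "x \<in> M" for x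
        using cov[of x] that M v inj_on_image_mem_iff[OF \<phi>(1) v, of "cov x"] by auto
      have eq_iff: "\<tau> x = \<tau> y \<longleftrightarrow> x = y" if "x \<in> M" "y \<in> M" for x y
        using inj_on_eq_iff[OF inj, of x y] that M by auto
      show ?thesis
      proof
        assume "\<exists>!x. x \<in> \<tau> ` M \<and> \<phi> v \<in> cov' x"
        then obtain y where y0: "y \<in> \<tau> ` M \<and> \<phi> v \<in> cov' y"
          and y1: "\<forall>y'. y' \<in> \<tau> ` M \<and> \<phi> v \<in> cov' y' \<longrightarrow> y' = y" by (rule ex1E)
        note y = y0[THEN conjunct1] y0[THEN conjunct2] y1[rule_format, OF conjI]
        from y(1) obtain x where x: "x \<in> M" "y = \<tau> x" by (elim imageE)
        show "\<exists>!x. x \<in> M \<and> v \<in> cov x"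
        proof (rule ex1I[of _ x])
          show "x \<in> M \<and> v \<in> cov x" using x y(2) cov_iff[OF x(1)] by simp
          fix x' assume "x' \<in> M \<and> v \<in> cov x'"
          then show "x' = x" using y(3)[of "\<tau> x'"] cov_iff[of x'] eq_iff[of x' x] x by simp
        qed
      next
        assume "\<exists>!x. x \<in> M \<and> v \<in> cov x"
        then obtain x where x0: "x \<in> M \<and> v \<in> cov x"
          and x1: "\<forall>x'. x' \<in> M \<and> v \<in> cov x' \<longrightarrow> x' = x" by (rule ex1E)
        note x = x0[THEN conjunct1] x0[THEN conjunct2] x1[rule_format, OF conjI]
        show "\<exists>!x. x \<in> \<tau> ` M \<and> \<phi> v \<in> cov' x"
        proof (rule ex1I[of _ "\<tau> x"])
          show "\<tau> x \<in> \<tau> ` M \<and> \<phi> v \<in> cov' (\<tau> x)" using x(1,2) cov_iff[OF x(1)] by simp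
          fix y assume y: "y \<in> \<tau> ` M \<and> \<phi> v \<in> cov' y"
          then obtain x' where "x' \<in> M" "y = \<tau> x'" by (elim conjE imageE)
          then show "y = \<tau> x" using x(3)[of x'] cov_iff[of x'] y by simp
        qed
      qed
    qed
    then have "(\<forall>v\<in>V'. \<exists>!x. x \<in> \<tau> ` M \<and> v \<in> cov' x) \<longleftrightarrow> (\<forall>v\<in>V. \<exists>!x. x \<in> M \<and> v \<in> cov x)"
      unfolding \<phi>(2)[symmetric] by simp
    moreover have "\<forall>x\<in>M. cov x \<subseteq> V" using M cov(1) by blast
    ultimately show ?thesis using sub M unfolding exact_covers_def mem_Collect_eq by argo
  qed
  have ec: "exact_covers cov' S' V' = (`) \<tau> ` exact_covers cov S V"
  proof
    show "exact_covers cov' S' V' \<subseteq> (`) \<tau> ` exact_covers cov S V"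
    proof
      fix N assume N: "N \<in> exact_covers cov' S' V'"
      then have "N \<subseteq> \<tau> ` S" using S' by (simp add: exact_covers_def)
      then obtain M where "M \<subseteq> S" "N = \<tau> ` M" by (auto simp: subset_image_iff)
      then show "N \<in> (`) \<tau> ` exact_covers cov S V" using mem N by blast
    qed
    show "(`) \<tau> ` exact_covers cov S V \<subseteq> exact_covers cov' S' V'"
    proof (rule image_subsetI)
      fix M assume M: "M \<in> exact_covers cov S V"
      then have "M \<subseteq> S" by (simp add: exact_covers_def)
      then show "\<tau> ` M \<in> exact_covers cov' S' V'" using mem M by blast
    qed
  qed
  have "sum J (\<tau> ` M) = sum (\<lambda>x. J (\<tau> x)) M" if "M \<in> exact_covers cov S V" for M
    using that inj by (subst sum.reindex) (auto simp: exact_covers_def inj_on_subset)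
  then have "sum J ` exact_covers cov' S' V' = sum (\<lambda>x. J (\<tau> x)) ` exact_covers cov S V"
    unfolding ec image_image by (intro image_cong) auto
  then show ?thesis by (simp add: cover_energy_def)
qed

definition translate :: "nat \<Rightarrow> nat \<Rightarrow> int list \<Rightarrow> int list \<Rightarrow> int list" where
  "translate d k z v = map (\<lambda>j. v ! j + int k * z ! j) [0..<d]"

fun translate_site :: "nat \<Rightarrow> nat \<Rightarrow> int list \<Rightarrow> site \<Rightarrow> site" where
  "translate_site d k z (Vtx v) = Vtx (translate d k z v)"
| "translate_site d k z (Edg v i) = Edg (translate d k z v) i"

abbreviation "origin d \<equiv> replicate d (0::int)"

lemma length_translate [simp]: "length (translate d k z v) = d"
  by (simp add: translate_def)

lemma translate_inj:
  assumes "length v = d" "length w = d" "translate d k z v = translate d k z w" shows "v = w"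
proof (rule nth_equalityI)
  fix j assume "j < length v"
  then have "translate d k z v ! j = translate d k z w ! j" "j < d" using assms by auto
  then show "v ! j = w ! j" by (simp add: translate_def)
qed (use assms in simp)

lemma translate_update:
  assumes "length v = d" "i < d"
  shows "translate d k z (v[i := v ! i + 1]) = (translate d k z v)[i := translate d k z v ! i + 1]"
  using assms by (intro nth_equalityI) (auto simp: translate_def nth_list_update)

lemma translate_cube: "translate d k z ` cube d k (origin d) = cube d k z"
proof
  show "translate d k z ` cube d k (origin d) \<subseteq> cube d k z"
    by (auto simp: cube_def translate_def)
  show "cube d k z \<subseteq> translate d k z ` cube d k (origin d)"
  proof
    fix v assume v: "v \<in> cube d k z"
    let ?u = "map (\<lambda>j. v ! j - int k * z ! j) [0..<d]"
    have "translate d k z ?u = v" using v by (intro nth_equalityI) (auto simp: translate_def cube_def)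
    moreover have "?u \<in> cube d k (origin d)" using v by (auto simp: cube_def)
    ultimately show "v \<in> translate d k z ` cube d k (origin d)" by force
  qed
qed

lemma translate_covers:
  assumes "x \<in> sites_Zd d"
  shows "lattice_covers (translate_site d k z x) = translate d k z ` lattice_covers x"
  using assms by (cases x) (auto simp: sites_Zd_def translate_update)

lemma translate_site_inj: "inj_on (translate_site d k z) (sites_Zd d)"
proof (rule inj_onI)
  fix x y assume "x \<in> sites_Zd d" "y \<in> sites_Zd d" "translate_site d k z x = translate_site d k z y"
  then show "x = y"
    by (cases x; cases y) (auto simp: sites_Zd_def, (metis translate_inj)+)
qed

lemma translate_cube_sites: "translate_site d k z ` cube_sites d k (origin d) = cube_sites d k z"
proof
  show "translate_site d k z ` cube_sites d k (origin d) \<subseteq> cube_sites d k z"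
  proof
    fix y assume "y \<in> translate_site d k z ` cube_sites d k (origin d)"
    then obtain x where x: "x \<in> sites_Zd d" "lattice_covers x \<subseteq> cube d k (origin d)" "y = translate_site d k z x"
      by (auto simp: cube_sites_def)
    have "y \<in> sites_Zd d" using x by (cases x) (auto simp: sites_Zd_def)
    moreover have "lattice_covers y \<subseteq> cube d k z"
      unfolding x(3) translate_covers[OF x(1)] using x(2) translate_cube[of d k z] by blast
    ultimately show "y \<in> cube_sites d k z" by (simp add: cube_sites_def)
  qed
  show "cube_sites d k z \<subseteq> translate_site d k z ` cube_sites d k (origin d)"
  proof
    fix y assume y: "y \<in> cube_sites d k z"
    then have yc: "y \<in> sites_Zd d" "lattice_covers y \<subseteq> cube d k z" by (auto simp: cube_sites_def)
    obtain x where x: "x \<in> sites_Zd d" "y = translate_site d k z x"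
    proof (cases y)
      case (Vtx v)
      then have "v \<in> translate d k z ` cube d k (origin d)" using yc translate_cube by auto
      then obtain u where "u \<in> cube d k (origin d)" "v = translate d k z u" by auto
      then show ?thesis using Vtx that[of "Vtx u"] by (auto simp: sites_Zd_def cube_def)
    next
      case (Edg v i)
      then have "v \<in> translate d k z ` cube d k (origin d)" "i < d"
        using yc translate_cube by (auto simp: sites_Zd_def)
      then obtain u where "u \<in> cube d k (origin d)" "v = translate d k z u" by auto
      then show ?thesis using Edg \<open>i < d\<close> that[of "Edg u i"] by (auto simp: sites_Zd_def cube_def)
    qed
    have "lattice_covers x \<subseteq> cube d k (origin d)"
    proof
      fix u assume u: "u \<in> lattice_covers x"
      then have "translate d k z u \<in> cube d k z" using yc(2) translate_covers[OF x(1), of k z] x(2) by auto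
      then obtain u' where u': "u' \<in> cube d k (origin d)" "translate d k z u = translate d k z u'"
        using translate_cube[of d k z] by auto
      have "length u = d" using u x(1) by (cases x) (auto simp: sites_Zd_def)
      then show "u \<in> cube d k (origin d)" using translate_inj[OF _ _ u'(2)] u'(1) by (auto simp: cube_def)
    qed
    then show "y \<in> translate_site d k z ` cube_sites d k (origin d)"
      using x by (auto simp: cube_sites_def)
  qed
qed

text \<open>Reduces every cube to the one at the origin with shifted weights. As these are again
  i.i.d., the cube energies are identically distributed.\<close>

lemma cube_energy_translate:
  "cube_energy d k z J = cube_energy d k (origin d) (\<lambda>x. J (translate_site d k z x))"
  unfolding cube_energy_def
proof (rule cover_energy_image[OF _ translate_cube_sites _ translate_cube])
  have sub: "cube_sites d k (origin d) \<subseteq> sites_Zd d" by (auto simp: cube_sites_def)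
  show "inj_on (translate_site d k z) (cube_sites d k (origin d))"
    by (rule inj_on_subset[OF translate_site_inj sub])
  show "inj_on (translate d k z) (cube d k (origin d))"
    by (rule inj_onI, rule translate_inj) (auto simp: cube_def)
  fix x assume "x \<in> cube_sites d k (origin d)"
  then show "lattice_covers x \<subseteq> cube d k (origin d)"
    "lattice_covers (translate_site d k z x) = translate d k z ` lattice_covers x"
    using translate_covers by (auto simp only: cube_sites_def mem_Collect_eq)
qed

section \<open>Central limit theorem for sums over cubes\<close>

locale lattice_weights = iid_weights P \<mu> J "sites_Zd d"
  for P :: "'w measure" and \<mu> :: "real measure" and J :: "site \<Rightarrow> 'w \<Rightarrow> real" and d :: nat +
  fixes b0 :: real
  assumes dim: "1 \<le> d" and positive: "b0 \<le> a \<Longrightarrow> a < b \<Longrightarrow> 0 < measure \<mu> {a<..<b}"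
begin

abbreviation torus_energy :: "nat \<Rightarrow> int list set \<Rightarrow> (site \<Rightarrow> real) \<Rightarrow> real" where
  "torus_energy n \<equiv> cover_energy (covers n) (torus_sites n d)"

lemma \<mu>_mono: "A \<subseteq> B \<Longrightarrow> B \<in> sets borel \<Longrightarrow> measure \<mu> A \<le> measure \<mu> B"
  by (rule dist.finite_measure_mono) (simp_all add: dist.sets_\<mu>)

lemma positive_greaterThan: "0 < measure \<mu> {a<..}"
  using positive[of "max a b0" "max a b0 + 1"] \<mu>_mono[of "{max a b0<..<max a b0 + 1}" "{a<..}"]
  by (simp add: subset_iff)

lemma torus_disordered_cover:
  "disordered_cover (covers n) (torus_sites n d) (torus_vertices n d) Vtx P \<mu> J"
proof (intro disordered_cover.intro torus_cover_system iid_subset)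
  show "torus_sites n d \<subseteq> sites_Zd d"
    by (auto simp: torus_sites_def sites_Zd_def torus_vertices_def)
qed

lemma torus_nonempty: "1 \<le> n \<Longrightarrow> torus_vertices n d \<noteq> {}"
  using card_torus_vertices[of n d] by (metis card.empty not_one_le_zero power_not_zero)

lemma torus_variance_ge:
  shows "\<exists>c>0. \<forall>n\<ge>1. c * real n ^ d \<le> variance (\<lambda>w. torus_energy n (torus_vertices n d) (weights w))"
proof -
  \<comment> \<open>\<open>t\<close> lies above \<open>b0\<close>, so \<open>{..t}\<close> contains
    an interval of positive mass. \<open>s\<close> must also exceed \<open>b0\<close>, and be
    nonnegative, whatever the sign of \<open>b0\<close>.\<close>
  define t s where "t = b0 + 1" and "s = \<bar>b0\<bar> + 1"
  define A where "A = {1, measure \<mu> {..t}, measure \<mu> {t + 1<..}, measure \<mu> {t + 1 + s<..}, measure \<mu> {..<s}}"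
  define c where "c = Min A"
  have "0 < measure \<mu> {..t}"
    using positive[of b0 t] \<mu>_mono[of "{b0<..<t}" "{..t}"] by (simp add: t_def subset_iff)
  moreover have "0 < measure \<mu> {..<s}"
  proof -
    have "b0 < s" unfolding s_def by linarith
    then show ?thesis using positive[of b0 s] \<mu>_mono[of "{b0<..<s}" "{..<s}"] by (simp add: subset_iff)
  qed
  ultimately have c0: "0 < c" using positive_greaterThan by (simp add: c_def A_def)
  have c_le: "c \<le> a" if "a \<in> A" for a unfolding c_def using that by (intro Min_le) (auto simp: A_def)
  let ?D = "2 * d + 1"
  have "(c * c ^ (3 * ?D))\<^sup>2 * real n ^ d \<le> variance (\<lambda>w. torus_energy n (torus_vertices n d) (weights w))"
    if n: "1 \<le> n" for n
  proof -
    interpret T: disordered_cover "covers n" "torus_sites n d" "torus_vertices n d" Vtx P \<mu> J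
      by (rule torus_disordered_cover)
    have D: "card (T.sites_at v) \<le> ?D" if "v \<in> torus_vertices n d" for v
      using card_torus_sites_at[OF that] by (simp add: T.sites_at_def)
    have s0: "0 \<le> s" by (simp add: s_def)
    show ?thesis
      using T.variance_ge[OF torus_nonempty[OF n] D s0 c0, of t] c_le
      by (simp add: A_def card_torus_vertices)
  qed
  then show ?thesis using c0 by (intro exI[of _ "(c * c ^ (3 * ?D))\<^sup>2"]) auto
qed

text \<open>The order of choices matters: \<eta> and \<open>K\<close> each contribute a quarter of
  \<epsilon>, then the grid and \<open>c\<close> are fixed, and only then \<rho> is taken so small
  that the term with \<open>card W\<close> uses the remaining half. Nothing depends on
  \<open>n\<close>.\<close>

lemma torus_variance_diff_le:
  assumes \<epsilon>: "0 < \<epsilon>"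
  shows "\<exists>\<rho>>0. \<forall>n\<ge>1. \<forall>W\<subseteq>torus_vertices n d. real (card W) \<le> \<rho> * real n ^ d \<longrightarrow>
    variance (\<lambda>w. torus_energy n (torus_vertices n d) (weights w)
      - torus_energy n (torus_vertices n d - W) (weights w)) \<le> \<epsilon> * real n ^ d"
proof -
  define D where "D = 2 * d + 1"
  define m1 m2 where "m1 = (\<integral>t. \<bar>t\<bar> \<partial>\<mu>)" and "m2 = (\<integral>t. t\<^sup>2 \<partial>\<mu>)"
  have m_nonneg: "0 \<le> m1" "0 \<le> m2" by (simp_all add: m1_def m2_def)
  have D1: "1 \<le> real D" by (simp add: D_def)
  define \<eta> where "\<eta> = sqrt (\<epsilon> / (16 * real D))"
  define N where "N = real D * (24 * (real D)\<^sup>2 * m1 * m2)"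
  define K where "K = 4 * (N + 1) / \<epsilon>"
  have N0: "0 \<le> N" using m_nonneg by (simp add: N_def)
  have \<eta>: "0 < \<eta>" "real D * (4 * \<eta>\<^sup>2) = \<epsilon> / 4" using \<epsilon> D1 by (simp_all add: \<eta>_def)
  have K: "0 < K" using \<epsilon> N0 by (simp add: K_def)
  have NK: "N / K \<le> \<epsilon> / 4" using \<epsilon> N0 by (simp add: K_def field_simps)
  obtain \<Gamma> s T c where \<Gamma>: "finite \<Gamma>" "\<And>h. \<bar>h\<bar> \<le> K \<Longrightarrow> \<exists>g\<in>\<Gamma>. h \<le> g \<and> g \<le> h + \<eta>/4"
    and c: "0 < c" "c \<le> 1" "c \<le> measure \<mu> {s<..<s + \<eta>/4}"
      "\<And>g. g \<in> \<Gamma> \<Longrightarrow> c \<le> measure \<mu> {s + g + \<eta>/4<..<s + g + \<eta>/2}" "c \<le> measure \<mu> {T<..}"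
    and T: "\<And>g. g \<in> \<Gamma> \<Longrightarrow> s + g + \<eta>/2 + K \<le> T"
    using window_constants[of b0 \<mu>, OF positive positive_greaterThan \<eta>(1) K] by blast
  define B where "B = real D * ((8 * real D * real (card \<Gamma>) / c ^ D + 8 * real D) * m2)"
  have B0: "0 \<le> B" using m_nonneg c(1) by (simp add: B_def)
  define \<rho> where "\<rho> = \<epsilon> / (2 * (B + 1))"
  have \<rho>: "0 < \<rho>" "\<rho> * B \<le> \<epsilon> / 2" using \<epsilon> B0 by (simp_all add: \<rho>_def field_simps)
  have "variance (\<lambda>w. torus_energy n (torus_vertices n d) (weights w)
      - torus_energy n (torus_vertices n d - W) (weights w)) \<le> \<epsilon> * real n ^ d"
    if n: "1 \<le> n" and W: "W \<subseteq> torus_vertices n d" "real (card W) \<le> \<rho> * real n ^ d" for n W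
  proof -
    interpret T: disordered_cover "covers n" "torus_sites n d" "torus_vertices n d" Vtx P \<mu> J
      by (rule torus_disordered_cover)
    have D: "card (T.sites_at v) \<le> D" if "v \<in> torus_vertices n d" for v
      using card_torus_sites_at[OF that] by (simp add: T.sites_at_def D_def)
    have m: "T.abs_mean = m1" "T.square_mean = m2"
      by (simp_all add: T.abs_mean_def T.square_mean_def m1_def m2_def)
    have "variance (\<lambda>w. torus_energy n (torus_vertices n d) (weights w)
        - torus_energy n (torus_vertices n d - W) (weights w))
      \<le> real D * (real (card (torus_vertices n d)) * (4 * \<eta>\<^sup>2 + 24 * (real D)\<^sup>2 * m1 * m2 / K)
        + real (card W) * (8 * real D * real (card \<Gamma>) / c ^ D + 8 * real D) * m2)"
      using T.variance_diff_le[OF W(1) torus_nonempty[OF n] \<Gamma> c T \<eta>(1) K D] unfolding m .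
    also have "\<dots> = real n ^ d * (real D * (4 * \<eta>\<^sup>2) + N / K) + real (card W) * B"
      unfolding card_torus_vertices B_def N_def by (simp add: algebra_simps)
    also have "\<dots> \<le> real n ^ d * (\<epsilon> / 4 + \<epsilon> / 4) + (\<rho> * real n ^ d) * B"
      unfolding \<eta>(2) using NK W(2) B0 by (intro add_mono mult_left_mono mult_right_mono) auto
    also have "\<dots> \<le> real n ^ d * (\<epsilon> / 4 + \<epsilon> / 4) + real n ^ d * (\<epsilon> / 2)"
      using mult_left_mono[OF \<rho>(2), of "real n ^ d"] by (simp add: mult_ac)
    also have "\<dots> = \<epsilon> * real n ^ d" by (simp add: algebra_simps)
    finally show ?thesis .
  qed
  then show ?thesis using \<rho>(1) by blast
qed

section \<open>Cube energies as i.i.d. variables\<close>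

lemma cube_energy_measurable:
  "cube_energy d k z \<in> borel_measurable (PiM (cube_sites d k z) (\<lambda>_. borel))"
proof -
  have "cube_sites d k z \<subseteq> sites_Zd d" by (auto simp: cube_sites_def)
  then interpret T: disordered_cover lattice_covers "cube_sites d k z" "cube d k z" Vtx P \<mu> J
    by (intro disordered_cover.intro cube_cover_system iid_subset)
  show ?thesis unfolding cube_energy_def by (rule T.H_meas[OF order_refl])
qed

lemma cube_energy_restrict: "cube_energy d k z (restrict K (cube_sites d k z)) = cube_energy d k z K"
proof -
  interpret cover_system lattice_covers "cube_sites d k z" "cube d k z" Vtx by (rule cube_cover_system)
  show ?thesis unfolding cube_energy_def by (rule H_cong) auto
qed

lemma cube_sites_subset: "cube_sites d k z \<subseteq> sites_Zd d"
  by (auto simp: cube_sites_def)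

lemma cube_sites_nonempty:
  assumes "2 \<le> k" "length z = d" shows "cube_sites d k z \<noteq> {}" "cube d k z \<noteq> {}"
proof -
  show "cube d k z \<noteq> {}" using card_cube[OF assms(2), of k] assms(1) by auto
  then obtain v where "v \<in> cube d k z" by auto
  then have "Vtx v \<in> cube_sites d k z" by (auto simp: cube_sites_def sites_Zd_def cube_def)
  then show "cube_sites d k z \<noteq> {}" by auto
qed

lemma cube_energy_weights_measurable:
  "(\<lambda>w. cube_energy d k z (weights w)) \<in> borel_measurable P"
  by (rule weights_measurable[OF cube_sites_subset cube_energy_measurable cube_energy_restrict])

lemma cube_energy_distr:
  assumes "2 \<le> k"
  shows "distr P borel (\<lambda>w. cube_energy d k z (weights w)) =
    distr (PiM (cube_sites d k (origin d)) (\<lambda>_. \<mu>)) borel (cube_energy d k (origin d))"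
proof -
  interpret R: iid_weights P \<mu> "\<lambda>x. J (translate_site d k z x)" "cube_sites d k (origin d)"
    using cube_sites_subset translate_cube_sites
    by (intro iid_reindex inj_on_subset[OF translate_site_inj]) auto
  show ?thesis
    unfolding cube_energy_translate[of d k z]
    by (rule R.distr_weights[OF order_refl cube_sites_nonempty(1)[OF assms] cube_energy_measurable
          cube_energy_restrict]) simp
qed

text \<open>Disjoint cubes have no site in common. The injective indexing \<open>zz\<close> lets the
  statement serve both a sequence of cubes and a block of cubes.\<close>

lemma cube_energy_indep:
  assumes "2 \<le> k" "inj_on zz A" "\<And>i. i \<in> A \<Longrightarrow> length (zz i) = d"
  shows "indep_vars (\<lambda>_. borel) (\<lambda>i w. cube_energy d k (zz i) (weights w)) A"
proof (rule indep_blocks[where K = "\<lambda>i. cube_sites d k (zz i)"])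
  show "disjoint_family_on (\<lambda>i. cube_sites d k (zz i)) A"
    unfolding disjoint_family_on_def
  proof (intro ballI impI)
    fix i j assume ij: "i \<in> A" "j \<in> A" "i \<noteq> j"
    then have "cube d k (zz i) \<inter> cube d k (zz j) = {}"
      using assms by (intro cube_disjoint) (auto simp: inj_on_eq_iff)
    moreover have "lattice_covers x \<noteq> {}" for x by (cases x) auto
    ultimately show "cube_sites d k (zz i) \<inter> cube_sites d k (zz j) = {}"
      unfolding cube_sites_def by blast
  qed
qed (rule cube_sites_subset cube_energy_measurable cube_energy_restrict)+

lemma cube_energy_square_integrable:
  assumes "2 \<le> k" "length z = d"
  shows "integrable P (\<lambda>w. (cube_energy d k z (weights w))\<^sup>2)"
proof -
  interpret T: disordered_cover lattice_covers "cube_sites d k z" "cube d k z" Vtx P \<mu> J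
    by (intro disordered_cover.intro cube_cover_system iid_subset cube_sites_subset)
  show ?thesis
    unfolding cube_energy_def
    by (rule T.H_weights_integrable(1)[OF order_refl cube_sites_nonempty(2)[OF assms]])
qed

definition cube_mean :: "nat \<Rightarrow> real" where
  "cube_mean k = (\<integral>w. cube_energy d k (origin d) (weights w) \<partial>P)"

definition cube_variance :: "nat \<Rightarrow> real" where
  "cube_variance k = (\<integral>w. (cube_energy d k (origin d) (weights w) - cube_mean k)\<^sup>2 \<partial>P)"

lemma cube_integral:
  fixes g :: "real \<Rightarrow> real"
  assumes "2 \<le> k" "g \<in> borel_measurable borel"
  shows "(\<integral>w. g (cube_energy d k z (weights w)) \<partial>P) = (\<integral>w. g (cube_energy d k (origin d) (weights w)) \<partial>P)"
  using integral_distr[OF cube_energy_weights_measurable[of k z] assms(2)]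
    integral_distr[OF cube_energy_weights_measurable[of k "origin d"] assms(2)]
    cube_energy_distr[OF assms(1), of z] cube_energy_distr[OF assms(1), of "origin d"] by simp

lemma cube_moments:
  assumes "2 \<le> k"
  shows "(\<integral>w. cube_energy d k z (weights w) \<partial>P) = cube_mean k"
    "(\<integral>w. (cube_energy d k z (weights w) - cube_mean k)\<^sup>2 \<partial>P) = cube_variance k"
  unfolding cube_mean_def cube_variance_def
  using cube_integral[OF assms, of "\<lambda>x. x" z] cube_integral[OF assms, of "\<lambda>x. (x - a)\<^sup>2" z for a] by simp_all

definition cube_sum :: "nat \<Rightarrow> nat \<Rightarrow> 'w \<Rightarrow> real" where
  "cube_sum k m w = (\<Sum>z\<in>torus_vertices m d. cube_energy d k z (weights w) - cube_mean k)"

lemma cube_sum_measurable: "cube_sum k m \<in> borel_measurable P"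
  unfolding cube_sum_def[abs_def]
  by (intro borel_measurable_sum borel_measurable_diff cube_energy_weights_measurable borel_measurable_const)

lemma cube_centered:
  assumes "2 \<le> k" "length z = d"
  shows "integrable P (\<lambda>w. (cube_energy d k z (weights w) - cube_mean k)\<^sup>2)"
    "integrable P (\<lambda>w. cube_energy d k z (weights w))"
    "(\<integral>w. cube_energy d k z (weights w) - cube_mean k \<partial>P) = 0"
proof -
  show int: "integrable P (\<lambda>w. cube_energy d k z (weights w))"
    by (rule square_integrable_imp_integrable[OF cube_energy_weights_measurable
          cube_energy_square_integrable[OF assms]])
  show "integrable P (\<lambda>w. (cube_energy d k z (weights w) - cube_mean k)\<^sup>2)"
    by (rule square_expectation_decomp(1)[OF int cube_energy_square_integrable[OF assms]])
  show "(\<integral>w. cube_energy d k z (weights w) - cube_mean k \<partial>P) = 0"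
    using int cube_moments(1)[OF assms(1), of z] by (simp add: prob_space)
qed

lemma cube_sum_second_moment:
  assumes "2 \<le> k"
  shows "integrable P (\<lambda>w. (cube_sum k m w)\<^sup>2)" "(\<integral>w. (cube_sum k m w)\<^sup>2 \<partial>P) = real (m ^ d) * cube_variance k"
proof -
  have len: "length z = d" if "z \<in> torus_vertices m d" for z using that by (simp add: torus_vertices_def)
  have "indep_vars (\<lambda>_. borel) (\<lambda>z w. cube_energy d k z (weights w)) (torus_vertices m d)"
    using len by (intro cube_energy_indep assms) (auto simp: inj_on_def)
  then have ind: "indep_vars (\<lambda>_. borel) (\<lambda>z w. cube_energy d k z (weights w) - cube_mean k) (torus_vertices m d)"
    by (rule indep_vars_compose2[where Y = "\<lambda>_ x. x - cube_mean k"]) measurable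
  note sm = second_moment_indep_sum[OF finite_torus_vertices ind cube_centered(1)[OF assms len] cube_centered(3)[OF assms len]]
  show "integrable P (\<lambda>w. (cube_sum k m w)\<^sup>2)" unfolding cube_sum_def by (rule sm(1))
  show "(\<integral>w. (cube_sum k m w)\<^sup>2 \<partial>P) = real (m ^ d) * cube_variance k"
    unfolding cube_sum_def using sm(2) cube_moments(2)[OF assms] by (simp add: card_torus_vertices)
qed

text \<open>The cubes along the first axis form an i.i.d. sequence, to which the classical central limit
  theorem applies; the sum over a block of \<open>m ^ d\<close> cubes has the same characteristic function as
  the sum of the first \<open>m ^ d\<close> terms of that sequence.\<close>
lemma cube_sum_clt:
  assumes k: "2 \<le> k" and \<sigma>: "0 < cube_variance k" and m: "filterlim m at_top sequentially"
  shows "(\<lambda>n. char (distr P borel (\<lambda>w. cube_sum k (m n) w / sqrt (\<integral>w. (cube_sum k (m n) w)\<^sup>2 \<partial>P))) t)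
    \<longlonglongrightarrow> char std_normal_distribution t"
proof -
  \<comment> \<open>The index (i, 0, ..., 0), a genuine sequence as the classical theorem requires;
    it exists because \<open>d\<close> is at least one.\<close>
  define zz where "zz i = int i # replicate (d - 1) 0" for i
  have zz: "inj zz" "length (zz i) = d" for i using dim by (auto simp: zz_def inj_on_def)
  define Y where "Y z w = cube_energy d k z (weights w) - cube_mean k" for z w
  define Z where "Z N w = (\<Sum>i<N. Y (zz i) w) / sqrt (real N * cube_variance k)" for N w
  have E_indep: "indep_vars (\<lambda>_. borel) (\<lambda>i w. cube_energy d k (zz i) (weights w)) UNIV"
    using zz by (intro cube_energy_indep k) (auto simp: inj_on_def)
  have "weak_conv_m (\<lambda>N. distr P borel (\<lambda>w. (\<Sum>i<N. cube_energy d k (zz i) (weights w) - cube_mean k)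
      / sqrt (real N * (sqrt (cube_variance k))\<^sup>2))) std_normal_distribution"
  proof (rule central_limit_theorem[OF E_indep])
    show "0 < sqrt (cube_variance k)" using \<sigma> by simp
    show "variance (\<lambda>w. cube_energy d k (zz i) (weights w)) = (sqrt (cube_variance k))\<^sup>2" for i
      using \<sigma> cube_moments[OF k, of "zz i"] by simp
  qed (use cube_moments(1)[OF k] cube_energy_square_integrable[OF k zz(2)] cube_energy_distr[OF k] in auto)
  then have "weak_conv_m (\<lambda>N. distr P borel (Z N)) std_normal_distribution"
    using \<sigma> by (simp add: Z_def[abs_def] Y_def)
  moreover have Y_meas: "Y z \<in> borel_measurable P" for z
    unfolding Y_def[abs_def] using cube_energy_weights_measurable by measurable
  then have "Z N \<in> borel_measurable P" for N
    unfolding Z_def[abs_def] by measurable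
  ultimately have "(\<lambda>N. char (distr P borel (Z N)) t) \<longlonglongrightarrow> char std_normal_distribution t"
    by (intro levy_continuity1 real_distribution_distr real_dist_normal_dist)
  moreover have "filterlim (\<lambda>n. m n ^ d) at_top sequentially"
  proof (rule filterlim_at_top_mono[OF m always_eventually], rule allI)
    show "m n \<le> m n ^ d" for n using dim by (cases "m n = 0") (auto intro: self_le_power)
  qed
  ultimately have "(\<lambda>n. char (distr P borel (Z (m n ^ d))) t) \<longlonglongrightarrow> char std_normal_distribution t"
    by (rule filterlim_compose)
  moreover have "char (distr P borel (Z (m n ^ d))) t
      = char (distr P borel (\<lambda>w. cube_sum k (m n) w / sqrt (\<integral>w. (cube_sum k (m n) w)\<^sup>2 \<partial>P))) t" for n
  proof -
    let ?r = "sqrt (real (m n ^ d) * cube_variance k)"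
    \<comment> \<open>All normalized terms share one characteristic function. By independence both
      sums then have its power with exponent \<open>m n ^ d\<close>.\<close>
    have char_Y: "char (distr P borel (\<lambda>w. Y z w / ?r)) t = char (distr P borel (\<lambda>w. Y (origin d) w / ?r)) t" for z
    proof -
      have "distr P borel (\<lambda>w. Y z w / ?r)
          = distr (distr P borel (\<lambda>w. cube_energy d k z (weights w))) borel (\<lambda>x. (x - cube_mean k) / ?r)" for z
        unfolding Y_def using cube_energy_weights_measurable by (subst distr_distr) (auto simp: comp_def)
      then show ?thesis using cube_energy_distr[OF k] by metis
    qed
    have ind: "indep_vars (\<lambda>_. borel) (\<lambda>i w. Y (f i) w / ?r) A"
      if "inj_on f A" "\<And>i. i \<in> A \<Longrightarrow> length (f i) = d" for f and A :: "'b set"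
      unfolding Y_def
      by (rule indep_vars_compose2[OF cube_energy_indep[OF k that], where Y = "\<lambda>_ x. (x - cube_mean k) / ?r"])
        measurable
    have "char (distr P borel (Z (m n ^ d))) t = char (distr P borel (\<lambda>w. \<Sum>i<m n ^ d. Y (zz i) w / ?r)) t"
      unfolding Z_def by (simp add: sum_divide_distrib)
    also have "\<dots> = (\<Prod>i<m n ^ d. char (distr P borel (\<lambda>w. Y (zz i) w / ?r)) t)"
      using zz by (intro char_distr_sum ind) (auto intro: inj_on_subset)
    also have "\<dots> = char (distr P borel (\<lambda>w. Y (origin d) w / ?r)) t ^ (m n ^ d)"
      by (subst char_Y) simp
    also have "\<dots> = (\<Prod>z\<in>torus_vertices (m n) d. char (distr P borel (\<lambda>w. Y z w / ?r)) t)"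
      by (subst (2) char_Y) (simp add: card_torus_vertices)
    also have "\<dots> = char (distr P borel (\<lambda>w. \<Sum>z\<in>torus_vertices (m n) d. Y z w / ?r)) t"
      by (rule char_distr_sum[symmetric], rule ind) (auto simp: torus_vertices_def)
    also have "\<dots> = char (distr P borel (\<lambda>w. cube_sum k (m n) w / ?r)) t"
      by (simp add: cube_sum_def[abs_def] Y_def sum_divide_distrib)
    finally show ?thesis using cube_sum_second_moment(2)[OF k, of "m n"] by simp
  qed
  ultimately show ?thesis by simp
qed

subsection \<open>Central limit theorem for the ground state energy\<close>

text \<open>Per direction, a fraction of at most \<open>1/k\<close> of \<open>n\<close> is lost to
  the walls and another to the incomplete cell at the end, which is shorter than \<open>k\<close>
  and hence than \<open>n/k\<close> because \<open>k * k \<le> n\<close>. So at least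
  \<open>n * (1 - 2/k)\<close> coordinates remain.\<close>

lemma card_outside_cubes:
  assumes k: "2 \<le> k" and n: "k * k \<le> n" and m: "m = n div k"
  shows "real (card (torus_vertices n d - (\<Union>z\<in>torus_vertices m d. cube d k z))) \<le> 2 * real d / real k * real n ^ d"
    "(\<Union>z\<in>torus_vertices m d. cube d k z) \<subseteq> torus_vertices n d"
proof -
  let ?V = "\<Union>z\<in>torus_vertices m d. cube d k z"
  have mk: "m * k \<le> n" by (simp add: m)
  show sub: "?V \<subseteq> torus_vertices n d" using cube_subset_torus[OF _ mk] by blast
  have len: "length z = d" if "z \<in> torus_vertices m d" for z using that by (simp add: torus_vertices_def)
  have "card ?V = (\<Sum>z\<in>torus_vertices m d. card (cube d k z))"
    using k len by (intro card_UN_disjoint finite_torus_vertices) (auto simp: finite_cube cube_disjoint)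
  also have "\<dots> = (\<Sum>z\<in>torus_vertices m d. (k - 1) ^ d)"
    using k len by (intro sum.cong refl card_cube) auto
  also have "\<dots> = (m * (k - 1)) ^ d" by (simp add: card_torus_vertices power_mult_distrib)
  finally have cardV: "card ?V = (m * (k - 1)) ^ d" .
  define x where "x = 1 - 2 / real k"
  have k0: "0 < real k" using k by simp
  have x0: "0 \<le> x" using k by (simp add: x_def field_simps)
  have "real k * real k \<le> real n" using n by (metis of_nat_le_iff of_nat_mult)
  then have kn: "real k \<le> real n / real k" using k0 by (simp add: field_simps)
  have "n < m * k + k" using k div_mult_mod_eq[of n k] mod_less_divisor[of k n] unfolding m by linarith
  then have "real n < real m * real k + real k" by (metis of_nat_add of_nat_less_iff of_nat_mult)
  then have "real n / real k - 1 \<le> real m" using k0 by (simp add: field_simps)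
  then have "(real n / real k - 1) * (real k - 1) \<le> real m * (real k - 1)"
    using k by (intro mult_right_mono) auto
  moreover have "(real n / real k - 1) * (real k - 1) = real n - real k - real n / real k + 1"
    using k0 by (simp add: field_simps)
  moreover have "real n * x = real n - real n / real k - real n / real k"
    by (simp add: x_def right_diff_distrib)
  ultimately have le: "real n * x \<le> real m * (real k - 1)" using kn by linarith
  have "real n ^ d * (1 - 2 * real d / real k) \<le> real n ^ d * x ^ d"
  proof (intro mult_left_mono)
    \<comment> \<open>Bernoulli turns the fraction kept in \<open>d\<close> directions into a linear
      bound; \<open>2 \<le> k\<close> keeps the base nonnegative.\<close>
    have "1 + real d * (- (2 / real k)) \<le> (1 + (- (2 / real k))) ^ d"
      using k by (intro Bernoulli_inequality) (simp add: field_simps)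
    then show "1 - 2 * real d / real k \<le> x ^ d" by (simp add: x_def mult.commute)
  qed simp
  also have "\<dots> = (real n * x) ^ d" by (simp add: power_mult_distrib)
  also have "\<dots> \<le> (real m * (real k - 1)) ^ d" using le x0 by (intro power_mono) auto
  also have "\<dots> = real (card ?V)" unfolding cardV using k by (simp add: of_nat_diff)
  finally have "real n ^ d - real (card ?V) \<le> 2 * real d / real k * real n ^ d"
    by (simp add: algebra_simps)
  moreover have "card (torus_vertices n d - ?V) = n ^ d - card ?V"
    using sub finite_torus_vertices by (subst card_Diff_subset) (auto simp: card_torus_vertices finite_subset)
  moreover have "card ?V \<le> n ^ d"
    using card_mono[OF finite_torus_vertices sub] by (simp add: card_torus_vertices)
  ultimately show "real (card (torus_vertices n d - ?V)) \<le> 2 * real d / real k * real n ^ d"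
    by (simp add: of_nat_diff)
qed

definition centered_energy :: "nat \<Rightarrow> 'w \<Rightarrow> real" where
  "centered_energy n w = torus_energy n (torus_vertices n d) (weights w)
    - (\<integral>w. torus_energy n (torus_vertices n d) (weights w) \<partial>P)"

lemma cube_approximation:
  assumes \<epsilon>: "0 < \<epsilon>"
  shows "\<exists>k\<ge>2. \<forall>\<^sub>F n in sequentially.
    (\<integral>w. (centered_energy n w - cube_sum k (n div k) w)\<^sup>2 \<partial>P) \<le> \<epsilon> * real n ^ d"
proof -
  obtain \<rho> where \<rho>: "0 < \<rho>" and le: "\<And>n W. 1 \<le> n \<Longrightarrow> W \<subseteq> torus_vertices n d \<Longrightarrow>
      real (card W) \<le> \<rho> * real n ^ d \<Longrightarrow> variance (\<lambda>w. torus_energy n (torus_vertices n d) (weights w)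
      - torus_energy n (torus_vertices n d - W) (weights w)) \<le> \<epsilon> * real n ^ d"
    using torus_variance_diff_le[OF \<epsilon>] by blast
  \<comment> \<open>Chosen so that the density of vertices outside the cubes, at most
    \<open>2 * real d / real k\<close>, does not exceed \<rho>.\<close>
  define k where "k = max 2 (nat \<lceil>2 * real d / \<rho>\<rceil>)"
  have k: "2 \<le> k" by (simp add: k_def)
  have "2 * real d / \<rho> \<le> real k" unfolding k_def by linarith
  then have k\<rho>: "2 * real d / real k \<le> \<rho>" using \<rho> k by (simp add: field_simps)
  have "(\<integral>w. (centered_energy n w - cube_sum k (n div k) w)\<^sup>2 \<partial>P) \<le> \<epsilon> * real n ^ d" if n: "k * k \<le> n" for n
  proof -
    interpret T: disordered_cover "covers n" "torus_sites n d" "torus_vertices n d" Vtx P \<mu> J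
      by (rule torus_disordered_cover)
    let ?U = "torus_vertices n d" and ?m = "n div k"
    let ?V = "\<Union>z\<in>torus_vertices ?m d. cube d k z"
    have n1: "1 \<le> n" using n k by (metis One_nat_def Suc_leI le_trans mult_pos_pos not_numeral_le_zero gr0I)
    note cc = card_outside_cubes[OF k n refl]
    have W: "?U - (?U - ?V) = ?V" using cc(2) by blast
    have "real (card (?U - ?V)) \<le> \<rho> * real n ^ d"
      using cc(1) mult_right_mono[OF k\<rho>, of "real n ^ d"] by simp
    from le[OF n1 Diff_subset this]
    have var: "variance (\<lambda>w. torus_energy n ?U (weights w) - torus_energy n ?V (weights w)) \<le> \<epsilon> * real n ^ d"
      unfolding W .
    have V_eq: "torus_energy n ?V K = (\<Sum>z\<in>torus_vertices ?m d. cube_energy d k z K)" for K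
      using k by (intro torus_energy_cubes) auto
    have len: "length z = d" if "z \<in> torus_vertices ?m d" for z using that by (simp add: torus_vertices_def)
    have V_int: "integrable P (\<lambda>w. torus_energy n ?V (weights w))"
      by (rule T.H_weights_integrable(2)[OF cc(2) torus_nonempty[OF n1]])
    have U_int: "integrable P (\<lambda>w. torus_energy n ?U (weights w))"
      by (rule T.H_weights_integrable(2)[OF order_refl torus_nonempty[OF n1]])
    have "(\<integral>w. torus_energy n ?V (weights w) \<partial>P) = (\<Sum>z\<in>torus_vertices ?m d. cube_mean k)"
      unfolding V_eq using cube_centered(2)[OF k len] cube_moments(1)[OF k]
      by (subst Bochner_Integration.integral_sum) auto
    \<comment> \<open>The expected energy of the union of the cubes is the sum of the cube means, so
      the two centerings combine to that of the energy difference.\<close>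
    then have "centered_energy n w - cube_sum k ?m w = torus_energy n ?U (weights w) - torus_energy n ?V (weights w)
        - (\<integral>w. torus_energy n ?U (weights w) - torus_energy n ?V (weights w) \<partial>P)" for w
      unfolding Bochner_Integration.integral_diff[OF U_int V_int]
      by (simp add: centered_energy_def cube_sum_def V_eq sum_subtractf)
    then show ?thesis using var by simp
  qed
  then have "\<forall>\<^sub>F n in sequentially.
      (\<integral>w. (centered_energy n w - cube_sum k (n div k) w)\<^sup>2 \<partial>P) \<le> \<epsilon> * real n ^ d"
    using eventually_ge_at_top[of "k * k"] by (rule eventually_mono[rotated])
  then show ?thesis using k by blast
qed

lemma energy_clt:
  "weak_conv_m (\<lambda>n. distr P borel (\<lambda>w. centered_energy n w / sqrt (\<integral>w. (centered_energy n w)\<^sup>2 \<partial>P)))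
    std_normal_distribution"
proof -
  have meas: "centered_energy n \<in> borel_measurable P" for n
  proof -
    interpret T: disordered_cover "covers n" "torus_sites n d" "torus_vertices n d" Vtx P \<mu> J
      by (rule torus_disordered_cover)
    show ?thesis unfolding centered_energy_def[abs_def]
      by (intro borel_measurable_diff borel_measurable_const T.H_weights_measurable order_refl)
  qed
  obtain c where c: "0 < c"
    "\<And>n. 1 \<le> n \<Longrightarrow> c * real n ^ d \<le> variance (\<lambda>w. torus_energy n (torus_vertices n d) (weights w))"
    using torus_variance_ge by blast
  show ?thesis
  proof (rule clt_by_approximation[OF meas c(1), where w = "\<lambda>n. real n ^ d"])
    have "0 < real n ^ d \<and> integrable P (\<lambda>w. (centered_energy n w)\<^sup>2) \<and>
        c * real n ^ d \<le> (\<integral>w. (centered_energy n w)\<^sup>2 \<partial>P)" if n: "1 \<le> n" for n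
    proof -
      interpret T: disordered_cover "covers n" "torus_sites n d" "torus_vertices n d" Vtx P \<mu> J
        by (rule torus_disordered_cover)
      have "integrable P (\<lambda>w. (centered_energy n w)\<^sup>2)"
        unfolding centered_energy_def
        by (rule square_expectation_decomp(1)[OF T.H_weights_integrable(2,1)[OF order_refl torus_nonempty[OF n]]])
      then show ?thesis using c(2)[OF n] n by (simp add: centered_energy_def)
    qed
    then show "\<forall>\<^sub>F n in sequentially. 0 < real n ^ d \<and> integrable P (\<lambda>w. (centered_energy n w)\<^sup>2) \<and>
        c * real n ^ d \<le> (\<integral>w. (centered_energy n w)\<^sup>2 \<partial>P)"
      using eventually_ge_at_top[of 1] by (rule eventually_mono[rotated])
  next
    fix \<epsilon> :: real assume "0 < \<epsilon>"
    then obtain k where k: "2 \<le> k" and ev: "\<forall>\<^sub>F n in sequentially.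
        (\<integral>w. (centered_energy n w - cube_sum k (n div k) w)\<^sup>2 \<partial>P) \<le> \<epsilon> * real n ^ d"
      using cube_approximation by blast
    note sm = cube_sum_second_moment[OF k]
    \<comment> \<open>Eventual positivity of the second moments excludes
      \<open>cube_variance k = 0\<close>, the case in which the cube sums could not be
      normalized.\<close>
    have lim: "\<forall>t. (\<lambda>n. char (distr P borel (\<lambda>w. cube_sum k (n div k) w / sqrt (\<integral>w. (cube_sum k (n div k) w)\<^sup>2 \<partial>P))) t)
        \<longlonglongrightarrow> char std_normal_distribution t"
      if pos: "\<forall>\<^sub>F n in sequentially. 0 < (\<integral>w. (cube_sum k (n div k) w)\<^sup>2 \<partial>P)"
    proof -
      obtain n where "0 < (\<integral>w. (cube_sum k (n div k) w)\<^sup>2 \<partial>P)"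
        using eventually_happens[OF pos] by auto
      then have "0 < cube_variance k" unfolding sm(2) by (simp add: zero_less_mult_iff)
      moreover have "filterlim (\<lambda>n. n div k) at_top sequentially"
        using k by (intro filterlim_at_top_div_const_nat) simp
      ultimately show ?thesis using cube_sum_clt[OF k] by blast
    qed
    show "\<exists>T. (\<forall>n. T n \<in> borel_measurable P) \<and>
      (\<forall>\<^sub>F n in sequentially. integrable P (\<lambda>x. (T n x)\<^sup>2) \<and>
        (\<integral>x. (centered_energy n x - T n x)\<^sup>2 \<partial>P) \<le> \<epsilon> * real n ^ d) \<and>
      ((\<forall>\<^sub>F n in sequentially. 0 < (\<integral>x. (T n x)\<^sup>2 \<partial>P)) \<longrightarrow>
        (\<forall>t. (\<lambda>n. char (distr P borel (\<lambda>x. T n x / sqrt (\<integral>x. (T n x)\<^sup>2 \<partial>P))) t)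
        \<longlonglongrightarrow> char std_normal_distribution t))"
      by (rule exI[of _ "\<lambda>n. cube_sum k (n div k)"]) (use ev sm(1) cube_sum_measurable lim in simp)
  qed
qed

end

theorem theorem1p4:
  fixes P :: "'w measure" and J :: "site \<Rightarrow> 'w \<Rightarrow> real" and d :: nat
    and \<mu> :: "real measure" and \<delta> :: real
  assumes "prob_space P"
    and "d \<ge> 2"
    and "prob_space.indep_vars P (\<lambda>_. borel) J (sites_Zd d)"
    and "\<forall>x \<in> sites_Zd d. distr P borel (J x) = \<mu>"
    and "good_distribution \<mu>"
    and "\<delta> > 0"
    and "\<forall>x \<in> sites_Zd d. integrable P (\<lambda>\<omega>. \<bar>J x \<omega>\<bar> powr (4 + \<delta>))"
  shows "weak_conv_m
     (\<lambda>n. distr P borel (\<lambda>\<omega>.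
        (ground_state_energy n d (\<lambda>x. J x \<omega>)
           - (\<integral>\<omega>'. ground_state_energy n d (\<lambda>x. J x \<omega>') \<partial>P))
        / sqrt (\<integral>\<omega>'. (ground_state_energy n d (\<lambda>x. J x \<omega>')
                      - (\<integral>\<omega>''. ground_state_energy n d (\<lambda>x. J x \<omega>'') \<partial>P))\<^sup>2 \<partial>P)))
     std_normal_distribution"
proof -
  interpret P: prob_space P by fact
  define x0 where "x0 = Vtx (replicate d 0)"
  have x0: "x0 \<in> sites_Zd d" by (simp add: x0_def sites_Zd_def)
  have meas: "J x \<in> borel_measurable P" if "x \<in> sites_Zd d" for x
    using assms(3) that unfolding P.indep_vars_def by blast
  have \<mu>: "\<mu> = distr P borel (J x0)" using assms(4) x0 by simp
  have "integrable P (\<lambda>\<omega>. (J x0 \<omega>)\<^sup>2)"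
  proof (rule integrable_nonneg_bound)
    show "integrable P (\<lambda>\<omega>. 1 + \<bar>J x0 \<omega>\<bar> powr (4 + \<delta>))" using assms(7) x0 by simp
    show "(\<lambda>\<omega>. (J x0 \<omega>)\<^sup>2) \<in> borel_measurable P" using meas[OF x0] by measurable
    \<comment> \<open>Below modulus one the constant dominates the square, above it the larger power
      does.\<close>
    have "y\<^sup>2 \<le> 1 + \<bar>y\<bar> powr (4 + \<delta>)" for y :: real
    proof (cases "\<bar>y\<bar> \<le> 1")
      case True
      then show ?thesis using abs_square_le_1[of y] by (simp add: add_increasing2)
    next
      case False
      then have "\<bar>y\<bar> powr 2 \<le> \<bar>y\<bar> powr (4 + \<delta>)" using assms(6) by (intro powr_mono) auto
      then show ?thesis using False by (simp add: powr_numeral)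
    qed
    then show "(J x0 \<omega>)\<^sup>2 \<le> 1 + \<bar>J x0 \<omega>\<bar> powr (4 + \<delta>)" for \<omega> .
  qed simp
  then have sq: "integrable \<mu> (\<lambda>x. x\<^sup>2)" unfolding \<mu> using meas[OF x0] by (subst integrable_distr_eq) auto
  interpret \<mu>: prob_space \<mu> unfolding \<mu> by (rule P.prob_space_distr[OF meas[OF x0]])
  obtain b0 where b0: "\<And>a b. b0 \<le> a \<Longrightarrow> a < b \<Longrightarrow> 0 < emeasure \<mu> {a<..<b}"
    using good_distribution_positive[OF assms(5)] by blast
  interpret lattice_weights P \<mu> J d b0
  proof
    show "sets \<mu> = sets borel" by (simp add: \<mu>)
    show "0 < measure \<mu> {a<..<b}" if "b0 \<le> a" "a < b" for a b
      using b0[OF that] by (simp add: \<mu>.emeasure_eq_measure)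
  qed (use assms sq in auto)
  show ?thesis using energy_clt unfolding centered_energy_def ground_state_energy_eq .
qed

end
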